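(* Let $f(z)$ be a transcendental meromorphic function in $\mathbb{C}$ with hyper order $\sigma_2(f)<1$. Let $$F(z,f)=f(z+c_1)^{i_1}f(z+c_2)^{i_2}\cdots f(z+c_m)^{i_m},$$ where $m\ge 1$ is an integer, $i_1,\dots,i_m$ are positive integers, and $c_1,\dots,c_m$ are distinct non-zero complex constants. Let $d_F=i_1+\cdots+i_m$ be the degree of $F(z,f)$ and let $n>d_F$ be an integer. If $s(z)\not\equiv 0$ is a small meromorphic function of $f(z)$, then $$2\overline{N}\left(r,\frac{1}{f(z)^nF(z,f)-s(z)}\right)\ge (n-1)T(r,f(z))-d_FN(r,f(z))-(2m+1)\overline{N}(r,f(z))+S(r,f).$$ In particular, if $F(z,f)=f(z+\eta)$ with $\eta\in\mathbb{C}\setminus\{0\}$ (so $m=d_F=1$ and $n>1$), then $$2\overline{N}\left(r,\frac{1}{f(z)^nf(z+\eta)-s(z)}\right)\ge (n-1)T(r,f(z))-N(r,f(z))-3\overline{N}(r,f(z))+S(r,f).$$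
   Context: Standard notation of Nevanlinna theory is used: $T(r,f)$ is the characteristic function, $N(r,f)$ and $\overline{N}(r,f)$ are the integrated counting functions of the poles of $f$ counted with multiplicity and without multiplicity respectively. The hyper order is $\sigma_2(f)=\limsup_{r\to\infty}\frac{\log^+\log^+T(r,f)}{\log r}$. $S(r,f)$ denotes any real function that is $o(T(r,f))$ as $r\to\infty$ outside a possible exceptional set $E$ of finite logarithmic measure ($\int_{E\cap[1,\infty)}dr/r<\infty$); an inequality containing a term $S(r,f)$ asserts that it holds with some such function. A meromorphic function $\alpha$ is a small function of $f$ if $T(r,\alpha)=S(r,f)$. *)

theory Defs
  imports "HOL-Complex_Analysis.Complex_Analysis" "HOL-Library.Landau_Symbols"
begin

text \<open>
  A meromorphic function in the plane is a function \<open>f\<close> with \<open>f meromorphic_on UNIV\<close>; its values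
  at poles and at removable singularities are irrelevant. Identities between meromorphic functions
  are therefore stated off a sparse set, i.e. with the filter \<open>cosparse UNIV\<close>.
\<close>

definition rational_meromorphic :: "(complex \<Rightarrow> complex) \<Rightarrow> bool" where
  "rational_meromorphic f \<longleftrightarrow>
     (\<exists>p q. q \<noteq> 0 \<and> eventually (\<lambda>z. f z = poly p z / poly q z) (cosparse UNIV))"

definition transcendental_meromorphic :: "(complex \<Rightarrow> complex) \<Rightarrow> bool" where
  "transcendental_meromorphic f \<longleftrightarrow> f meromorphic_on UNIV \<and> \<not> rational_meromorphic f"

definition log_plus :: "real \<Rightarrow> real" where
  "log_plus x = ln (max 1 x)"

text \<open>The number of poles in the closed disc of radius \<open>t\<close>, with and without multiplicity.\<close>

definition pole_count :: "(complex \<Rightarrow> complex) \<Rightarrow> real \<Rightarrow> nat" where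
  "pole_count f t = (\<Sum>z | is_pole f z \<and> cmod z \<le> t. nat (- zorder f z))"

definition distinct_pole_count :: "(complex \<Rightarrow> complex) \<Rightarrow> real \<Rightarrow> nat" where
  "distinct_pole_count f t = card {z. is_pole f z \<and> cmod z \<le> t}"

definition integrated_count :: "(real \<Rightarrow> nat) \<Rightarrow> real \<Rightarrow> real" where
  "integrated_count \<nu> r =
     integral {0..r} (\<lambda>t. (real (\<nu> t) - real (\<nu> 0)) / t) + real (\<nu> 0) * ln r"

definition nev_N :: "real \<Rightarrow> (complex \<Rightarrow> complex) \<Rightarrow> real" where
  "nev_N r f = integrated_count (pole_count f) r"

definition nev_Nbar :: "real \<Rightarrow> (complex \<Rightarrow> complex) \<Rightarrow> real" where
  "nev_Nbar r f = integrated_count (distinct_pole_count f) r"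

definition nev_m :: "real \<Rightarrow> (complex \<Rightarrow> complex) \<Rightarrow> real" where
  "nev_m r f =
     1 / (2 * pi) * integral {0..2 * pi} (\<lambda>\<theta>. log_plus (cmod (f (of_real r * cis \<theta>))))"

definition nev_T :: "real \<Rightarrow> (complex \<Rightarrow> complex) \<Rightarrow> real" where
  "nev_T r f = nev_m r f + nev_N r f"

definition hyper_order :: "(complex \<Rightarrow> complex) \<Rightarrow> ereal" where
  "hyper_order f = Limsup at_top (\<lambda>r. ereal (log_plus (log_plus (nev_T r f)) / ln r))"

definition finite_log_measure :: "real set \<Rightarrow> bool" where
  "finite_log_measure E \<longleftrightarrow>
     E \<in> sets lebesgue \<and> (\<integral>\<^sup>+ r \<in> E \<inter> {1..}. ennreal (1 / r) \<partial>lebesgue) < \<infinity>"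

text \<open>The quantities denoted by \<open>S(r,f)\<close>. They are unrestricted on the exceptional set \<open>E\<close>.\<close>

definition nev_S :: "(complex \<Rightarrow> complex) \<Rightarrow> (real \<Rightarrow> real) set" where
  "nev_S f = {S. \<exists>E. finite_log_measure E \<and>
                  S \<in> o[inf at_top (principal (- E))](\<lambda>r. nev_T r f)}"

definition small_function :: "(complex \<Rightarrow> complex) \<Rightarrow> (complex \<Rightarrow> complex) \<Rightarrow> bool" where
  "small_function f \<alpha> \<longleftrightarrow> \<alpha> meromorphic_on UNIV \<and> (\<lambda>r. nev_T r \<alpha>) \<in> nev_S f"

definition shift_monomial ::
  "nat \<Rightarrow> (nat \<Rightarrow> complex) \<Rightarrow> (nat \<Rightarrow> nat) \<Rightarrow> (complex \<Rightarrow> complex) \<Rightarrow> complex \<Rightarrow> complex" where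
  "shift_monomial m c i f z = (\<Prod>k = 1..m. f (z + c k) ^ i k)"

definition shift_monomial_degree :: "nat \<Rightarrow> (nat \<Rightarrow> nat) \<Rightarrow> nat" where
  "shift_monomial_degree m i = (\<Sum>k = 1..m. i k)"

end

theory Submission
  imports Defs "HOL-Real_Asymp.Real_Asymp"
begin

text \<open>
  Put \<open>\<phi> = f\<^sup>n F - s\<close>, \<open>P = s (\<phi>'/\<phi> - s'/s)\<close> and \<open>Q = P / f\<^bsup>n-1\<^esup>\<close>. Differentiating \<open>f\<^sup>n F = \<phi> + s\<close>
  gives \<open>Q = f F (\<phi>'/\<phi> - n f'/f - F'/F)\<close>, so by Clunie's argument the proximity functions of both \<open>P\<close>
  and \<open>Q\<close> are small. Neither vanishes identically: otherwise \<open>f\<^sup>n F\<close> would be a constant multiple of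
  \<open>s\<close>, which is impossible for \<open>n > d\<^sub>F\<close>. Hence \<open>(n - 1) T(r,f) \<le> N(r,P) + N(r,Q) + S(r,f)\<close> by the
  first main theorem applied to \<open>Q\<close>. Off the zeros and poles of \<open>s\<close>, each zero of \<open>\<phi>\<close> is at most a
  simple pole of \<open>P\<close> and of \<open>Q\<close>, a pole of \<open>f\<close> is at most a simple pole of \<open>P\<close> and no pole of \<open>Q\<close>, and
  the remaining poles come from \<open>F\<close>.

  The lemmas on the logarithmic derivative and on \<open>f(z + c) / f(z)\<close> both follow from the Poisson formula
  for \<open>L'\<close>, where \<open>exp L\<close> is \<open>f\<close> divided by the Blaschke factors of its zeros and poles in a disc. Only
  circles on which \<open>f\<close> is analytic and without zeros are used; the excluded radii are countably many, so
  they belong to the exceptional set, and no logarithmic singularity is ever integrated.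
\<close>

section \<open>Exceptional sets of finite logarithmic measure\<close>

text \<open>The factor 2 is the price of using both \<open>P\<close> and \<open>Q\<close>: a zero of
  \<phi> may be a pole of each. The coefficient 2m + 1 is one for the poles of f, seen by
  \<open>P\<close>, and two for each shift, once in \<open>P\<close> and once in \<open>Q\<close>;
  the term d_F N(r,f) comes from the poles of F in \<open>Q\<close>, after shifted counting
  functions have been compared with unshifted ones. The hyper order enters only through regular
  growth: over a gap r^\<delta> neither T nor N gains more than a factor 1 + \<eta>, off a set of
  finite logarithmic measure. The gap tends to infinity, so it swallows a fixed shift and makes the
  error of the difference quotient smaller than T by a power of r. Transcendence enters through
  T(r,f) / ln r -> \<infinity>, which makes errors O(ln r) negligible. An error term S(r,f) must
  have one exceptional set for all \<epsilon>, but each step supplies a set depending on \<epsilon>.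
  A diagonal argument identifies the two notions, so the sets can stay hidden in a filter until the
  end.\<close>

definition log_measure :: "real measure" where
  "log_measure = density lebesgue (\<lambda>r. ennreal (1 / r) * indicator {1..} r)"

lemma sets_log_measure [simp]: "sets log_measure = sets lebesgue"
  by (simp add: log_measure_def)

lemma emeasure_log_measure:
  assumes "E \<in> sets lebesgue"
  shows "emeasure log_measure E = (\<integral>\<^sup>+ r \<in> E \<inter> {1..}. ennreal (1 / r) \<partial>lebesgue)"
proof -
  have m: "(\<lambda>r::real. ennreal (1 / r) * indicator {1..} r) \<in> borel_measurable lebesgue"
    by (intro measurable_completion) measurable
  show ?thesis
    unfolding log_measure_def using assms m
    by (subst emeasure_density)
       (auto intro!: nn_integral_cong simp: indicator_def split: if_splits)
qed

text \<open>Recasts the weighted integral as the value of a measure, so that countable subadditivity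
  and continuity from above become available for exceptional sets.\<close>

lemma finite_log_measure_iff:
  "finite_log_measure E \<longleftrightarrow> E \<in> sets log_measure \<and> emeasure log_measure E < \<infinity>"
  by (auto simp: finite_log_measure_def emeasure_log_measure)

lemma finite_log_measure_Un:
  "finite_log_measure A \<Longrightarrow> finite_log_measure B \<Longrightarrow> finite_log_measure (A \<union> B)"
  unfolding finite_log_measure_iff
  using emeasure_subadditive[of A log_measure B]
  by (auto simp: ennreal_add_less_top intro: order_le_less_trans)

lemma finite_log_measure_countable:
  assumes "countable A" shows "finite_log_measure A"
proof -
  have "A \<in> null_sets lborel" using assms by (rule countable_imp_null_set_lborel)
  hence n: "A \<in> null_sets lebesgue" by (simp add: null_sets_completionI)
  have "(\<integral>\<^sup>+ r \<in> A \<inter> {1..}. ennreal (1 / r) \<partial>lebesgue) = (\<integral>\<^sup>+ (r::real). 0 \<partial>lebesgue)"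
  proof (rule nn_integral_cong_AE)
    show "AE r in lebesgue. ennreal (1 / r) * indicator (A \<inter> {1..}) r = 0"
      using AE_not_in[OF n] by eventually_elim auto
  qed
  thus ?thesis using n by (auto simp: finite_log_measure_def)
qed

text \<open>Quantifying over the exceptional set inside the filter lets
  \<open>eventually_elim\<close> merge such sets silently. In \<open>nev_S\<close> the set is fixed
  before the constant of the small o; \<open>nev_S_eq_smallo\<close> shows that nothing is lost by
  this weaker reading.\<close>

definition nev_filter :: "real filter" where
  "nev_filter = Abs_filter (\<lambda>P. \<exists>E. finite_log_measure E \<and> eventually P (inf at_top (principal (- E))))"

lemma eventually_nev_filter:
  "eventually P nev_filter \<longleftrightarrow>
     (\<exists>E. finite_log_measure E \<and> eventually P (inf at_top (principal (- E))))"
  unfolding nev_filter_def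
proof (rule eventually_Abs_filter, standard, goal_cases)
  case 1
  show ?case by (rule exI[of _ "{}"]) (simp add: finite_log_measure_countable)
next
  case (2 P Q)
  then obtain E E' where "finite_log_measure E" "eventually P (inf at_top (principal (- E)))"
    "finite_log_measure E'" "eventually Q (inf at_top (principal (- E')))" by blast
  thus ?case
    by (intro exI[of _ "E \<union> E'"] conjI finite_log_measure_Un)
       (auto simp: eventually_inf_principal elim: eventually_elim2)
next
  case (3 P Q)
  thus ?case by (metis (mono_tags, lifting) eventually_mono)
qed

lemma eventually_at_top_imp_nev: "eventually P at_top \<Longrightarrow> eventually P nev_filter"
  unfolding eventually_nev_filter
  by (rule exI[of _ "{}"]) (simp add: finite_log_measure_countable)

lemma nev_filter_le_at_top: "nev_filter \<le> at_top"
  by (rule filter_leI) (rule eventually_at_top_imp_nev)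

lemma eventually_nev_not_in: "finite_log_measure E \<Longrightarrow> eventually (\<lambda>r. r \<notin> E) nev_filter"
  unfolding eventually_nev_filter by (rule exI[of _ E]) (auto simp: eventually_inf_principal)

text \<open>Continuity from above: the sets \<open>E \<inter> {real k..}\<close> have finite measure
  and decrease to the empty set.\<close>

lemma log_measure_tail:
  assumes "finite_log_measure E" "e > 0"
  shows "\<exists>x\<ge>x0. emeasure log_measure (E \<inter> {x..}) < e"
proof -
  let ?A = "\<lambda>k::nat. E \<inter> {real k..}"
  have E: "E \<in> sets log_measure" "emeasure log_measure E < \<infinity>"
    using assms by (auto simp: finite_log_measure_iff)
  have "(\<lambda>k. emeasure log_measure (?A k)) \<longlonglongrightarrow> emeasure log_measure (\<Inter>k. ?A k)"
  proof (rule Lim_emeasure_decseq)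
    show "range ?A \<subseteq> sets log_measure" using E by auto
    show "decseq ?A" by (auto simp: decseq_def)
    show "emeasure log_measure (?A k) \<noteq> \<infinity>" for k
      using E emeasure_mono[of "?A k" E log_measure] by (auto simp: less_top[symmetric] top_unique)
  qed
  moreover have "(\<Inter>k. ?A k) = {}"
  proof -
    have "\<exists>k. x \<notin> ?A k" for x
      using reals_Archimedean2[of x] by (auto simp: not_le)
    thus ?thesis by blast
  qed
  ultimately have "(\<lambda>k. emeasure log_measure (?A k)) \<longlonglongrightarrow> 0" by simp
  hence "eventually (\<lambda>k. emeasure log_measure (?A k) < e) sequentially"
    using assms(2) by (auto simp: order_tendsto_iff)
  moreover have "eventually (\<lambda>k::nat. real k \<ge> x0) sequentially"
    using eventually_ge_at_top[of "nat \<lceil>x0\<rceil>"] by eventually_elim linarith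
  ultimately have "eventually (\<lambda>k. emeasure log_measure (?A k) < e \<and> real k \<ge> x0) sequentially"
    by (rule eventually_conj)
  then obtain k where "emeasure log_measure (?A k) < e" "real k \<ge> x0"
    by (auto simp: eventually_sequentially)
  thus ?thesis by blast
qed

text \<open>Bounding the density 1/r by its value at an end point is precise enough for all uses, so
  the exact value ln (b / a) is never computed.\<close>

lemma log_measure_interval_upper:
  assumes "1 \<le> a" "a \<le> b"
  shows "emeasure log_measure {a..b} \<le> ennreal ((b - a) / a)"
proof -
  have "emeasure log_measure {a..b} = (\<integral>\<^sup>+ r \<in> {a..b} \<inter> {1..}. ennreal (1 / r) \<partial>lebesgue)"
    by (simp add: emeasure_log_measure)
  also have "\<dots> \<le> (\<integral>\<^sup>+ r. ennreal (1 / a) * indicator {a..b} r \<partial>lebesgue)"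
    using assms by (intro nn_integral_mono)
      (auto simp: indicator_def intro!: ennreal_leI divide_left_mono)
  also have "\<dots> = ennreal (1 / a) * ennreal (b - a)"
    using assms by (subst nn_integral_cmult_indicator) auto
  also have "\<dots> = ennreal ((b - a) / a)"
    using assms by (simp add: ennreal_mult[symmetric])
  finally show ?thesis .
qed

lemma log_measure_interval_lower:
  assumes "1 \<le> a" "a \<le> b"
  shows "emeasure log_measure {a..b} \<ge> ennreal ((b - a) / b)"
proof -
  have "ennreal ((b - a) / b) = ennreal (1 / b) * ennreal (b - a)"
    using assms by (simp add: ennreal_mult[symmetric])
  also have "\<dots> = (\<integral>\<^sup>+ r. ennreal (1 / b) * indicator {a..b} r \<partial>lebesgue)"
    using assms by (subst nn_integral_cmult_indicator) auto
  also have "\<dots> \<le> (\<integral>\<^sup>+ r \<in> {a..b} \<inter> {1..}. ennreal (1 / r) \<partial>lebesgue)"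
    using assms by (intro nn_integral_mono)
      (auto simp: indicator_def intro!: ennreal_leI divide_left_mono)
  also have "\<dots> = emeasure log_measure {a..b}" by (simp add: emeasure_log_measure)
  finally show ?thesis .
qed

text \<open>An interval [x, 2x] has logarithmic measure at least 1/2, more than is left of the
  exceptional set beyond \<open>x0\<close>. This turns a bound off an exceptional set into a bound
  at some radius on every scale.\<close>

lemma eventually_nev_dyadic:
  assumes "eventually P nev_filter"
  shows "\<exists>x0\<ge>1. \<forall>x\<ge>x0. \<exists>r\<in>{x..2*x}. P r"
proof -
  obtain E y where E: "finite_log_measure E" and y: "\<And>r. r \<ge> y \<Longrightarrow> r \<notin> E \<Longrightarrow> P r"
    using assms by (auto simp: eventually_nev_filter eventually_inf_principal eventually_at_top_linorder)
  obtain x0 where x0: "x0 \<ge> max 1 y" "emeasure log_measure (E \<inter> {x0..}) < ennreal (1/2)"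
    using log_measure_tail[OF E, of "ennreal (1/2)" "max 1 y"] by (auto simp del: ennreal_half)
  show ?thesis
  proof (intro exI[of _ x0] conjI allI impI)
    show "x0 \<ge> 1" using x0 by simp
    fix x assume x: "x \<ge> x0"
    have "\<not> {x..2*x} \<subseteq> E"
    proof
      assume "{x..2*x} \<subseteq> E"
      hence "emeasure log_measure {x..2*x} \<le> emeasure log_measure (E \<inter> {x0..})"
        using x E by (intro emeasure_mono) (auto simp: finite_log_measure_iff)
      moreover have "emeasure log_measure {x..2*x} \<ge> ennreal (1/2)"
      proof -
        have "(2*x - x) / (2*x) = 1/2" using x x0 by (simp add: field_simps)
        thus ?thesis using log_measure_interval_lower[of x "2*x"] x x0 by (simp only:)
      qed
      ultimately have "ennreal (1/2) \<le> emeasure log_measure (E \<inter> {x0..})" by (rule order_trans[rotated])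
      thus False using x0(2) by (simp add: leD)
    qed
    then obtain r where "r \<in> {x..2*x}" "r \<notin> E" by blast
    thus "\<exists>r\<in>{x..2*x}. P r" using y[of r] x x0 by (intro bexI[of _ r]) auto
  qed
qed

lemma nev_filter_neq_bot: "nev_filter \<noteq> bot"
proof
  assume "nev_filter = bot"
  hence "eventually (\<lambda>_. False) nev_filter" by simp
  from eventually_nev_dyadic[OF this] show False by auto
qed

text \<open>Of the j-th exceptional set only the part beyond \<open>x j\<close> is kept, where its
  measure is below (1/2)^(j+1); the union then has measure at most 1. Truncation is harmless because
  each property is only claimed eventually.\<close>

lemma eventually_nev_diagonal:
  assumes "\<And>j::nat. eventually (P j) nev_filter"
  shows "\<exists>E. finite_log_measure E \<and> (\<forall>j. eventually (P j) (inf at_top (principal (- E))))"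
proof -
  have "\<forall>j. \<exists>E y. finite_log_measure E \<and> (\<forall>r\<ge>y. r \<notin> E \<longrightarrow> P j r)"
    using assms by (simp add: eventually_nev_filter eventually_inf_principal eventually_at_top_linorder)
  then obtain E y where E: "\<And>j. finite_log_measure (E j)"
    and y: "\<And>j r. r \<ge> y j \<Longrightarrow> r \<notin> E j \<Longrightarrow> P j r" by metis
  have "\<forall>j. \<exists>x\<ge>y j. emeasure log_measure (E j \<inter> {x..}) < ennreal ((1/2)^Suc j)"
    using log_measure_tail[OF E] by simp
  then obtain x where x: "\<And>j. x j \<ge> y j"
    and xE: "\<And>j. emeasure log_measure (E j \<inter> {x j..}) < ennreal ((1/2)^Suc j)" by metis
  define F where "F = (\<Union>j. E j \<inter> {x j..})"
  have sets: "E j \<inter> {x j..} \<in> sets log_measure" for j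
    using E[of j] by (auto simp: finite_log_measure_iff)
  have "emeasure log_measure F \<le> (\<Sum>j. emeasure log_measure (E j \<inter> {x j..}))"
    unfolding F_def using sets by (intro emeasure_subadditive_countably) auto
  also have "\<dots> \<le> (\<Sum>j. ennreal ((1/2)^Suc j))"
    using xE by (intro suminf_le) (auto intro: less_imp_le)
  also have "\<dots> = ennreal 1"
    using power_half_series by (intro suminf_ennreal_eq) auto
  finally have "emeasure log_measure F < \<infinity>" by (rule order_le_less_trans) simp
  hence "finite_log_measure F" using sets by (auto simp: finite_log_measure_iff F_def)
  moreover have "eventually (P j) (inf at_top (principal (- F)))" for j
    unfolding eventually_inf_principal
    using eventually_ge_at_top[of "x j"]
  proof eventually_elim
    case (elim r)
    show ?case
    proof
      assume "r \<in> - F"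
      hence "r \<notin> E j" using elim by (auto simp: F_def)
      thus "P j r" using y[of j r] x[of j] elim by simp
    qed
  qed
  ultimately show ?thesis by blast
qed

text \<open>Left to right is immediate. Conversely, the constants 1 / (j + 1) suffice for a small o,
  and the diagonal lemma provides one exceptional set for all of them.\<close>

lemma nev_S_eq_smallo: "nev_S f = o[nev_filter](\<lambda>r. nev_T r f)"
proof (intro set_eqI iffI)
  fix S assume "S \<in> nev_S f"
  then obtain E where E: "finite_log_measure E"
    and S: "S \<in> o[inf at_top (principal (- E))](\<lambda>r. nev_T r f)" by (auto simp: nev_S_def)
  show "S \<in> o[nev_filter](\<lambda>r. nev_T r f)"
    by (rule landau_o.smallI) (use E landau_o.smallD[OF S] in \<open>auto simp: eventually_nev_filter\<close>)
next
  fix S assume S: "S \<in> o[nev_filter](\<lambda>r. nev_T r f)"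
  have "\<exists>E. finite_log_measure E \<and> (\<forall>j. eventually
          (\<lambda>r. norm (S r) \<le> (1 / real (Suc j)) * norm (nev_T r f)) (inf at_top (principal (- E))))"
    by (rule eventually_nev_diagonal, rule landau_o.smallD[OF S]) simp
  then obtain E where E: "finite_log_measure E" "\<And>j. eventually
          (\<lambda>r. norm (S r) \<le> (1 / real (Suc j)) * norm (nev_T r f)) (inf at_top (principal (- E)))" by blast
  have "S \<in> o[inf at_top (principal (- E))](\<lambda>r. nev_T r f)"
  proof (rule landau_o.smallI)
    fix c :: real assume "c > 0"
    then obtain j where j: "1 / real (Suc j) < c" using nat_approx_posE by blast
    show "eventually (\<lambda>r. norm (S r) \<le> c * norm (nev_T r f)) (inf at_top (principal (- E)))"
      using E(2)[of j]
      by eventually_elim (erule order_trans, rule mult_right_mono[OF less_imp_le[OF j] norm_ge_zero])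
  qed
  thus "S \<in> nev_S f" using E by (auto simp: nev_S_def)
qed

text \<open>Summation by parts. With \<open>a j = l j + l (j + 1)\<close> a double increment of
  \<open>l\<close> is a single increment of \<open>a\<close>, so the series is a telescoping one
  plus a series with terms of order j^(\<kappa> - 2), which converges because \<kappa> < 1.\<close>

lemma summable_growth_increments:
  fixes l :: "nat \<Rightarrow> real"
  assumes mono: "\<And>i j. 1 \<le> i \<Longrightarrow> i \<le> j \<Longrightarrow> l i \<le> l j"
    and nonneg: "\<And>j. 1 \<le> j \<Longrightarrow> 0 \<le> l j"
    and bound: "\<And>j. 1 \<le> j \<Longrightarrow> l j \<le> C * real j powr \<kappa>"
    and \<kappa>: "0 < \<kappa>" "\<kappa> < 1"
  shows "summable (\<lambda>j. (l (j + 3) - l (j + 1)) / real (j + 1))"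
proof -
  define a where "a j = l j + l (j + 1)" for j
  have C: "C \<ge> 0" using nonneg[of 1] bound[of 1] by simp
  have a0: "0 \<le> a j" if "1 \<le> j" for j
    using nonneg[of j] nonneg[of "j+1"] that by (simp add: a_def)
  have a_le: "a j \<le> 2 * C * real (j + 1) powr \<kappa>" if "1 \<le> j" for j
  proof -
    have "C * real j powr \<kappa> \<le> C * real (j + 1) powr \<kappa>"
      using C \<kappa> by (intro mult_left_mono powr_mono2) auto
    thus ?thesis using bound[of j] bound[of "j+1"] that by (simp add: a_def)
  qed
  have split: "(l (j + 3) - l (j + 1)) / real (j + 1)
      = (a (j + 2) / real (j + 2) - a (j + 1) / real (j + 1)) + a (j + 2) / (real (j + 1) * real (j + 2))" for j
  proof -
    have "l (j + 3) - l (j + 1) = a (j + 2) - a (j + 1)"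
      by (simp add: a_def numeral_eq_Suc)
    moreover have "a (j + 2) / real (j + 1) = a (j + 2) / real (j + 2) + a (j + 2) / (real (j + 1) * real (j + 2))"
      by (simp add: divide_simps del: of_nat_add) (simp add: algebra_simps)
    ultimately show ?thesis by (simp add: diff_divide_distrib)
  qed
  have sm: "summable (\<lambda>j. a (j + 2) / (real (j + 1) * real (j + 2)))"
  proof (rule summable_comparison_test')
    have "summable (\<lambda>j. real (Suc j) powr (\<kappa> - 2))"
      using \<kappa> by (subst summable_Suc_iff) (simp add: summable_real_powr_iff)
    thus "summable (\<lambda>j. 6 * C * real (Suc j) powr (\<kappa> - 2))" by (rule summable_mult)
    fix j :: nat assume "j \<ge> 0"
    have "a (j + 2) \<le> 2 * C * real (j + 3) powr \<kappa>" using a_le[of "j+2"] by (simp add: numeral_eq_Suc)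
    also have "\<dots> \<le> 2 * C * (3 * real (Suc j)) powr \<kappa>"
      using C \<kappa> by (intro mult_left_mono powr_mono2) auto
    also have "\<dots> = 2 * C * 3 powr \<kappa> * real (Suc j) powr \<kappa>"
      by (subst powr_mult) (auto simp only: mult.assoc)
    also have "\<dots> \<le> 2 * C * 3 powr 1 * real (Suc j) powr \<kappa>"
      using C \<kappa> by (intro mult_right_mono mult_left_mono powr_mono) auto
    finally have 1: "a (j + 2) \<le> 6 * C * real (Suc j) powr \<kappa>" by simp
    have "a (j + 2) / (real (j + 1) * real (j + 2)) \<le> 6 * C * real (Suc j) powr \<kappa> / (real (Suc j) * real (Suc j))"
      using 1 C by (intro frac_le mult_mono) auto
    also have "\<dots> = 6 * C * real (Suc j) powr (\<kappa> - 2)"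
      by (simp add: powr_diff powr_numeral power2_eq_square)
    finally show "norm (a (j + 2) / (real (j + 1) * real (j + 2))) \<le> 6 * C * real (Suc j) powr (\<kappa> - 2)"
      using a0[of "j+2"] by simp
  qed
  define B where "B = 4 * C + suminf (\<lambda>j. a (j + 2) / (real (j + 1) * real (j + 2)))"
  show ?thesis
  proof (rule bounded_imp_summable)
    show "0 \<le> (l (j + 3) - l (j + 1)) / real (j + 1)" for j
      using mono[of "j+1" "j+3"] by simp
    fix n
    have "(\<Sum>j\<le>n. (l (j + 3) - l (j + 1)) / real (j + 1))
        = (\<Sum>j\<le>n. a (j + 2) / real (j + 2) - a (j + 1) / real (j + 1))
          + (\<Sum>j\<le>n. a (j + 2) / (real (j + 1) * real (j + 2)))"
      by (subst split) (rule sum.distrib)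
    also have "(\<Sum>j\<le>n. a (j + 2) / real (j + 2) - a (j + 1) / real (j + 1)) = a (n + 2) / real (n + 2) - a 1"
      by (induction n) (simp_all add: numeral_eq_Suc)
    also have "a (n + 2) / real (n + 2) \<le> 4 * C"
    proof -
      have "a (n + 2) \<le> 2 * C * real (n + 3) powr \<kappa>" using a_le[of "n+2"] by (simp add: numeral_eq_Suc)
      also have "\<dots> \<le> 2 * C * real (n + 3) powr 1"
        using C \<kappa> by (intro mult_left_mono powr_mono) auto
      also have "\<dots> \<le> 2 * C * (2 * real (n + 2))" using C by (intro mult_left_mono) auto
      finally have "a (n + 2) \<le> 4 * C * real (n + 2)" by (simp add: algebra_simps)
      thus ?thesis by (simp add: divide_le_eq del: of_nat_add)
    qed
    also have "(\<Sum>j\<le>n. a (j + 2) / (real (j + 1) * real (j + 2))) \<le> suminf (\<lambda>j. a (j + 2) / (real (j + 1) * real (j + 2)))"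
      using a0 by (intro sum_le_suminf sm) auto
    finally show "(\<Sum>j\<le>n. (l (j + 3) - l (j + 1)) / real (j + 1)) \<le> B"
      using a0[of 1] by (simp add: B_def)
  qed
qed

text \<open>The plane is cut along the radii \<open>j\<^sup>\<beta>\<close>; the exceptional set is the union of those intervals
  on which \<open>\<Phi>\<close> grows by a factor \<open>1 + \<eta>\<close> over two steps.\<close>

lemma growth_lemma:
  fixes \<Phi> :: "real \<Rightarrow> real"
  assumes mono: "\<And>x y. 1 \<le> x \<Longrightarrow> x \<le> y \<Longrightarrow> \<Phi> x \<le> \<Phi> y"
    and ge1: "\<And>x. 1 \<le> x \<Longrightarrow> 1 \<le> \<Phi> x"
    and bound: "eventually (\<lambda>r. \<Phi> r \<le> exp (r powr \<rho>)) at_top"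
    and \<rho>: "0 < \<rho>" "\<rho> < 1" and \<eta>: "\<eta> > 0"
  shows "eventually (\<lambda>r. \<Phi> (r + r powr ((1 - \<rho>) / 2)) \<le> (1 + \<eta>) * \<Phi> r) nev_filter"
proof -
  define \<delta> where "\<delta> = (1 - \<rho>) / 2"
  \<comment> \<open>Chosen such that \<beta>\<delta> = \<beta> - 1: at the radius j^\<beta> the gap
    r^\<delta> is j^(\<beta> - 1), which fits between neighbouring cutting radii. At the same time
    \<beta>\<rho> < 1, the exponent that makes the increments of \<open>l\<close> summable.\<close>
  define \<beta> where "\<beta> = 2 / (1 + \<rho>)"
  have \<beta>: "1 < \<beta>" "\<beta> < 2" using \<rho> by (auto simp: \<beta>_def field_simps)
  have \<beta>\<delta>: "\<beta> * \<delta> = \<beta> - 1" using \<rho> by (simp add: \<beta>_def \<delta>_def field_simps)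
  have \<beta>\<rho>: "0 < \<beta> * \<rho>" "\<beta> * \<rho> < 1" using \<rho> by (auto simp: \<beta>_def field_simps)
  define x where "x j = real j powr \<beta>" for j :: nat
  have x_mono: "x i \<le> x j" if "i \<le> j" for i j
    using that \<beta> by (auto simp: x_def intro!: powr_mono2)
  have x1: "1 \<le> x j" if "1 \<le> j" for j
    using x_mono[OF that] by (simp add: x_def)
  define l where "l j = ln (\<Phi> (x j))" for j
  have \<Phi>1: "1 \<le> \<Phi> (x j)" if "1 \<le> j" for j using ge1[OF x1[OF that]] .
  have l_mono: "l i \<le> l j" if "1 \<le> i" "i \<le> j" for i j
    unfolding l_def using that \<Phi>1[of i] \<Phi>1[of j] mono[OF x1[of i] x_mono[of i j]] by simp
  have l0: "0 \<le> l j" if "1 \<le> j" for j using \<Phi>1[OF that] by (simp add: l_def)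
  obtain C where C: "\<And>j. 1 \<le> j \<Longrightarrow> l j \<le> C * real j powr (\<beta> * \<rho>)"
  proof -
    have "filterlim x at_top sequentially"
      unfolding x_def using \<beta> by real_asymp
    hence "eventually (\<lambda>j. \<Phi> (x j) \<le> exp (x j powr \<rho>)) sequentially"
      using bound by (rule eventually_compose_filterlim[rotated])
    then obtain j0 where j0: "\<And>j. j \<ge> j0 \<Longrightarrow> \<Phi> (x j) \<le> exp (x j powr \<rho>)"
      by (auto simp: eventually_sequentially)
    define j1 where "j1 = max 1 j0"
    have "l j \<le> (1 + l j1) * real j powr (\<beta> * \<rho>)" if j: "1 \<le> j" for j
    proof -
      have p1: "1 \<le> real j powr (\<beta> * \<rho>)" using j \<beta>\<rho> by (simp add: ge_one_powr_ge_zero)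
      have l1: "0 \<le> l j1" using l0[of j1] by (simp add: j1_def)
      show ?thesis
      proof (cases "j \<le> j1")
        case True
        hence "l j \<le> l j1" using l_mono j by simp
        also have "\<dots> \<le> (1 + l j1) * 1" by simp
        also have "\<dots> \<le> (1 + l j1) * real j powr (\<beta> * \<rho>)" using p1 l1 by (intro mult_left_mono) auto
        finally show ?thesis .
      next
        case False
        hence "\<Phi> (x j) \<le> exp (x j powr \<rho>)" by (intro j0) (simp add: j1_def)
        hence "l j \<le> ln (exp (x j powr \<rho>))"
          unfolding l_def using \<Phi>1[OF j] by (subst ln_le_cancel_iff) auto
        also have "\<dots> = 1 * real j powr (\<beta> * \<rho>)" by (simp add: x_def powr_powr)
        also have "\<dots> \<le> (1 + l j1) * real j powr (\<beta> * \<rho>)" using l1 by (intro mult_right_mono) auto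
        finally show ?thesis .
      qed
    qed
    thus ?thesis using that by blast
  qed
  \<comment> \<open>The offset by one keeps every index at least 1, where \<Phi> is known to be
    monotone and at least 1.\<close>
  define J where "J = {j. (1 + \<eta>) * \<Phi> (x (j + 1)) < \<Phi> (x (j + 3))}"
  define I where "I j = (if j \<in> J then {x (j + 1)..x (j + 2)} else {})" for j
  define E where "E = (\<Union>j. I j)"
  \<comment> \<open>For j in \<open>J\<close> the double increment of \<open>l\<close> is at least
    ln (1 + \<eta>), so \<open>b j\<close> dominates 3 / (j + 1), which in turn bounds the
    logarithmic measure of \<open>I j\<close>.\<close>
  define b where "b j = 3 / ln (1 + \<eta>) * ((l (j + 3) - l (j + 1)) / real (j + 1))" for j
  have sb: "summable b"
    unfolding b_def
    by (intro summable_mult summable_growth_increments[OF _ _ C \<beta>\<rho>] l_mono l0)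
  have b0: "0 \<le> b j" for j using l_mono[of "j+1" "j+3"] \<eta> by (simp add: b_def)
  have I_le: "emeasure log_measure (I j) \<le> ennreal (b j)" for j
  proof (cases "j \<in> J")
    case True
    \<comment> \<open>With t = 1 / (j + 1) <= 1 and \<beta> < 2: (1 + t)^\<beta> <= (1 + t)^2 <= 1 +
      3t.\<close>
    have "x (j + 2) \<le> x (j + 1) * (1 + 3 / real (j + 1))"
    proof -
      have "x (j + 2) = x (j + 1) * (1 + 1 / real (j + 1)) powr \<beta>"
      proof -
        have "real (j + 1) * (1 + 1 / real (j + 1)) = real (j + 2)" by (simp add: field_simps)
        thus ?thesis unfolding x_def by (subst powr_mult[symmetric]) (simp only:)
      qed
      also have "(1 + 1 / real (j + 1)) powr \<beta> \<le> (1 + 1 / real (j + 1)) powr 2"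
        using \<beta> by (intro powr_mono) auto
      also have "\<dots> = 1 + 2 / real (j + 1) + (1 / real (j + 1)) * (1 / real (j + 1))"
      proof -
        have "(1 + t) powr 2 = 1 + 2 * t + t * t" if "0 < t" for t :: real
          using that by (simp add: powr_numeral power2_eq_square algebra_simps)
        from this[of "1 / real (j + 1)"] show ?thesis by simp
      qed
      also have "\<dots> \<le> 1 + 2 / real (j + 1) + 1 * (1 / real (j + 1))"
        by (intro add_left_mono mult_right_mono) auto
      finally show ?thesis using x1[of "j+1"] by (simp add: mult_left_mono add.commute)
    qed
    hence "(x (j + 2) - x (j + 1)) / x (j + 1) \<le> 3 / real (j + 1)"
      using x1[of "j+1"] by (simp add: field_simps del: of_nat_add)
    also have "\<dots> \<le> b j"
    proof -
      have "ln ((1 + \<eta>) * \<Phi> (x (j + 1))) \<le> l (j + 3)"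
        unfolding l_def using True \<eta> \<Phi>1[of "j+1"] by (intro ln_mono mult_pos_pos) (auto simp: J_def)
      hence "ln (1 + \<eta>) \<le> l (j + 3) - l (j + 1)"
        using \<eta> \<Phi>1[of "j+1"] by (simp add: ln_mult l_def)
      hence "3 / ln (1 + \<eta>) * (ln (1 + \<eta>) / real (j + 1)) \<le> b j"
        unfolding b_def using \<eta> by (intro mult_left_mono divide_right_mono) auto
      thus ?thesis using \<eta> by simp
    qed
    finally have 1: "(x (j + 2) - x (j + 1)) / x (j + 1) \<le> b j" .
    have "emeasure log_measure (I j) \<le> ennreal ((x (j + 2) - x (j + 1)) / x (j + 1))"
      using True x_mono[of "j+1" "j+2"] x1[of "j+1"]
      by (simp add: I_def log_measure_interval_upper)
    also have "\<dots> \<le> ennreal (b j)" using 1 by (rule ennreal_leI)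
    finally show ?thesis .
  qed (simp add: I_def)
  have "emeasure log_measure E \<le> (\<Sum>j. emeasure log_measure (I j))"
    unfolding E_def by (intro emeasure_subadditive_countably) (auto simp: I_def)
  also have "\<dots> \<le> (\<Sum>j. ennreal (b j))"
    by (intro suminf_le I_le) auto
  also have "\<dots> = ennreal (suminf b)"
    by (intro suminf_ennreal2 b0 sb)
  finally have "emeasure log_measure E < \<infinity>" by (rule order_le_less_trans) simp
  moreover have "E \<in> sets log_measure" unfolding E_def by (auto simp: I_def)
  ultimately have E: "finite_log_measure E" by (simp add: finite_log_measure_iff)
  have main: "\<Phi> (r + r powr \<delta>) \<le> (1 + \<eta>) * \<Phi> r" if r: "1 \<le> r" "r \<notin> E" for r
  proof -
    \<comment> \<open>Thus \<open>r\<close> lies between \<open>x m\<close> and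
      \<open>x (m + 1)\<close>; being outside \<open>E\<close>, it forces the index m - 1 out of
      \<open>J\<close>.\<close>
    define m where "m = nat \<lfloor>r powr (1 / \<beta>)\<rfloor>"
    have r1: "1 \<le> r powr (1 / \<beta>)" using r \<beta> by (simp add: ge_one_powr_ge_zero)
    have m: "1 \<le> m" "real m \<le> r powr (1 / \<beta>)" "r powr (1 / \<beta>) \<le> real (m + 1)"
      using r1 unfolding m_def by linarith+
    have rr: "(r powr (1 / \<beta>)) powr \<beta> = r" using r \<beta> by (simp add: powr_powr)
    have lo: "x m \<le> r" using powr_mono2[of \<beta> "real m" "r powr (1/\<beta>)"] m \<beta> rr by (simp add: x_def)
    have hi: "r \<le> x (m + 1)"
      using powr_mono2[of \<beta> "r powr (1/\<beta>)" "real (m+1)"] m \<beta> rr by (simp add: x_def)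
    obtain j where j: "m = j + 1" using m by (metis add.commute le_add_diff_inverse)
    have "j \<notin> J" using r lo hi by (auto simp: E_def I_def j split: if_splits)
    hence nj: "\<Phi> (x (j + 3)) \<le> (1 + \<eta>) * \<Phi> (x (j + 1))" by (simp add: J_def not_less)
    \<comment> \<open>Two cutting steps contain the gap: (m + 1)^\<beta> + (m + 1)^(\<beta> - 1) =
      (m + 1)^(\<beta> - 1) (m + 2) <= (m + 2)^\<beta>.\<close>
    have "r + r powr \<delta> \<le> x (j + 3)"
    proof -
      have "r powr \<delta> \<le> x (m + 1) powr \<delta>" using hi r \<rho> by (intro powr_mono2) (auto simp: \<delta>_def)
      also have "\<dots> = real (m + 1) powr (\<beta> - 1)" by (simp add: x_def powr_powr \<beta>\<delta>)
      finally have "r + r powr \<delta> \<le> real (m + 1) powr \<beta> + real (m + 1) powr (\<beta> - 1)"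
        using hi by (simp add: x_def)
      also have "\<dots> = real (m + 1) powr (\<beta> - 1) * real (m + 2)"
        by (simp add: powr_diff field_simps)
      also have "\<dots> \<le> real (m + 2) powr (\<beta> - 1) * real (m + 2)"
        using \<beta> by (intro mult_right_mono powr_mono2) auto
      also have "\<dots> = x (j + 3)" by (simp add: powr_diff x_def j numeral_eq_Suc)
      finally show ?thesis .
    qed
    hence "\<Phi> (r + r powr \<delta>) \<le> \<Phi> (x (j + 3))" using r by (intro mono) (auto intro: add_increasing2)
    also note nj
    also have "(1 + \<eta>) * \<Phi> (x (j + 1)) \<le> (1 + \<eta>) * \<Phi> r"
      using \<eta> lo x1[OF m(1)] by (intro mult_left_mono mono) (auto simp: j)
    finally show ?thesis .
  qed
  show ?thesis
    using eventually_at_top_imp_nev[OF eventually_ge_at_top[of 1]] eventually_nev_not_in[OF E]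
    by eventually_elim (use main in \<open>simp add: \<delta>_def\<close>)
qed

section \<open>Integrated counting functions\<close>

definition locally_finite_weight :: "(complex \<Rightarrow> nat) \<Rightarrow> bool" where
  "locally_finite_weight w \<longleftrightarrow> (\<forall>r. finite {z. w z \<noteq> 0 \<and> cmod z \<le> r})"

text \<open>The value of the integrated counting function as a finite sum. The origin is covered
  without a special case: \<open>ln 0 = 0\<close> turns its summand into \<open>w 0\<close> times
  \<open>ln r\<close>, which is exactly the extra term of \<open>integrated_count\<close>.\<close>

definition weighted_N :: "(complex \<Rightarrow> nat) \<Rightarrow> real \<Rightarrow> real" where
  "weighted_N w r = (\<Sum>z | w z \<noteq> 0 \<and> cmod z \<le> r. real (w z) * (ln r - ln (cmod z)))"

lemma locally_finite_weightD: "locally_finite_weight w \<Longrightarrow> finite {z. w z \<noteq> 0 \<and> cmod z \<le> r}"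
  by (simp add: locally_finite_weight_def)

lemma locally_finite_weight_mono:
  assumes "locally_finite_weight w" "\<And>z. v z \<noteq> 0 \<Longrightarrow> w z \<noteq> 0"
  shows "locally_finite_weight v"
  unfolding locally_finite_weight_def
proof
  fix r show "finite {z. v z \<noteq> 0 \<and> cmod z \<le> r}"
    by (rule finite_subset[OF _ locally_finite_weightD[OF assms(1), of r]]) (use assms(2) in auto)
qed

lemma locally_finite_weight_add:
  assumes "locally_finite_weight v" "locally_finite_weight w"
  shows "locally_finite_weight (\<lambda>z. v z + w z)"
  unfolding locally_finite_weight_def
proof
  fix r show "finite {z. v z + w z \<noteq> 0 \<and> cmod z \<le> r}"
    by (rule finite_subset[OF _ finite_UnI[OF locally_finite_weightD[OF assms(1), of r]
          locally_finite_weightD[OF assms(2), of r]]]) auto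
qed

lemma locally_finite_weight_cmult:
  "locally_finite_weight w \<Longrightarrow> locally_finite_weight (\<lambda>z. k * w z)"
  by (erule locally_finite_weight_mono) simp

lemma locally_finite_weight_sum:
  assumes "finite A" "\<And>k. k \<in> A \<Longrightarrow> locally_finite_weight (w k)"
  shows "locally_finite_weight (\<lambda>z. \<Sum>k\<in>A. w k z)"
  using assms
proof (induction A)
  case empty
  show ?case by (simp add: locally_finite_weight_def)
qed (auto intro: locally_finite_weight_add)

lemma locally_finite_weight_shift:
  assumes "locally_finite_weight w"
  shows "locally_finite_weight (\<lambda>z. w (z + c))"
  unfolding locally_finite_weight_def
proof
  fix r
  have "{z. w (z + c) \<noteq> 0 \<and> cmod z \<le> r} \<subseteq> (\<lambda>z. z - c) ` {z. w z \<noteq> 0 \<and> cmod z \<le> r + cmod c}"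
  proof
    fix z assume "z \<in> {z. w (z + c) \<noteq> 0 \<and> cmod z \<le> r}"
    thus "z \<in> (\<lambda>z. z - c) ` {z. w z \<noteq> 0 \<and> cmod z \<le> r + cmod c}"
      by (intro image_eqI[of _ _ "z + c"]) (auto intro: norm_triangle_le)
  qed
  thus "finite {z. w (z + c) \<noteq> 0 \<and> cmod z \<le> r}"
    using locally_finite_weightD[OF assms, of "r + cmod c"] by (meson finite_imageI finite_subset)
qed

lemma weighted_N_eq_sum:
  assumes "finite A" "{z. w z \<noteq> 0 \<and> cmod z \<le> r} \<subseteq> A" "A \<subseteq> {z. cmod z \<le> r}"
  shows "weighted_N w r = (\<Sum>z\<in>A. real (w z) * (ln r - ln (cmod z)))"
  unfolding weighted_N_def using assms by (intro sum.mono_neutral_left) auto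

lemma weighted_N_mono_weight:
  assumes w: "locally_finite_weight w" and le: "\<And>z. v z \<le> w z" and r: "1 \<le> r"
  shows "weighted_N v r \<le> weighted_N w r"
proof -
  let ?A = "{z. w z \<noteq> 0 \<and> cmod z \<le> r}"
  have sub: "{z. v z \<noteq> 0 \<and> cmod z \<le> r} \<subseteq> ?A" using le by (auto intro: order_less_le_trans)
  have "weighted_N v r = (\<Sum>z\<in>?A. real (v z) * (ln r - ln (cmod z)))"
    using locally_finite_weightD[OF w] sub by (intro weighted_N_eq_sum) auto
  also have "\<dots> \<le> weighted_N w r"
    unfolding weighted_N_def
  proof (intro sum_mono mult_right_mono)
    fix z assume "z \<in> ?A"
    thus "0 \<le> ln r - ln (cmod z)" using r by (cases "z = 0") auto
  qed (use le in auto)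
  finally show ?thesis .
qed

lemma weighted_N_add:
  assumes "locally_finite_weight v" "locally_finite_weight w"
  shows "weighted_N (\<lambda>z. v z + w z) r = weighted_N v r + weighted_N w r"
proof -
  let ?A = "{z. v z \<noteq> 0 \<and> cmod z \<le> r} \<union> {z. w z \<noteq> 0 \<and> cmod z \<le> r}"
  have fin: "finite ?A" by (intro finite_UnI locally_finite_weightD assms)
  have "weighted_N (\<lambda>z. v z + w z) r = (\<Sum>z\<in>?A. real (v z + w z) * (ln r - ln (cmod z)))"
    by (rule weighted_N_eq_sum[OF fin]) auto
  moreover have "weighted_N v r = (\<Sum>z\<in>?A. real (v z) * (ln r - ln (cmod z)))"
    by (rule weighted_N_eq_sum[OF fin]) auto
  moreover have "weighted_N w r = (\<Sum>z\<in>?A. real (w z) * (ln r - ln (cmod z)))"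
    by (rule weighted_N_eq_sum[OF fin]) auto
  ultimately show ?thesis by (simp only: of_nat_add distrib_right sum.distrib)
qed

lemma weighted_N_cmult:
  assumes "locally_finite_weight w"
  shows "weighted_N (\<lambda>z. k * w z) r = real k * weighted_N w r"
proof -
  let ?A = "{z. w z \<noteq> 0 \<and> cmod z \<le> r}"
  have "weighted_N (\<lambda>z. k * w z) r = (\<Sum>z\<in>?A. real (k * w z) * (ln r - ln (cmod z)))"
    by (rule weighted_N_eq_sum[OF locally_finite_weightD[OF assms]]) auto
  thus ?thesis by (simp add: weighted_N_def sum_distrib_left mult_ac)
qed

lemma weighted_N_sum:
  assumes "finite A" "\<And>k. k \<in> A \<Longrightarrow> locally_finite_weight (w k)"
  shows "weighted_N (\<lambda>z. \<Sum>k\<in>A. w k z) r = (\<Sum>k\<in>A. weighted_N (w k) r)"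
  using assms
proof (induction A)
  case empty
  show ?case by (simp add: weighted_N_def)
next
  case (insert a A)
  thus ?case by (simp add: weighted_N_add locally_finite_weight_sum)
qed

lemma weighted_N_nonneg: "1 \<le> r \<Longrightarrow> 0 \<le> weighted_N w r"
  unfolding weighted_N_def
proof (rule sum_nonneg, rule mult_nonneg_nonneg)
  fix z assume "1 \<le> r" "z \<in> {z. w z \<noteq> 0 \<and> cmod z \<le> r}"
  thus "0 \<le> ln r - ln (cmod z)" by (cases "z = 0") auto
qed auto

text \<open>The truncation \<open>max r (cmod z)\<close> is the form in which circle means of
  Blaschke factors appear in Jensen's formula.\<close>

lemma weighted_N_diff:
  assumes w: "locally_finite_weight w" and r: "0 < r" "r \<le> R"
  shows "weighted_N w R - weighted_N w r =
     (\<Sum>z | w z \<noteq> 0 \<and> cmod z \<le> R. real (w z) * (ln R - ln (max r (cmod z))))"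
proof -
  let ?A = "\<lambda>r. {z. w z \<noteq> 0 \<and> cmod z \<le> r}"
  have "weighted_N w r = (\<Sum>z\<in>?A r. real (w z) * (ln r - ln (cmod z)))"
    by (simp add: weighted_N_def)
  also have "\<dots> = (\<Sum>z\<in>?A R. if cmod z \<le> r then real (w z) * (ln r - ln (cmod z)) else 0)"
    using r locally_finite_weightD[OF w, of R]
    by (intro sum.mono_neutral_cong_left) auto
  finally have "weighted_N w R - weighted_N w r = (\<Sum>z\<in>?A R. real (w z) * (ln R - ln (cmod z))
     - (if cmod z \<le> r then real (w z) * (ln r - ln (cmod z)) else 0))"
    by (simp add: weighted_N_def sum_subtractf)
  also have "\<dots> = (\<Sum>z\<in>?A R. real (w z) * (ln R - ln (max r (cmod z))))"
    by (intro sum.cong refl) (auto simp: max_def algebra_simps)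
  finally show ?thesis .
qed

lemma weighted_N_mono_radius:
  assumes w: "locally_finite_weight w" and r: "0 < r" "r \<le> R"
  shows "weighted_N w r \<le> weighted_N w R"
proof -
  have "0 \<le> weighted_N w R - weighted_N w r"
    unfolding weighted_N_diff[OF assms]
    by (intro sum_nonneg mult_nonneg_nonneg) (use r in \<open>auto intro!: ln_mono\<close>)
  thus ?thesis by simp
qed

text \<open>Every point of the smaller disc contributes at least ln R - ln r. This controls the
  number of zeros and poles by the characteristic at a larger radius.\<close>

lemma weighted_N_ge_count:
  assumes w: "locally_finite_weight w" and r: "1 \<le> r" "r \<le> R"
  shows "real (\<Sum>z | w z \<noteq> 0 \<and> cmod z \<le> r. w z) * (ln R - ln r) \<le> weighted_N w R"
proof -
  let ?A = "\<lambda>r. {z. w z \<noteq> 0 \<and> cmod z \<le> r}"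
  have "real (\<Sum>z\<in>?A r. w z) * (ln R - ln r) = (\<Sum>z\<in>?A r. real (w z) * (ln R - ln r))"
    by (simp add: sum_distrib_right)
  also have "\<dots> \<le> (\<Sum>z\<in>?A r. real (w z) * (ln R - ln (cmod z)))"
  proof (intro sum_mono mult_left_mono diff_left_mono)
    fix z assume z: "z \<in> ?A r"
    show "ln (cmod z) \<le> ln r"
      using z r by (cases "z = 0") auto
  qed simp
  also have "\<dots> \<le> (\<Sum>z\<in>?A R. real (w z) * (ln R - ln (cmod z)))"
  proof (rule sum_mono2)
    show "finite (?A R)" by (rule locally_finite_weightD[OF w])
    fix z assume "z \<in> ?A R - ?A r"
    thus "0 \<le> real (w z) * (ln R - ln (cmod z))" using r by (cases "z = 0") auto
  qed (use r in auto)
  finally show ?thesis by (simp add: weighted_N_def)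
qed

text \<open>The count minus its value at 0 is a sum of step functions, one for each nonzero point,
  and each step contributes the integral of 1/t from |z| to r. The origin returns through the term
  with \<open>ln r\<close>.\<close>

lemma integrated_count_eq_weighted_N:
  assumes w: "locally_finite_weight w" and r: "0 < r"
    and \<nu>: "\<And>t. \<nu> t = (\<Sum>z | w z \<noteq> 0 \<and> cmod z \<le> t. w z)"
  shows "integrated_count \<nu> r = weighted_N w r"
proof -
  let ?A = "\<lambda>r. {z. w z \<noteq> 0 \<and> cmod z \<le> r}"
  let ?B = "?A r - {0}"
  have fin: "finite (?A t)" for t by (rule locally_finite_weightD[OF w])
  have \<nu>0: "\<nu> 0 = w 0"
  proof -
    have "?A 0 = (if w 0 = 0 then {} else {0})" by auto
    thus ?thesis by (simp add: \<nu>)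
  qed
  have \<nu>t: "real (\<nu> t) - real (\<nu> 0) = (\<Sum>z\<in>?B. if cmod z \<le> t then real (w z) else 0)"
    if t: "0 \<le> t" "t \<le> r" for t
  proof -
    have "real (\<nu> t) = (\<Sum>z\<in>?A t. real (w z))" by (simp add: \<nu>)
    also have "\<dots> = (\<Sum>z\<in>insert 0 ?B. if cmod z \<le> t then real (w z) else 0)"
      using t fin[of r] by (intro sum.mono_neutral_cong_left) auto
    also have "\<dots> = real (w 0) + (\<Sum>z\<in>?B. if cmod z \<le> t then real (w z) else 0)"
      using fin[of r] t by (subst sum.insert) auto
    finally show ?thesis by (simp add: \<nu>0)
  qed
  have one: "((\<lambda>t. (if cmod z \<le> t then real (w z) else 0) / t) has_integral
       real (w z) * (ln r - ln (cmod z))) {0..r}" if z: "z \<in> ?B" for z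
  proof -
    have "((\<lambda>t. real (w z) * (1 / t)) has_integral real (w z) * (ln r - ln (cmod z))) {cmod z..r}"
      using z by (intro has_integral_mult_right fundamental_theorem_of_calculus)
        (auto intro!: derivative_eq_intros intro: less_le_trans[of 0 "cmod z"]
          simp flip: has_real_derivative_iff_has_vector_derivative)
    hence "((\<lambda>t. if t \<in> {cmod z..r} then real (w z) * (1 / t) else 0) has_integral
        real (w z) * (ln r - ln (cmod z))) {0..r}"
      using z by (subst has_integral_restrict) auto
    thus ?thesis by (rule has_integral_eq[rotated]) auto
  qed
  have "((\<lambda>t. \<Sum>z\<in>?B. (if cmod z \<le> t then real (w z) else 0) / t) has_integral
       (\<Sum>z\<in>?B. real (w z) * (ln r - ln (cmod z)))) {0..r}"
    using fin[of r] one by (intro has_integral_sum) auto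
  hence "((\<lambda>t. (real (\<nu> t) - real (\<nu> 0)) / t) has_integral
       (\<Sum>z\<in>?B. real (w z) * (ln r - ln (cmod z)))) {0..r}"
    by (rule has_integral_eq[rotated]) (simp add: \<nu>t sum_divide_distrib)
  hence "integrated_count \<nu> r = (\<Sum>z\<in>?B. real (w z) * (ln r - ln (cmod z))) + real (w 0) * ln r"
    by (simp add: integrated_count_def \<nu>0 integral_unique)
  also have "\<dots> = (\<Sum>z\<in>insert 0 ?B. real (w z) * (ln r - ln (cmod z)))"
    using fin[of r] by (subst sum.insert) auto
  also have "\<dots> = weighted_N w r"
    using fin[of r] r by (intro weighted_N_eq_sum[symmetric]) auto
  finally show ?thesis .
qed

text \<open>The difference \<open>h\<close> of the two sides vanishes at r + c and is nonincreasing
  on the way there, since x <= (1 + \<epsilon>)(x - c) persists for larger arguments.\<close>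

lemma ln_shift_le:
  fixes x r c \<epsilon> :: real
  assumes "0 \<le> c" "c < x" "x \<le> r + c" "0 < r" "x \<le> (1 + \<epsilon>) * (x - c)"
  shows "ln r - ln (x - c) \<le> (1 + \<epsilon>) * (ln (r + c) - ln x)"
proof -
  define h where "h t = (1 + \<epsilon>) * (ln (r + c) - ln t) - (ln r - ln (t - c))" for t
  have "h (r + c) \<le> h x"
  proof (rule DERIV_nonpos_imp_nonincreasing[OF assms(3)])
    fix t assume t: "x \<le> t" "t \<le> r + c"
    have "(h has_real_derivative (1 + \<epsilon>) * (- (1 / t)) + 1 / (t - c)) (at t)"
      unfolding h_def using t assms by (auto intro!: derivative_eq_intros simp: field_simps)
    moreover have "(1 + \<epsilon>) * (- (1 / t)) + 1 / (t - c) \<le> 0"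
    proof -
      have "0 \<le> \<epsilon>"
      proof (rule ccontr)
        assume "\<not> 0 \<le> \<epsilon>"
        hence "(1 + \<epsilon>) * (x - c) < 1 * (x - c)" using assms by (intro mult_strict_right_mono) auto
        from order_le_less_trans[OF assms(5) this] show False using assms(1) by simp
      qed
      hence "x + (t - x) \<le> (1 + \<epsilon>) * (x - c) + (1 + \<epsilon>) * (t - x)"
        using assms t mult_right_mono[of 1 "1 + \<epsilon>" "t - x"] by (intro add_mono) auto
      hence "t \<le> (1 + \<epsilon>) * (t - c)" by (simp add: algebra_simps)
      thus ?thesis using t assms by (simp add: field_simps)
    qed
    ultimately show "\<exists>y. DERIV h t :> y \<and> y \<le> 0" by blast
  qed
  thus ?thesis by (simp add: h_def)
qed

text \<open>Far points are compared one by one through \<open>ln_shift_le\<close>. The finitely many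
  near points cost only O(ln r), with their total weight collected in \<open>K\<close>.\<close>

lemma weighted_N_shift_le:
  assumes w: "locally_finite_weight w" and \<epsilon>: "0 < \<epsilon>"
  shows "\<exists>K\<ge>0. \<forall>r\<ge>1. weighted_N (\<lambda>z. w (z + c)) r \<le> (1 + \<epsilon>) * weighted_N w (r + cmod c) + K * (1 + ln r)"
proof -
  let ?A = "\<lambda>r. {z. w z \<noteq> 0 \<and> cmod z \<le> r}"
  \<comment> \<open>The first summand gives |z| <= (1 + \<epsilon>)(|z| - |c|) beyond
    \<open>x0\<close>; the others ensure |c| < |z| there.\<close>
  define x0 where "x0 = (1 + \<epsilon>) * cmod c / \<epsilon> + cmod c + 1"
  define g where "g z = real (w z) * (1 + \<bar>ln (cmod (z - c))\<bar>)" for z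
  define K where "K = (\<Sum>z\<in>?A x0. g z)"
  have fin: "finite (?A r)" for r by (rule locally_finite_weightD[OF w])
  have "K \<ge> 0" unfolding K_def g_def by (intro sum_nonneg) auto
  moreover have "weighted_N (\<lambda>z. w (z + c)) r \<le> (1 + \<epsilon>) * weighted_N w (r + cmod c) + K * (1 + ln r)"
    if r: "1 \<le> r" for r
  proof -
    let ?S = "{z. w z \<noteq> 0 \<and> cmod (z - c) \<le> r}"
    have sub: "?S \<subseteq> ?A (r + cmod c)" 
    proof
      fix z assume "z \<in> ?S"
      thus "z \<in> ?A (r + cmod c)" using norm_triangle_sub[of z c] by auto
    qed
    have finS: "finite ?S" using finite_subset[OF sub fin] .
    have "weighted_N (\<lambda>z. w (z + c)) r = (\<Sum>z\<in>?S. real (w z) * (ln r - ln (cmod (z - c))))"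
      unfolding weighted_N_def
      by (rule sum.reindex_bij_witness[of _ "\<lambda>z. z - c" "\<lambda>z. z + c"]) auto
    also have "\<dots> \<le> (\<Sum>z\<in>?S. (1 + \<epsilon>) * (real (w z) * (ln (r + cmod c) - ln (cmod z)))
                        + (if cmod z \<le> x0 then g z * (1 + ln r) else 0))"
    proof (rule sum_mono)
      fix z assume z: "z \<in> ?S"
      hence zA: "cmod z \<le> r + cmod c" using sub by auto
      have nn: "0 \<le> ln (r + cmod c) - ln (cmod z)"
        using zA r by (cases "z = 0") (auto intro!: ln_mono ln_ge_zero add_increasing2)
      show "real (w z) * (ln r - ln (cmod (z - c))) \<le> (1 + \<epsilon>) * (real (w z) * (ln (r + cmod c) - ln (cmod z)))
                        + (if cmod z \<le> x0 then g z * (1 + ln r) else 0)"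
      proof (cases "cmod z \<le> x0")
        case True
        have l: "0 \<le> ln r" using r by simp
        have "ln r - ln (cmod (z - c)) \<le> (1 + \<bar>ln (cmod (z - c))\<bar>) * (1 + ln r)"
          using l by (simp add: algebra_simps) (smt (verit) mult_nonneg_nonneg)
        hence "real (w z) * (ln r - ln (cmod (z - c))) \<le> g z * (1 + ln r)"
          unfolding g_def mult.assoc by (intro mult_left_mono) auto
        moreover have "0 \<le> (1 + \<epsilon>) * (real (w z) * (ln (r + cmod c) - ln (cmod z)))"
          using \<epsilon> nn by (intro mult_nonneg_nonneg) auto
        ultimately show ?thesis using True by simp
      next
        case False
        hence x: "x0 < cmod z" by simp
        have c: "cmod c < cmod z"
        proof -
          have "0 \<le> (1 + \<epsilon>) * cmod c / \<epsilon>" using \<epsilon> by simp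
          thus ?thesis using x unfolding x0_def by linarith
        qed
        have "(1 + \<epsilon>) * cmod c / \<epsilon> < cmod z" using x norm_ge_zero[of c] unfolding x0_def by linarith
        hence "cmod z \<le> (1 + \<epsilon>) * (cmod z - cmod c)" using \<epsilon> by (simp add: field_simps)
        hence "ln r - ln (cmod z - cmod c) \<le> (1 + \<epsilon>) * (ln (r + cmod c) - ln (cmod z))"
          using c zA r by (intro ln_shift_le) auto
        moreover have "ln (cmod z - cmod c) \<le> ln (cmod (z - c))"
          using c by (intro ln_mono) (auto intro: norm_triangle_ineq2)
        ultimately have "ln r - ln (cmod (z - c)) \<le> (1 + \<epsilon>) * (ln (r + cmod c) - ln (cmod z))" by simp
        hence "real (w z) * (ln r - ln (cmod (z - c))) \<le> real (w z) * ((1 + \<epsilon>) * (ln (r + cmod c) - ln (cmod z)))"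
          by (rule mult_left_mono) simp
        thus ?thesis using False by (simp add: mult_ac)
      qed
    qed
    also have "\<dots> = (1 + \<epsilon>) * (\<Sum>z\<in>?S. real (w z) * (ln (r + cmod c) - ln (cmod z)))
                    + (\<Sum>z\<in>?S. if cmod z \<le> x0 then g z * (1 + ln r) else 0)"
      by (simp add: sum.distrib sum_distrib_left)
    also have "(\<Sum>z\<in>?S. real (w z) * (ln (r + cmod c) - ln (cmod z))) \<le> weighted_N w (r + cmod c)"
      unfolding weighted_N_def
    proof (rule sum_mono2[OF fin sub])
      fix z assume "z \<in> ?A (r + cmod c) - ?S"
      thus "0 \<le> real (w z) * (ln (r + cmod c) - ln (cmod z))"
        using r by (cases "z = 0") (auto intro!: mult_nonneg_nonneg ln_mono ln_ge_zero add_increasing2)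
    qed
    also have "(\<Sum>z\<in>?S. if cmod z \<le> x0 then g z * (1 + ln r) else 0) \<le> K * (1 + ln r)"
    proof -
      have "(\<Sum>z\<in>?S. if cmod z \<le> x0 then g z * (1 + ln r) else 0) = (\<Sum>z\<in>?S \<inter> ?A x0. g z * (1 + ln r))"
        using finS by (intro sum.mono_neutral_cong_right) auto
      also have "\<dots> \<le> (\<Sum>z\<in>?A x0. g z * (1 + ln r))"
        using r fin by (intro sum_mono2) (auto simp: g_def intro!: mult_nonneg_nonneg)
      also have "\<dots> = K * (1 + ln r)" by (simp add: K_def sum_distrib_right)
      finally show ?thesis .
    qed
    finally show ?thesis using \<epsilon> by (simp add: mult_left_mono)
  qed
  ultimately show ?thesis by blast
qed

section \<open>Circle means and Poisson formulas\<close>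

definition circle_mean :: "real \<Rightarrow> (complex \<Rightarrow> real) \<Rightarrow> real" where
  "circle_mean r h = 1 / (2 * pi) * integral {0..2 * pi} (\<lambda>\<theta>. h (of_real r * cis \<theta>))"

lemma circle_point_in_sphere [simp]: "0 \<le> r \<Longrightarrow> of_real r * cis \<theta> \<in> sphere 0 r"
  by (simp add: norm_mult)

lemma continuous_on_circle_param:
  fixes h :: "complex \<Rightarrow> 'a::topological_space"
  assumes "continuous_on (sphere 0 r) h" "0 \<le> r"
  shows "continuous_on A (\<lambda>\<theta>. h (of_real r * cis \<theta>))"
  by (rule continuous_on_compose2[OF assms(1)])
     (use assms(2) in \<open>auto intro!: continuous_intros simp: norm_mult\<close>)

lemma integrable_on_circle:
  fixes h :: "complex \<Rightarrow> 'a::banach"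
  assumes "continuous_on (sphere 0 r) h" "0 \<le> r"
  shows "(\<lambda>\<theta>. h (of_real r * cis \<theta>)) integrable_on {a..b}"
  using continuous_on_circle_param[OF assms] by (rule integrable_continuous_interval)

lemma circle_mean_eqI:
  assumes "((\<lambda>\<theta>. h (of_real r * cis \<theta>)) has_integral 2 * pi * I) {0..2 * pi}"
  shows "circle_mean r h = I"
  using integral_unique[OF assms] by (simp add: circle_mean_def)

lemma circle_mean_mono:
  assumes "continuous_on (sphere 0 r) g" "continuous_on (sphere 0 r) h" "0 \<le> r"
    and "\<And>z. cmod z = r \<Longrightarrow> g z \<le> h z"
  shows "circle_mean r g \<le> circle_mean r h"
  unfolding circle_mean_def
  by (intro mult_left_mono integral_le integrable_on_circle assms)
     (use assms(3) in \<open>auto simp: norm_mult\<close>)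

lemma circle_mean_cong:
  assumes "0 \<le> r" "\<And>z. cmod z = r \<Longrightarrow> g z = h z"
  shows "circle_mean r g = circle_mean r h"
  unfolding circle_mean_def
  using assms by (intro arg_cong[where f = "\<lambda>x. 1 / (2 * pi) * x"] integral_cong) (auto simp: norm_mult)

lemma circle_mean_add:
  assumes "continuous_on (sphere 0 r) g" "continuous_on (sphere 0 r) h" "0 \<le> r"
  shows "circle_mean r (\<lambda>z. g z + h z) = circle_mean r g + circle_mean r h"
  unfolding circle_mean_def using assms
  by (subst integral_add) (auto intro!: integrable_on_circle simp: ring_distribs)

lemma circle_mean_cmult: "circle_mean r (\<lambda>z. c * h z) = c * circle_mean r h"
  unfolding circle_mean_def by simp

lemma circle_mean_const [simp]: "circle_mean r (\<lambda>_. c) = c"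
  unfolding circle_mean_def by simp

lemma circle_mean_minus: "circle_mean r (\<lambda>z. - h z) = - circle_mean r h"
  using circle_mean_cmult[of r "-1" h] by simp

lemma circle_mean_diff:
  assumes "continuous_on (sphere 0 r) g" "continuous_on (sphere 0 r) h" "0 \<le> r"
  shows "circle_mean r (\<lambda>z. g z - h z) = circle_mean r g - circle_mean r h"
  using circle_mean_add[of r g "\<lambda>z. - h z"] assms
  by (simp add: circle_mean_minus continuous_on_minus)

lemma circle_mean_sum:
  assumes "finite A" "\<And>a. a \<in> A \<Longrightarrow> continuous_on (sphere 0 r) (h a)" "0 \<le> r"
  shows "circle_mean r (\<lambda>z. \<Sum>a\<in>A. h a z) = (\<Sum>a\<in>A. circle_mean r (h a))"
  using assms
proof (induction A)
  case (insert a A)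
  thus ?case by (simp add: circle_mean_add continuous_on_sum)
qed simp

lemma circle_mean_nonneg:
  assumes "continuous_on (sphere 0 r) h" "0 \<le> r" "\<And>z. cmod z = r \<Longrightarrow> 0 \<le> h z"
  shows "0 \<le> circle_mean r h"
  using circle_mean_mono[of r "\<lambda>_. 0" h] assms by simp

section \<open>Cauchy and Poisson formulas as integrals over the angle\<close>

lemma has_integral_circle_of_contour:
  assumes "(G has_contour_integral I) (circlepath 0 R)"
  shows "((\<lambda>\<theta>. G (of_real R * cis \<theta>) * (of_real R * cis \<theta>)) has_integral I / \<i>) {0..2 * pi}"
proof -
  have "((\<lambda>t. G (0 + of_real R * cis t) * of_real R * \<i> * cis t) has_integral I) {0..2 * pi}"
    using assms unfolding circlepath_def
    by (subst (asm) has_contour_integral_part_circlepath_iff) auto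
  from has_integral_mult_left[OF this, of "1 / \<i>"] show ?thesis
    by (simp add: mult_ac)
qed

lemma holomorphic_circle_Cauchy:
  assumes "F holomorphic_on cball 0 R" "cmod z < R"
  shows "((\<lambda>\<theta>. F (of_real R * cis \<theta>) * (of_real R * cis \<theta>) / (of_real R * cis \<theta> - z))
           has_integral 2 * of_real pi * F z) {0..2 * pi}"
  using has_integral_circle_of_contour[OF Cauchy_integral_circlepath_simple[OF assms(1), of z]] assms(2)
  by (simp add: mult_ac)

lemma holomorphic_circle_mean:
  assumes "F holomorphic_on cball 0 R" "0 < R"
  shows "((\<lambda>\<theta>. F (of_real R * cis \<theta>)) has_integral 2 * of_real pi * F 0) {0..2 * pi}"
  using holomorphic_circle_Cauchy[OF assms(1), of 0] assms(2) by simp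

lemma holomorphic_circle_Cauchy_deriv:
  assumes "F holomorphic_on cball 0 R" "cmod z < R"
  shows "((\<lambda>\<theta>. F (of_real R * cis \<theta>) * (of_real R * cis \<theta>) / (of_real R * cis \<theta> - z)\<^sup>2)
           has_integral 2 * of_real pi * deriv F z) {0..2 * pi}"
proof -
  have "((\<lambda>u. F u / (u - z) ^ Suc 1) has_contour_integral ((2 * pi * \<i>) / (fact 1) * (deriv ^^ 1) F z))
           (circlepath 0 R)"
    using assms holomorphic_on_imp_continuous_on
    by (intro Cauchy_has_contour_integral_higher_derivative_circlepath)
       (auto intro: holomorphic_on_subset)
  from has_integral_circle_of_contour[OF this] show ?thesis
    by (simp add: mult_ac power2_eq_square)
qed

lemma denominator_nonzero:
  assumes "cmod z < R" "cmod w \<le> R"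
  shows "of_real (R\<^sup>2) - cnj z * w \<noteq> 0"
proof
  assume "of_real (R\<^sup>2) - cnj z * w = 0"
  hence "of_real (R\<^sup>2) = cnj z * w" by simp
  hence "cmod (of_real (R\<^sup>2)) = cmod z * cmod w" by (simp add: norm_mult)
  hence "R\<^sup>2 = cmod z * cmod w" by (simp add: norm_power)
  moreover have "cmod z * cmod w < R * R"
  proof -
    have "cmod z * cmod w \<le> cmod z * R" using assms by (intro mult_left_mono) auto
    also have "\<dots> < R * R" using assms norm_ge_zero[of z] by (intro mult_strict_right_mono) linarith+
    finally show ?thesis .
  qed
  ultimately show False by (simp add: power2_eq_square)
qed

text \<open>Cauchy's formula at z is added to the mean value property of \<open>F w\<close> times
  cnj z * w / (R^2 - cnj z * w), which is holomorphic in the disc and vanishes at 0. On the circle,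
  where R^2 = w * cnj w, both kernels add up to the real Poisson kernel, so real parts may be
  taken.\<close>

lemma Poisson_formula:
  assumes F: "F holomorphic_on cball 0 R" and z: "cmod z < R"
  shows "((\<lambda>\<theta>. Re (F (of_real R * cis \<theta>)) * ((R\<^sup>2 - (cmod z)\<^sup>2) / (cmod (of_real R * cis \<theta> - z))\<^sup>2))
           has_integral 2 * pi * Re (F z)) {0..2 * pi}"
proof -
  have R: "0 < R" using z norm_ge_zero[of z] by linarith
  let ?w = "\<lambda>\<theta>. of_real R * cis \<theta>"
  have "(\<lambda>w. F w * (cnj z * w / (of_real (R\<^sup>2) - cnj z * w))) holomorphic_on cball 0 R"
    using denominator_nonzero[OF z] F by (intro holomorphic_intros) auto
  from has_integral_add[OF holomorphic_circle_Cauchy[OF F z] holomorphic_circle_mean[OF this R]]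
  have "((\<lambda>\<theta>. F (?w \<theta>) * ?w \<theta> / (?w \<theta> - z) + F (?w \<theta>) * (cnj z * ?w \<theta> / (of_real (R\<^sup>2) - cnj z * ?w \<theta>)))
      has_integral 2 * of_real pi * F z) {0..2 * pi}" by simp
  moreover have "F (?w \<theta>) * ?w \<theta> / (?w \<theta> - z) + F (?w \<theta>) * (cnj z * ?w \<theta> / (of_real (R\<^sup>2) - cnj z * ?w \<theta>))
      = F (?w \<theta>) * of_real ((R\<^sup>2 - (cmod z)\<^sup>2) / (cmod (?w \<theta> - z))\<^sup>2)" for \<theta>
  proof -
    define w where "w = ?w \<theta>"
    have nw: "cmod w = R" using R by (simp add: w_def norm_mult)
    have ww: "of_real (R\<^sup>2) = w * cnj w" using nw by (simp add: complex_norm_square[symmetric] del: of_real_power)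
    have w0: "w \<noteq> 0" using nw R by auto
    have wz: "w - z \<noteq> 0" using nw z by auto
    hence cwz: "cnj w - cnj z \<noteq> 0" by (metis complex_cnj_diff complex_cnj_zero_iff)
    have "cnj z * w / (of_real (R\<^sup>2) - cnj z * w) = cnj z / (cnj w - cnj z)"
      unfolding ww using w0 cwz by (simp add: field_simps)
    moreover have "of_real ((R\<^sup>2 - (cmod z)\<^sup>2) / (cmod (w - z))\<^sup>2)
        = (w * cnj w - z * cnj z) / ((w - z) * (cnj w - cnj z))"
      by (simp only: of_real_divide of_real_diff ww complex_norm_square complex_cnj_diff)
    moreover have "w / (w - z) + cnj z / (cnj w - cnj z) = (w * cnj w - z * cnj z) / ((w - z) * (cnj w - cnj z))"
      using wz cwz by (simp add: field_simps)
    ultimately have "w / (w - z) + cnj z * w / (of_real (R\<^sup>2) - cnj z * w)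
        = of_real ((R\<^sup>2 - (cmod z)\<^sup>2) / (cmod (w - z))\<^sup>2)" by simp
    hence "F w * (w / (w - z) + cnj z * w / (of_real (R\<^sup>2) - cnj z * w))
        = F w * of_real ((R\<^sup>2 - (cmod z)\<^sup>2) / (cmod (w - z))\<^sup>2)" by (rule arg_cong)
    thus ?thesis unfolding w_def by (simp add: ring_distribs)
  qed
  ultimately have "((\<lambda>\<theta>. F (?w \<theta>) * of_real ((R\<^sup>2 - (cmod z)\<^sup>2) / (cmod (?w \<theta> - z))\<^sup>2))
      has_integral 2 * of_real pi * F z) {0..2 * pi}" by simp
  from has_integral_Re[OF this] show ?thesis by simp
qed

text \<open>The conjugate part of \<open>2 Re F = F + cnj F\<close> contributes a holomorphic integrand vanishing at 0.\<close>

lemma Poisson_deriv_formula: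
  assumes F: "F holomorphic_on cball 0 R" and z: "cmod z < R"
  shows "((\<lambda>\<theta>. of_real (2 * Re (F (of_real R * cis \<theta>))) * (of_real R * cis \<theta>) / (of_real R * cis \<theta> - z)\<^sup>2)
           has_integral 2 * of_real pi * deriv F z) {0..2 * pi}"
proof -
  have R: "0 < R" using z norm_ge_zero[of z] by linarith
  let ?w = "\<lambda>\<theta>. of_real R * cis \<theta>"
  have "(\<lambda>w. F w * (of_real (R\<^sup>2) * w / (of_real (R\<^sup>2) - cnj z * w)\<^sup>2)) holomorphic_on cball 0 R"
    using denominator_nonzero[OF z] F by (intro holomorphic_intros) auto
  from holomorphic_circle_mean[OF this R]
  have "((\<lambda>\<theta>. F (?w \<theta>) * (of_real (R\<^sup>2) * ?w \<theta> / (of_real (R\<^sup>2) - cnj z * ?w \<theta>)\<^sup>2)) has_integral 0) {0..2 * pi}"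
    by simp
  hence "((\<lambda>\<theta>. cnj (F (?w \<theta>) * (of_real (R\<^sup>2) * ?w \<theta> / (of_real (R\<^sup>2) - cnj z * ?w \<theta>)\<^sup>2))) has_integral 0) {0..2 * pi}"
    by (subst (asm) has_integral_cnj[symmetric]) (simp only: o_def complex_cnj_zero)
  from has_integral_add[OF holomorphic_circle_Cauchy_deriv[OF F z] this]
  have "((\<lambda>\<theta>. F (?w \<theta>) * ?w \<theta> / (?w \<theta> - z)\<^sup>2
      + cnj (F (?w \<theta>) * (of_real (R\<^sup>2) * ?w \<theta> / (of_real (R\<^sup>2) - cnj z * ?w \<theta>)\<^sup>2)))
      has_integral 2 * of_real pi * deriv F z) {0..2 * pi}" by simp
  moreover have "F (?w \<theta>) * ?w \<theta> / (?w \<theta> - z)\<^sup>2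
      + cnj (F (?w \<theta>) * (of_real (R\<^sup>2) * ?w \<theta> / (of_real (R\<^sup>2) - cnj z * ?w \<theta>)\<^sup>2))
      = of_real (2 * Re (F (?w \<theta>))) * ?w \<theta> / (?w \<theta> - z)\<^sup>2" for \<theta>
  proof -
    define w where "w = ?w \<theta>"
    have nw: "cmod w = R" using R by (simp add: w_def norm_mult)
    have ww: "of_real (R\<^sup>2) = w * cnj w" using nw by (simp add: complex_norm_square[symmetric] del: of_real_power)
    have w0: "w \<noteq> 0" using nw R by auto
    have wz: "w - z \<noteq> 0" using nw z by auto
    have "cnj (of_real (R\<^sup>2) * w / (of_real (R\<^sup>2) - cnj z * w)\<^sup>2) = w * cnj w * cnj w / ((w - z) * cnj w)\<^sup>2"
      unfolding ww by (simp add: algebra_simps)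
    also have "\<dots> = w / (w - z)\<^sup>2"
      using w0 wz by (simp add: power_mult_distrib divide_simps) (simp add: power2_eq_square)
    finally have "cnj (F w * (of_real (R\<^sup>2) * w / (of_real (R\<^sup>2) - cnj z * w)\<^sup>2)) = cnj (F w) * (w / (w - z)\<^sup>2)"
      by (subst complex_cnj_mult) (simp only:)
    hence "F w * w / (w - z)\<^sup>2 + cnj (F w * (of_real (R\<^sup>2) * w / (of_real (R\<^sup>2) - cnj z * w)\<^sup>2))
        = (F w + cnj (F w)) * (w / (w - z)\<^sup>2)"
      by (simp add: ring_distribs add_divide_distrib)
    thus ?thesis unfolding w_def complex_add_cnj by simp
  qed
  ultimately show ?thesis by simp
qed

lemma continuous_on_Poisson_kernel:
  assumes "cmod z < R"
  shows "continuous_on (sphere 0 R) (\<lambda>w. 1 / (cmod (w - z))\<^sup>2)"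
  using assms by (intro continuous_intros) auto

lemma Poisson_deriv_bound:
  assumes F: "F holomorphic_on cball 0 R" and z: "cmod z < R"
  shows "cmod (deriv F z) \<le> 2 * R * circle_mean R (\<lambda>w. \<bar>Re (F w)\<bar> * (1 / (cmod (w - z))\<^sup>2))"
proof -
  have R: "0 < R" using z norm_ge_zero[of z] by linarith
  let ?w = "\<lambda>\<theta>. of_real R * cis \<theta>"
  have cF: "continuous_on (sphere 0 R) F"
    using holomorphic_on_imp_continuous_on[OF F] by (rule continuous_on_subset) auto
  have cont: "continuous_on (sphere 0 R) (\<lambda>w. \<bar>Re (F w)\<bar> * (1 / (cmod (w - z))\<^sup>2))"
    by (intro continuous_on_mult continuous_on_Poisson_kernel[OF z] continuous_intros cF)
  have "norm (integral {0..2*pi} (\<lambda>\<theta>. of_real (2 * Re (F (?w \<theta>))) * ?w \<theta> / (?w \<theta> - z)\<^sup>2))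
      \<le> integral {0..2*pi} (\<lambda>\<theta>. 2 * R * (\<bar>Re (F (?w \<theta>))\<bar> * (1 / (cmod (?w \<theta> - z))\<^sup>2)))"
  proof (rule integral_norm_bound_integral)
    show "(\<lambda>\<theta>. of_real (2 * Re (F (?w \<theta>))) * ?w \<theta> / (?w \<theta> - z)\<^sup>2) integrable_on {0..2*pi}"
      using Poisson_deriv_formula[OF F z] by (rule has_integral_integrable)
    show "(\<lambda>\<theta>. 2 * R * (\<bar>Re (F (?w \<theta>))\<bar> * (1 / (cmod (?w \<theta> - z))\<^sup>2))) integrable_on {0..2*pi}"
      using R by (intro integrable_on_mult_right integrable_on_circle[OF cont]) auto
    show "norm (of_real (2 * Re (F (?w \<theta>))) * ?w \<theta> / (?w \<theta> - z)\<^sup>2)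
        \<le> 2 * R * (\<bar>Re (F (?w \<theta>))\<bar> * (1 / (cmod (?w \<theta> - z))\<^sup>2))" for \<theta>
      using R by (simp add: norm_mult norm_divide norm_power mult_ac)
  qed
  also have "\<dots> = 2 * pi * (2 * R * circle_mean R (\<lambda>w. \<bar>Re (F w)\<bar> * (1 / (cmod (w - z))\<^sup>2)))"
    unfolding circle_mean_def integral_mult_right by simp
  also have "integral {0..2*pi} (\<lambda>\<theta>. of_real (2 * Re (F (?w \<theta>))) * ?w \<theta> / (?w \<theta> - z)\<^sup>2)
      = 2 * of_real pi * deriv F z"
    using Poisson_deriv_formula[OF F z] by (rule integral_unique)
  finally show ?thesis by (simp add: norm_mult)
qed

text \<open>The distance of two points on concentric circles depends only on the difference of their
  angles. So the mean over the inner circle equals the one over the outer circle, and that is the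
  Poisson formula for the constant 1.\<close>

lemma Poisson_kernel_mean:
  assumes "0 \<le> r" "r < R" "cmod w = R"
  shows "circle_mean r (\<lambda>z. 1 / (cmod (w - z))\<^sup>2) = 1 / (R\<^sup>2 - r\<^sup>2)"
proof -
  obtain t where t: "w = of_real R * cis t"
    using rcis_cmod_Arg[of w] assms by (metis rcis_def)
  have R: "0 < R" and pos: "0 < R\<^sup>2 - r\<^sup>2"
    using assms power_strict_mono[of r R 2] by auto
  have "((\<lambda>\<theta>. 1 * ((R\<^sup>2 - r\<^sup>2) / (cmod (of_real R * cis \<theta> - of_real r * cis t))\<^sup>2)) has_integral 2 * pi * 1) {0..2*pi}"
    using Poisson_formula[of "\<lambda>_. 1" R "of_real r * cis t"] assms by (simp add: norm_mult)
  \<comment> \<open>Conjugation followed by the rotation by \<theta> + t exchanges the angles of the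
    two points.\<close>
  moreover have "cmod (of_real R * cis \<theta> - of_real r * cis t) = cmod (w - of_real r * cis \<theta>)" for \<theta>
  proof -
    have "cmod (of_real R * cis \<theta> - of_real r * cis t)
        = cmod (cnj (of_real R * cis \<theta> - of_real r * cis t)) * cmod (cis (\<theta> + t))"
      by (subst complex_mod_cnj) simp
    also have "\<dots> = cmod (cnj (of_real R * cis \<theta> - of_real r * cis t) * cis (\<theta> + t))"
      by (simp only: norm_mult)
    also have "cnj (of_real R * cis \<theta> - of_real r * cis t) * cis (\<theta> + t) = w - of_real r * cis \<theta>"
      by (simp add: t cis_cnj left_diff_distrib mult.assoc cis_mult)
    finally show ?thesis .
  qed
  ultimately have "((\<lambda>\<theta>. (R\<^sup>2 - r\<^sup>2) / (cmod (w - of_real r * cis \<theta>))\<^sup>2) has_integral 2 * pi) {0..2*pi}" by simp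
  from has_integral_mult_right[OF this, of "1 / (R\<^sup>2 - r\<^sup>2)"]
  have "((\<lambda>\<theta>. 1 / (cmod (w - of_real r * cis \<theta>))\<^sup>2) has_integral 2 * pi * (1 / (R\<^sup>2 - r\<^sup>2))) {0..2*pi}"
    using pos by (simp add: mult_ac)
  thus ?thesis by (rule circle_mean_eqI)
qed

text \<open>Fubini for a continuous integrand, followed by \<open>Poisson_kernel_mean\<close>.
  Averaging a Poisson integral over the inner circle thus costs 1 / (R^2 - r^2) instead of the
  pointwise bound 1 / (R - r)^2.\<close>

lemma circle_mean_Poisson_kernel_swap:
  assumes V: "continuous_on (sphere 0 R) V" and r: "0 \<le> r" "r < R"
  shows "circle_mean r (\<lambda>z. circle_mean R (\<lambda>w. V w * (1 / (cmod (w - z))\<^sup>2))) = circle_mean R V / (R\<^sup>2 - r\<^sup>2)"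
    and "continuous_on (sphere 0 r) (\<lambda>z. circle_mean R (\<lambda>w. V w * (1 / (cmod (w - z))\<^sup>2)))"
proof -
  let ?g = "\<lambda>\<theta> \<phi>. V (of_real R * cis \<theta>) * (1 / (cmod (of_real R * cis \<theta> - of_real r * cis \<phi>))\<^sup>2)"
  have ne: "of_real R * cis \<theta> \<noteq> z" if "cmod z = r" for \<theta> z
    using that r by (auto simp: norm_mult)
  have ne': "of_real R * cis \<theta> \<noteq> of_real r * cis \<phi>" for \<theta> \<phi>
    using r by (intro ne) (simp add: norm_mult)
  have cV: "continuous_on A (\<lambda>x. V (of_real R * cis (g x)))" if "continuous_on A g" for A and g :: "'a::topological_space \<Rightarrow> real"
    by (rule continuous_on_compose2[OF V]) (use r that in \<open>auto intro!: continuous_intros simp: norm_mult\<close>)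
  have c2: "continuous_on (cbox (0, 0) (2 * pi, 2 * pi)) (\<lambda>(\<phi>, \<theta>). ?g \<theta> \<phi>)"
    unfolding case_prod_unfold using ne' by (intro continuous_intros cV) auto
  have "integral {0..2*pi} (\<lambda>\<phi>. integral {0..2*pi} (\<lambda>\<theta>. ?g \<theta> \<phi>)) = integral {0..2*pi} (\<lambda>\<theta>. integral {0..2*pi} (\<lambda>\<phi>. ?g \<theta> \<phi>))"
    using integral_swap_continuous[OF c2] by simp
  also have "\<dots> = integral {0..2*pi} (\<lambda>\<theta>. V (of_real R * cis \<theta>) * (2 * pi / (R\<^sup>2 - r\<^sup>2)))"
  proof (rule integral_cong)
    fix \<theta>
    have "integral {0..2*pi} (\<lambda>\<phi>. 1 / (cmod (of_real R * cis \<theta> - of_real r * cis \<phi>))\<^sup>2) = 2 * pi / (R\<^sup>2 - r\<^sup>2)"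
      using Poisson_kernel_mean[OF r, of "of_real R * cis \<theta>"] r
      by (simp add: circle_mean_def norm_mult field_simps)
    thus "integral {0..2*pi} (\<lambda>\<phi>. ?g \<theta> \<phi>) = V (of_real R * cis \<theta>) * (2 * pi / (R\<^sup>2 - r\<^sup>2))"
      by (simp only: integral_mult_right)
  qed
  finally show "circle_mean r (\<lambda>z. circle_mean R (\<lambda>w. V w * (1 / (cmod (w - z))\<^sup>2))) = circle_mean R V / (R\<^sup>2 - r\<^sup>2)"
    by (simp add: circle_mean_def)
  have "continuous_on (sphere 0 r) (\<lambda>z. integral (cbox 0 (2*pi)) (\<lambda>\<theta>. V (of_real R * cis \<theta>) * (1 / (cmod (of_real R * cis \<theta> - z))\<^sup>2)))"
    by (rule integral_continuous_on_param)
       (unfold case_prod_unfold, use ne in \<open>intro continuous_intros cV\<close>, auto)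
  thus "continuous_on (sphere 0 r) (\<lambda>z. circle_mean R (\<lambda>w. V w * (1 / (cmod (w - z))\<^sup>2)))"
    unfolding circle_mean_def by (intro continuous_intros) auto
qed

section \<open>Circle means of logarithms and of negative powers of a distance\<close>

lemma holomorphic_log_on_ball:
  assumes "G holomorphic_on ball 0 R" "\<And>z. cmod z < R \<Longrightarrow> G z \<noteq> 0"
  obtains L where "L holomorphic_on ball 0 R" "\<And>z. cmod z < R \<Longrightarrow> G z = exp (L z)"
proof (rule contractible_imp_holomorphic_log[OF assms(1)])
  show "contractible (ball 0 R :: complex set)" by (simp add: convex_imp_contractible)
qed (use assms(2) that in auto)

lemma circle_mean_ln_norm_nonvanishing:
  assumes "G holomorphic_on ball 0 R" "\<And>z. cmod z < R \<Longrightarrow> G z \<noteq> 0" "0 < r" "r < R"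
  shows "circle_mean r (\<lambda>z. ln (cmod (G z))) = ln (cmod (G 0))"
proof -
  obtain L where L: "L holomorphic_on ball 0 R" "\<And>z. cmod z < R \<Longrightarrow> G z = exp (L z)"
    using holomorphic_log_on_ball[OF assms(1,2)] by metis
  have "L holomorphic_on cball 0 r" using L(1) assms by (elim holomorphic_on_subset) auto
  from has_integral_Re[OF holomorphic_circle_mean[OF this assms(3)]]
  have "circle_mean r (\<lambda>z. Re (L z)) = Re (L 0)" by (intro circle_mean_eqI) simp
  moreover have "ln (cmod (G z)) = Re (L z)" if "cmod z < R" for z using L(2)[OF that] by simp
  moreover have "circle_mean r (\<lambda>z. ln (cmod (G z))) = circle_mean r (\<lambda>z. Re (L z))"
    using assms calculation(2) by (intro circle_mean_cong) auto
  ultimately show ?thesis using assms by simp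
qed

text \<open>For |b| < r, the factor z - b is replaced by r - cnj b * z / r, which has the same
  modulus on the circle and whose zero is the reflection of b, outside the disc. Points b on the
  circle are excluded, so no logarithmic singularity is met.\<close>

lemma circle_mean_ln_norm_diff:
  assumes r: "0 < r" and b: "cmod b \<noteq> r"
  shows "circle_mean r (\<lambda>z. ln (cmod (z - b))) = ln (max r (cmod b))"
proof (cases "r < cmod b")
  case True
  have "circle_mean r (\<lambda>z. ln (cmod (z - b))) = ln (cmod (0 - b))"
    by (rule circle_mean_ln_norm_nonvanishing[of _ "cmod b"]) (use True r in \<open>auto intro!: holomorphic_intros\<close>)
  thus ?thesis using True by simp
next
  case False
  hence br: "cmod b < r" using b by simp
  have eq: "cmod (z - b) = cmod (of_real r - cnj b * z / of_real r)" if z: "cmod z = r" for z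
  proof -
    have zz: "of_real (r\<^sup>2) = z * cnj z" using z by (simp add: complex_norm_square[symmetric] del: of_real_power)
    have "of_real r * (of_real r - cnj b * z / of_real r) = z * cnj (z - b)"
      using r zz by (simp add: field_simps power2_eq_square)
    hence "r * cmod (of_real r - cnj b * z / of_real r) = r * cmod (z - b)"
      using r z by (metis abs_of_pos complex_mod_cnj norm_mult norm_of_real)
    thus ?thesis using r by simp
  qed
  \<comment> \<open>A radius between r and the modulus r^2 / |b| of the reflected zero.\<close>
  obtain R where R: "r < R" "cmod b * R < r * r"
  proof (cases "b = 0")
    case False
    hence "r < r * r / cmod b" using br r by (simp add: field_simps)
    then obtain R where "r < R" "R < r * r / cmod b" using dense by blast
    thus ?thesis using that False by (simp add: field_simps)
  qed (use that[of "r + 1"] r in auto)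
  have "circle_mean r (\<lambda>z. ln (cmod (of_real r - cnj b * z / of_real r))) = ln (cmod (of_real r - cnj b * 0 / of_real r))"
  proof (rule circle_mean_ln_norm_nonvanishing[OF _ _ r R(1)])
    fix z assume z: "cmod z < R"
    show "of_real r - cnj b * z / of_real r \<noteq> 0"
    proof
      assume "of_real r - cnj b * z / of_real r = 0"
      hence "of_real (r * r) = cnj b * z" using r by (simp add: field_simps)
      hence "r * r = cmod b * cmod z"
        by (metis abs_mult_self_eq complex_mod_cnj norm_mult norm_of_real abs_mult)
      also have "\<dots> \<le> cmod b * R" using z by (intro mult_left_mono) auto
      finally show False using R by simp
    qed
  qed (use r in \<open>auto intro!: holomorphic_intros\<close>)
  moreover have "circle_mean r (\<lambda>z. ln (cmod (z - b))) = circle_mean r (\<lambda>z. ln (cmod (of_real r - cnj b * z / of_real r)))"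
    using r eq by (intro circle_mean_cong) auto
  ultimately show ?thesis using br r by (simp add: max_def)
qed

text \<open>For angles up to pi/2 the imaginary part suffices, with sin x >= x / pi: up to pi/3
  because sin x - x/2 is nondecreasing there, beyond because sin x >= 1/2. For larger angles the
  cosine is nonpositive and the distance is at least r.\<close>

lemma norm_cis_minus_real_ge:
  assumes "\<bar>t\<bar> \<le> pi" "0 \<le> r" "0 \<le> \<rho>"
  shows "r * \<bar>t\<bar> / pi \<le> cmod (of_real r * cis t - of_real \<rho>)"
proof (cases "\<bar>t\<bar> \<le> pi / 2")
  case True
  have "x / pi \<le> sin x" if x: "0 \<le> x" "x \<le> pi / 2" for x :: real
  proof (cases "x \<le> pi / 3")
    case True
    have "sin 0 - 0 / 2 \<le> sin x - x / 2"
    proof (rule DERIV_nonneg_imp_nondecreasing[OF x(1)])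
      fix y assume y: "0 \<le> y" "y \<le> x"
      have "cos (pi / 3) \<le> cos y" using y True by (intro cos_monotone_0_pi_le) auto
      thus "\<exists>d. ((\<lambda>x. sin x - x / 2) has_real_derivative d) (at y) \<and> 0 \<le> d"
        by (intro exI[of _ "cos y - 1 / 2"] conjI) (auto intro!: derivative_eq_intros simp: cos_60)
    qed
    hence "x / 2 \<le> sin x" by simp
    moreover have "x / pi \<le> x / 2" using x pi_gt3 by (intro divide_left_mono) auto
    ultimately show ?thesis by linarith
  next
    case False
    have "sin (pi / 6) \<le> sin x" using x False pi_gt3 by (intro sin_monotone_2pi_le) auto
    moreover have "x / pi \<le> 1 / 2" using x by (simp add: field_simps)
    ultimately show ?thesis unfolding sin_30 by linarith
  qed
  from this[of "\<bar>t\<bar>"] True have "\<bar>t\<bar> / pi \<le> \<bar>sin t\<bar>" by (cases "t \<ge> 0") auto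
  hence "r * (\<bar>t\<bar> / pi) \<le> r * \<bar>sin t\<bar>" using assms by (intro mult_left_mono)
  also have "\<dots> = \<bar>Im (of_real r * cis t - of_real \<rho>)\<bar>" using assms by (simp add: abs_mult)
  also have "\<dots> \<le> cmod (of_real r * cis t - of_real \<rho>)" by (rule abs_Im_le_cmod)
  finally show ?thesis by simp
next
  case False
  have "cos \<bar>t\<bar> \<le> cos (pi / 2)" using False assms by (intro cos_monotone_0_pi_le) auto
  hence "cos t \<le> 0" by simp
  hence k: "2 * r * \<rho> * cos t \<le> 0" using assms by (intro mult_nonneg_nonpos) auto
  have "(cmod (of_real r * cis t - of_real \<rho>))\<^sup>2 = r\<^sup>2 * ((sin t)\<^sup>2 + (cos t)\<^sup>2) - 2 * r * \<rho> * cos t + \<rho>\<^sup>2"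
  proof -
    have "(cmod (of_real r * cis t - of_real \<rho>))\<^sup>2 = (r * cos t - \<rho>)\<^sup>2 + (r * sin t)\<^sup>2"
      unfolding cmod_power2 by simp
    thus ?thesis by algebra
  qed
  hence "r\<^sup>2 \<le> (cmod (of_real r * cis t - of_real \<rho>))\<^sup>2"
    unfolding sin_cos_squared_add mult_1_right using k zero_le_power2[of \<rho>] by linarith
  hence "r \<le> cmod (of_real r * cis t - of_real \<rho>)" by (rule power2_le_imp_le) simp
  moreover have "r * \<bar>t\<bar> / pi \<le> r" using assms by (simp add: divide_le_eq mult_left_mono)
  ultimately show ?thesis by simp
qed

text \<open>The range of \<open>a\<close> admits an angle in [0, 2 pi] and its translates by 2 pi in
  both directions; for all of them [a - 4 pi, a + 4 pi] contains [0, 2 pi], and the primitive is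
  explicit on either side of \<open>a\<close>.\<close>

lemma integral_abs_powr_le:
  fixes a \<alpha> :: real
  assumes "0 < \<alpha>" "\<alpha> < 1" "- (2 * pi) \<le> a" "a \<le> 4 * pi"
  shows "(\<lambda>\<theta>. \<bar>\<theta> - a\<bar> powr - \<alpha>) integrable_on {0..2 * pi}"
    and "integral {0..2 * pi} (\<lambda>\<theta>. \<bar>\<theta> - a\<bar> powr - \<alpha>) \<le> 2 * ((4 * pi) powr (1 - \<alpha>) / (1 - \<alpha>))"
proof -
  let ?h = "\<lambda>\<theta>. \<bar>\<theta> - a\<bar> powr - \<alpha>"
  let ?I = "(4 * pi) powr (1 - \<alpha>) / (1 - \<alpha>)"
  have "(?h has_integral (a + 4 * pi - a) powr (1 - \<alpha>) / (1 - \<alpha>) - (a - a) powr (1 - \<alpha>) / (1 - \<alpha>)) {a..a + 4 * pi}"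
  proof (rule fundamental_theorem_of_calculus_interior)
    show "continuous_on {a..a + 4 * pi} (\<lambda>x. (x - a) powr (1 - \<alpha>) / (1 - \<alpha>))"
      using assms by (intro continuous_intros continuous_on_powr') auto
    fix x assume "x \<in> {a<..<a + 4 * pi}"
    hence x: "0 < x - a" by simp
    have "((\<lambda>x. x - a) has_real_derivative 1) (at x)" by (auto intro!: derivative_eq_intros)
    from DERIV_cdivide[OF DERIV_fun_powr[OF this x, of "1 - \<alpha>"], of "1 - \<alpha>"]
    show "((\<lambda>x. (x - a) powr (1 - \<alpha>) / (1 - \<alpha>)) has_vector_derivative \<bar>x - a\<bar> powr - \<alpha>) (at x)"
      unfolding has_real_derivative_iff_has_vector_derivative[symmetric] using assms x by simp
  qed simp
  hence 1: "(?h has_integral ?I) {a..a + 4 * pi}" by simp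
  have "(?h has_integral - ((a - a) powr (1 - \<alpha>) / (1 - \<alpha>)) - (- ((a - (a - 4 * pi)) powr (1 - \<alpha>) / (1 - \<alpha>)))) {a - 4 * pi..a}"
  proof (rule fundamental_theorem_of_calculus_interior)
    show "continuous_on {a - 4 * pi..a} (\<lambda>x. - ((a - x) powr (1 - \<alpha>) / (1 - \<alpha>)))"
      using assms by (intro continuous_intros continuous_on_powr') auto
    fix x assume "x \<in> {a - 4 * pi<..<a}"
    hence x: "0 < a - x" by simp
    have "((\<lambda>x. a - x) has_real_derivative - 1) (at x)" by (auto intro!: derivative_eq_intros)
    from DERIV_minus[OF DERIV_cdivide[OF DERIV_fun_powr[OF this x, of "1 - \<alpha>"], of "1 - \<alpha>"]]
    show "((\<lambda>x. - ((a - x) powr (1 - \<alpha>) / (1 - \<alpha>))) has_vector_derivative \<bar>x - a\<bar> powr - \<alpha>) (at x)"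
      unfolding has_real_derivative_iff_has_vector_derivative[symmetric] using assms x by simp
  qed simp
  hence 2: "(?h has_integral ?I) {a - 4 * pi..a}" by simp
  have 3: "(?h has_integral 2 * ?I) {a - 4 * pi..a + 4 * pi}"
    using has_integral_combine[OF _ _ 2 1] by simp
  show int: "?h integrable_on {0..2 * pi}"
    by (rule integrable_on_subinterval[OF has_integral_integrable[OF 3]]) (use assms in auto)
  have "integral {0..2 * pi} ?h \<le> integral {a - 4 * pi..a + 4 * pi} ?h"
    using assms by (intro integral_subset_le int has_integral_integrable[OF 3]) auto
  thus "integral {0..2 * pi} ?h \<le> 2 * ?I" using integral_unique[OF 3] by simp
qed

text \<open>The chord bound reduces |r cis \<theta> - b| to r |\<theta> - a| / pi, where a is that
  translate of the argument of b which lies within pi of \<theta>. The bound does not see |b|, hence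
  is uniform however close b is to the circle.\<close>

lemma circle_mean_powr_le:
  assumes \<alpha>: "0 < \<alpha>" "\<alpha> < 1"
  shows "\<exists>K\<ge>0. \<forall>r>0. \<forall>b. cmod b \<noteq> r \<longrightarrow> circle_mean r (\<lambda>z. cmod (z - b) powr - \<alpha>) \<le> K * r powr - \<alpha>"
proof -
  define I where "I = 2 * ((4 * pi) powr (1 - \<alpha>) / (1 - \<alpha>))"
  define K where "K = 1 / (2 * pi) * (pi powr \<alpha> * (3 * I))"
  have "I \<ge> 0" using \<alpha> by (simp add: I_def)
  hence "K \<ge> 0" by (simp add: K_def)
  moreover have "circle_mean r (\<lambda>z. cmod (z - b) powr - \<alpha>) \<le> K * r powr - \<alpha>" if r: "0 < r" and b: "cmod b \<noteq> r" for r b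
  proof -
    define \<beta> where "\<beta> = Arg2pi b"
    have b_eq: "b = of_real (cmod b) * cis \<beta>"
      using Arg2pi_eq[of b] by (simp add: \<beta>_def cis_conv_exp)
    have \<beta>: "0 \<le> \<beta>" "\<beta> \<le> 2 * pi" using Arg2pi_ge_0[of b] Arg2pi_lt_2pi[of b] by (auto simp: \<beta>_def)
    let ?f = "\<lambda>\<theta>. cmod (of_real r * cis \<theta> - b) powr - \<alpha>"
    define h where "h a \<theta> = \<bar>\<theta> - a\<bar> powr - \<alpha>" for a \<theta> :: real
    let ?S = "\<lambda>\<theta>. (r / pi) powr - \<alpha> * (h \<beta> \<theta> + h (\<beta> - 2 * pi) \<theta> + h (\<beta> + 2 * pi) \<theta>)"
    let ?N = "{\<beta>, \<beta> - 2 * pi, \<beta> + 2 * pi}"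
    have hi: "h a integrable_on {0..2 * pi}" "integral {0..2*pi} (h a) \<le> I" if "a \<in> ?N" for a
      using that integral_abs_powr_le[OF \<alpha>, of a] \<beta> by (auto simp: h_def[abs_def] I_def)
    have h0: "0 \<le> h a \<theta>" for a \<theta> by (simp add: h_def)
    have S: "?S integrable_on {0..2*pi}" by (intro integrable_on_mult_right integrable_add hi) auto
    \<comment> \<open>At the angles in \<open>?N\<close> one summand is
      \<open>0 powr - \<alpha> = 0\<close> rather than infinite, so \<open>?S\<close> need not
      majorise there. Redefining the majorant at finitely many points does not change its
      integral.\<close>
    let ?T = "\<lambda>\<theta>. if \<theta> \<in> ?N then ?f \<theta> else ?S \<theta>"
    have T: "(?T has_integral integral {0..2*pi} ?S) {0..2*pi}"
      by (rule has_integral_spike_finite[OF _ _ integrable_integral[OF S], of ?N]) auto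
    have le: "?f \<theta> \<le> ?T \<theta>" if \<theta>: "\<theta> \<in> {0..2*pi}" for \<theta>
    proof (cases "\<theta> \<in> ?N")
      case False
      obtain a where a: "a \<in> ?N" "\<bar>\<theta> - a\<bar> \<le> pi"
      proof -
        consider "\<bar>\<theta> - \<beta>\<bar> \<le> pi" | "\<theta> - \<beta> > pi" | "\<theta> - \<beta> < - pi" by linarith
        thus ?thesis
          by cases (use \<theta> \<beta> in \<open>auto intro: that[of \<beta>] that[of "\<beta> + 2 * pi"] that[of "\<beta> - 2 * pi"]\<close>)
      qed
      have cis_a: "cis a = cis \<beta>" using a(1) by (auto simp: complex_eq_iff cos_diff sin_diff)
      have "r * \<bar>\<theta> - a\<bar> / pi \<le> cmod (of_real r * cis (\<theta> - a) - of_real (cmod b))"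
        using r by (intro norm_cis_minus_real_ge a) auto
      also have "\<dots> = cmod (of_real r * cis (\<theta> - a) - of_real (cmod b)) * cmod (cis a)" by simp
      also have "\<dots> = cmod ((of_real r * cis (\<theta> - a) - of_real (cmod b)) * cis a)" by (simp only: norm_mult)
      also have "(of_real r * cis (\<theta> - a) - of_real (cmod b)) * cis a = of_real r * cis \<theta> - b"
        by (subst (2) b_eq) (simp add: left_diff_distrib mult.assoc cis_mult, simp add: cis_a)
      finally have lb: "r / pi * \<bar>\<theta> - a\<bar> \<le> cmod (of_real r * cis \<theta> - b)" by simp
      have "0 < r / pi * \<bar>\<theta> - a\<bar>" using False a r by auto
      hence "?f \<theta> \<le> (r / pi * \<bar>\<theta> - a\<bar>) powr - \<alpha>" using lb \<alpha> by (intro powr_mono2') auto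
      also have "\<dots> = (r / pi) powr - \<alpha> * h a \<theta>" using r unfolding h_def by (subst powr_mult) auto
      also have "\<dots> \<le> ?S \<theta>"
        using a(1) h0[of \<beta> \<theta>] h0[of "\<beta> - 2*pi" \<theta>] h0[of "\<beta> + 2*pi" \<theta>] by (intro mult_left_mono) auto
      finally show ?thesis using False by simp
    qed simp
    have cont: "continuous_on (sphere 0 r) (\<lambda>z. cmod (z - b) powr - \<alpha>)"
      using b by (intro continuous_intros) auto
    have "integral {0..2*pi} ?f \<le> integral {0..2*pi} ?S"
      by (rule has_integral_le[OF integrable_integral[OF integrable_on_circle[OF cont]] T le]) (use r in auto)
    also have "\<dots> = (r / pi) powr - \<alpha> * (integral {0..2*pi} (h \<beta>) + integral {0..2*pi} (h (\<beta> - 2*pi)) + integral {0..2*pi} (h (\<beta> + 2*pi)))"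
      using hi(1)[of \<beta>] hi(1)[of "\<beta> - 2 * pi"] hi(1)[of "\<beta> + 2 * pi"]
      by (simp add: integral_add integrable_add)
    also have "\<dots> \<le> (r / pi) powr - \<alpha> * (3 * I)"
      using hi(2)[of \<beta>] hi(2)[of "\<beta> - 2 * pi"] hi(2)[of "\<beta> + 2 * pi"] by (intro mult_left_mono) auto
    also have "(r / pi) powr - \<alpha> = r powr - \<alpha> * pi powr \<alpha>"
      using r by (simp add: powr_divide powr_minus field_simps)
    finally have "1 / (2 * pi) * integral {0..2*pi} ?f \<le> 1 / (2 * pi) * (r powr - \<alpha> * pi powr \<alpha> * (3 * I))"
      by (intro mult_left_mono) auto
    thus ?thesis by (simp add: circle_mean_def K_def mult_ac)
  qed
  ultimately show ?thesis by blast
qed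

text \<open>For t <= 1 via ln (1 + t) <= t <= t^\<alpha>. For t > 1 the logarithm is at most ln 2 +
  ln t, with ln 2 <= 1/\<alpha> and \<alpha> ln t <= t^\<alpha> - 1.\<close>

lemma ln_one_plus_le_powr:
  fixes t \<alpha> :: real
  assumes "0 \<le> t" "0 < \<alpha>" "\<alpha> \<le> 1"
  shows "ln (1 + t) \<le> t powr \<alpha> / \<alpha>"
proof (cases "t \<le> 1")
  case True
  have "ln (1 + t) \<le> t" using assms by (intro ln_add_one_self_le_self)
  also have "t \<le> t powr \<alpha>"
  proof (cases "t = 0")
    case False
    thus ?thesis using powr_mono'[of \<alpha> 1 t] True assms by simp
  qed simp
  also have "\<dots> \<le> t powr \<alpha> / \<alpha>" using assms by (simp add: le_divide_eq mult_left_le)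
  finally show ?thesis .
next
  case False
  have "ln (1 + t) \<le> ln (2 * t)" using False by (intro ln_mono) auto
  also have "\<dots> = ln 2 + ln t" using False by (simp add: ln_mult)
  also have "ln 2 \<le> 1 / \<alpha>"
  proof -
    have "ln 2 \<le> (1::real)" using ln_le_minus_one[of 2] by simp
    also have "1 \<le> 1 / \<alpha>" using assms by simp
    finally show ?thesis .
  qed
  also have "ln t \<le> (t powr \<alpha> - 1) / \<alpha>"
  proof -
    have "\<alpha> * ln t = ln (t powr \<alpha>)" using False by (simp add: ln_powr)
    also have "\<dots> \<le> t powr \<alpha> - 1" using False by (intro ln_le_minus_one) auto
    finally show ?thesis using assms by (simp add: field_simps)
  qed
  finally show ?thesis by (simp add: diff_divide_distrib)
qed

text \<open>Either sign of the difference is at most ln (1 + |c| / |x|), where x is the point in the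
  denominator: z - b for one sign and z - (b - c) for the other.\<close>

lemma abs_ln_norm_shift_le:
  fixes z c b :: complex
  assumes "z \<noteq> b" "z + c \<noteq> b" "0 < \<alpha>" "\<alpha> \<le> 1"
  shows "\<bar>ln (cmod (z + c - b)) - ln (cmod (z - b))\<bar>
     \<le> cmod c powr \<alpha> / \<alpha> * (cmod (z - b) powr - \<alpha> + cmod (z - (b - c)) powr - \<alpha>)"
proof -
  have one: "ln (cmod (x + c)) - ln (cmod x) \<le> cmod c powr \<alpha> / \<alpha> * cmod x powr - \<alpha>"
    if "x \<noteq> 0" "x + c \<noteq> 0" for x c :: complex
  proof -
    have "ln (cmod (x + c)) - ln (cmod x) = ln (cmod (x + c) / cmod x)" using that by (simp add: ln_div)
    also have "\<dots> \<le> ln (1 + cmod c / cmod x)"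
      using that norm_triangle_ineq[of x c] by (intro ln_mono) (auto simp: field_simps)
    also have "\<dots> \<le> (cmod c / cmod x) powr \<alpha> / \<alpha>" using assms by (intro ln_one_plus_le_powr) auto
    also have "\<dots> = cmod c powr \<alpha> / \<alpha> * cmod x powr - \<alpha>" by (simp add: powr_divide powr_minus field_simps)
    finally show ?thesis .
  qed
  have "z + c - b \<noteq> 0" "z - b \<noteq> 0" "z - (b - c) \<noteq> 0" using assms by (auto simp: algebra_simps)
  hence "ln (cmod (z + c - b)) - ln (cmod (z - b)) \<le> cmod c powr \<alpha> / \<alpha> * cmod (z - b) powr - \<alpha>"
    "ln (cmod (z - b)) - ln (cmod (z + c - b)) \<le> cmod c powr \<alpha> / \<alpha> * cmod (z - (b - c)) powr - \<alpha>"
    using one[of "z - b" c] one[of "z + c - b" "- c"] by (simp_all add: algebra_simps)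
  moreover have "0 \<le> cmod c powr \<alpha> / \<alpha> * cmod (z - b) powr - \<alpha>" "0 \<le> cmod c powr \<alpha> / \<alpha> * cmod (z - (b - c)) powr - \<alpha>"
    using assms by auto
  ultimately show ?thesis unfolding distrib_left by linarith
qed

text \<open>The contribution of a single zero or pole b to the mean of |ln |f(z + c) / f(z)||. Both
  b and b - c have to avoid the circle, as these are the points where the integrand is
  singular.\<close>

lemma circle_mean_ln_norm_shift_le:
  assumes \<alpha>: "0 < \<alpha>" "\<alpha> < 1"
  shows "\<exists>K\<ge>0. \<forall>r>0. \<forall>b. cmod b \<noteq> r \<longrightarrow> cmod (b - c) \<noteq> r \<longrightarrow>
           circle_mean r (\<lambda>z. \<bar>ln (cmod (z + c - b)) - ln (cmod (z - b))\<bar>) \<le> K * r powr - \<alpha>"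
proof -
  obtain K where K: "K \<ge> 0" "\<And>r b. 0 < r \<Longrightarrow> cmod b \<noteq> r \<Longrightarrow> circle_mean r (\<lambda>z. cmod (z - b) powr - \<alpha>) \<le> K * r powr - \<alpha>"
    using circle_mean_powr_le[OF \<alpha>] by blast
  define D where "D = cmod c powr \<alpha> / \<alpha>"
  have D: "0 \<le> D" using \<alpha> by (simp add: D_def)
  have "circle_mean r (\<lambda>z. \<bar>ln (cmod (z + c - b)) - ln (cmod (z - b))\<bar>) \<le> (2 * D * K) * r powr - \<alpha>"
    if r: "0 < r" and b: "cmod b \<noteq> r" "cmod (b - c) \<noteq> r" for r b
  proof -
    have zb: "z \<noteq> b" "z + c \<noteq> b" if "cmod z = r" for z
      using b that by auto
    have cont: "continuous_on (sphere 0 r) (\<lambda>z. cmod (z - b) powr - \<alpha>)"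
      "continuous_on (sphere 0 r) (\<lambda>z. cmod (z - (b - c)) powr - \<alpha>)"
      using b by (intro continuous_intros; auto)+
    have cont2: "continuous_on (sphere 0 r) (\<lambda>z. \<bar>ln (cmod (z + c - b)) - ln (cmod (z - b))\<bar>)"
      using zb by (intro continuous_intros) auto
    have "circle_mean r (\<lambda>z. \<bar>ln (cmod (z + c - b)) - ln (cmod (z - b))\<bar>)
        \<le> circle_mean r (\<lambda>z. D * (cmod (z - b) powr - \<alpha> + cmod (z - (b - c)) powr - \<alpha>))"
      using r \<alpha> zb unfolding D_def
      by (intro circle_mean_mono abs_ln_norm_shift_le cont2 continuous_on_mult_left continuous_on_add cont) auto
    also have "\<dots> = D * (circle_mean r (\<lambda>z. cmod (z - b) powr - \<alpha>) + circle_mean r (\<lambda>z. cmod (z - (b - c)) powr - \<alpha>))"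
      using r by (subst circle_mean_cmult, subst circle_mean_add[OF cont]) auto
    also have "\<dots> \<le> D * (K * r powr - \<alpha> + K * r powr - \<alpha>)"
      using r b D by (intro mult_left_mono add_mono K) auto
    finally show ?thesis by (simp add: algebra_simps)
  qed
  thus ?thesis using D K(1) by (intro exI[of _ "2 * D * K"]) auto
qed

section \<open>Meromorphic functions, orders and Blaschke factors\<close>

definition nz_meromorphic :: "(complex \<Rightarrow> complex) \<Rightarrow> bool" where
  "nz_meromorphic f \<longleftrightarrow> f meromorphic_on UNIV \<and> \<not> eventually (\<lambda>z. f z = 0) (cosparse UNIV)"

text \<open>On the connected plane a meromorphic function that is not 0 off a sparse set is nonzero
  off a sparse set; hence it is nonzero near every point, which is what order computations
  require.\<close>

lemma nz_meromorphicD: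
  assumes "nz_meromorphic f"
  shows "f meromorphic_on UNIV" "f meromorphic_on {z}"
    "eventually (\<lambda>w. f w \<noteq> 0) (cosparse UNIV)"
    "eventually (\<lambda>w. f w \<noteq> 0) (at z)" "frequently (\<lambda>w. f w \<noteq> 0) (at z)"
proof -
  show 1: "f meromorphic_on UNIV" using assms by (simp add: nz_meromorphic_def)
  thus "f meromorphic_on {z}" by (rule meromorphic_on_subset) auto
  show 2: "eventually (\<lambda>w. f w \<noteq> 0) (cosparse UNIV)"
    using meromorphic_imp_constant_or_avoid[OF 1, of 0] assms by (auto simp: nz_meromorphic_def)
  thus 3: "eventually (\<lambda>w. f w \<noteq> 0) (at z)" by (rule eventually_cosparse_imp_eventually_at) auto
  thus "frequently (\<lambda>w. f w \<noteq> 0) (at z)" by (simp add: eventually_frequently)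
qed

lemma nz_meromorphicI:
  assumes "f meromorphic_on UNIV" "frequently (\<lambda>w. f w \<noteq> 0) (at z)"
  shows "nz_meromorphic f"
  unfolding nz_meromorphic_def
proof (intro conjI notI assms(1))
  assume "eventually (\<lambda>z. f z = 0) (cosparse UNIV)"
  hence "eventually (\<lambda>w. f w = 0) (at z)" by (rule eventually_cosparse_imp_eventually_at) auto
  with assms(2) show False by (auto simp: frequently_def)
qed

lemma nz_meromorphic_ev_at:
  assumes "f meromorphic_on UNIV" "eventually (\<lambda>w. f w \<noteq> 0) (at z)"
  shows "nz_meromorphic f"
  by (rule nz_meromorphicI[OF assms(1), of z]) (use assms(2) in \<open>simp add: eventually_frequently\<close>)

lemma nz_meromorphic_mult:
  assumes "nz_meromorphic f" "nz_meromorphic g" shows "nz_meromorphic (\<lambda>z. f z * g z)"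
proof (rule nz_meromorphic_ev_at)
  show "eventually (\<lambda>w. f w * g w \<noteq> 0) (at 0)"
    using nz_meromorphicD(4)[OF assms(1), of 0] nz_meromorphicD(4)[OF assms(2), of 0]
    by eventually_elim simp
qed (intro meromorphic_intros nz_meromorphicD assms)

lemma nz_meromorphic_divide:
  assumes "nz_meromorphic f" "nz_meromorphic g" shows "nz_meromorphic (\<lambda>z. f z / g z)"
proof (rule nz_meromorphic_ev_at)
  show "eventually (\<lambda>w. f w / g w \<noteq> 0) (at 0)"
    using nz_meromorphicD(4)[OF assms(1), of 0] nz_meromorphicD(4)[OF assms(2), of 0]
    by eventually_elim simp
qed (intro meromorphic_intros nz_meromorphicD assms)

lemma nz_meromorphic_const [simp]: "c \<noteq> 0 \<Longrightarrow> nz_meromorphic (\<lambda>_. c)"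
  by (rule nz_meromorphic_ev_at[of _ 0]) auto

lemma nz_meromorphic_inverse: "nz_meromorphic f \<Longrightarrow> nz_meromorphic (\<lambda>z. 1 / f z)"
  using nz_meromorphic_divide[of "\<lambda>_. 1" f] by simp

lemma nz_meromorphic_power: "nz_meromorphic f \<Longrightarrow> nz_meromorphic (\<lambda>z. f z ^ n)"
  by (induction n) (auto intro: nz_meromorphic_mult)

lemma nz_meromorphic_prod:
  "finite A \<Longrightarrow> (\<And>a. a \<in> A \<Longrightarrow> nz_meromorphic (f a)) \<Longrightarrow> nz_meromorphic (\<lambda>z. \<Prod>a\<in>A. f a z)"
  by (induction A rule: finite_induct) (auto intro: nz_meromorphic_mult)

lemma shift_at: "filtermap (\<lambda>z. z + c) (at (a :: complex)) = at (a + c)"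
  using filtermap_at_shift[of "- c" a] by (simp add: algebra_simps)

lemma shift_analytic_iff:
  "(\<lambda>z. f (z + c)) analytic_on {a} \<longleftrightarrow> f analytic_on {a + c}" for f :: "complex \<Rightarrow> complex"
proof
  assume "f analytic_on {a + c}"
  hence "f \<circ> (\<lambda>z. z + c) analytic_on {a}"
    by (intro analytic_on_compose_gen[where T = "{a + c}"] analytic_intros) auto
  thus "(\<lambda>z. f (z + c)) analytic_on {a}" by (simp add: o_def)
next
  assume "(\<lambda>z. f (z + c)) analytic_on {a}"
  hence "(\<lambda>z. f (z + c)) \<circ> (\<lambda>z. z - c) analytic_on {a + c}"
    by (intro analytic_on_compose_gen[where T = "{a}"] analytic_intros) auto
  thus "f analytic_on {a + c}" by (simp add: o_def)
qed

lemma nz_meromorphic_shift: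
  assumes "nz_meromorphic f" shows "nz_meromorphic (\<lambda>z. f (z + c))"
proof (rule nz_meromorphic_ev_at)
  show "(\<lambda>z. f (z + c)) meromorphic_on UNIV"
    by (rule meromorphic_on_compose[of f UNIV "\<lambda>z. z + c" UNIV])
       (auto intro!: analytic_intros nz_meromorphicD(1)[OF assms])
  show "eventually (\<lambda>w. f (w + c) \<noteq> 0) (at 0)"
    using nz_meromorphicD(4)[OF assms, of "0 + c"] unfolding shift_at[symmetric] eventually_filtermap .
qed

lemma zorder_shift_arg: "zorder (\<lambda>z. f (z + c)) a = zorder f (a + c)"
  using zorder_shift[of f "a + c"] zorder_shift[of "\<lambda>z. f (z + c)" a] by (simp add: add.assoc)

lemma zorder_cong_cosparse:
  assumes "eventually (\<lambda>z. f z = g z) (cosparse UNIV)"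
  shows "zorder f z = zorder g z"
  by (rule zorder_cong[OF eventually_cosparse_imp_eventually_at[OF assms]]) auto

lemma nz_zorder_mult:
  "nz_meromorphic f \<Longrightarrow> nz_meromorphic g \<Longrightarrow> zorder (\<lambda>z. f z * g z) z = zorder f z + zorder g z"
  by (intro zorder_mult nz_meromorphicD)

lemma nz_zorder_divide:
  "nz_meromorphic f \<Longrightarrow> nz_meromorphic g \<Longrightarrow> zorder (\<lambda>z. f z / g z) z = zorder f z - zorder g z"
  by (intro zorder_divide nz_meromorphicD)

lemma nz_zorder_inverse: "nz_meromorphic f \<Longrightarrow> zorder (\<lambda>z. 1 / f z) z = - zorder f z"
  using nz_zorder_divide[of "\<lambda>_. 1" f z] by simp

lemma nz_zorder_power: "nz_meromorphic f \<Longrightarrow> zorder (\<lambda>z. f z ^ n) z = int n * zorder f z"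
  by (intro zorder_power nz_meromorphicD)

lemma nz_zorder_prod:
  assumes "finite A" "\<And>a. a \<in> A \<Longrightarrow> nz_meromorphic (f a)"
  shows "zorder (\<lambda>z. \<Prod>a\<in>A. f a z) z = (\<Sum>a\<in>A. zorder (f a) z)"
  by (intro zorder_prod nz_meromorphicD(2) nz_meromorphicD(4) nz_meromorphic_prod assms)

lemma nz_is_pole_iff:
  assumes "nz_meromorphic f" shows "is_pole f z \<longleftrightarrow> zorder f z < 0"
proof
  assume "is_pole f z"
  thus "zorder f z < 0" using nz_meromorphicD(2)[OF assms]
    by (intro isolated_pole_imp_neg_zorder) (auto simp: meromorphic_at_iff)
qed (intro zorder_neg_imp_is_pole nz_meromorphicD assms)

lemma nz_zorder_eq_0:
  assumes f: "nz_meromorphic f" and z: "zorder f z = 0"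
  shows "remove_sings f analytic_on {z}" "remove_sings f z \<noteq> 0"
proof -
  have mero: "isolated_singularity_at f z" "not_essential f z"
    using nz_meromorphicD(2)[OF f, of z] by (auto simp: meromorphic_at_iff)
  have np: "\<not> is_pole f z" using nz_is_pole_iff[OF f] z by simp
  then obtain c where c: "f \<midarrow>z\<rightarrow> c" using mero(2) by (auto simp: not_essential_def)
  show "remove_sings f analytic_on {z}" by (rule remove_sings_analytic_at[OF mero(1) c])
  show "remove_sings f z \<noteq> 0"
  proof
    assume "remove_sings f z = 0"
    hence "f \<midarrow>z\<rightarrow> 0" using remove_sings_eq_0_iff[OF mero(2)] np by simp
    hence "isolated_zero f z" using nz_meromorphicD(4)[OF f] by (simp add: isolated_zero_def)
    hence "zorder f z > 0" using mero(1) by (rule zorder_isolated_zero_pos')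
    thus False using z by simp
  qed
qed

section \<open>Poles as weights, and circles free of zeros and singularities\<close>

definition pole_mult :: "(complex \<Rightarrow> complex) \<Rightarrow> complex \<Rightarrow> nat" where
  "pole_mult f z = (if is_pole f z then nat (- zorder f z) else 0)"

definition pole_ind :: "(complex \<Rightarrow> complex) \<Rightarrow> complex \<Rightarrow> nat" where
  "pole_ind f z = (if is_pole f z then 1 else 0)"

lemma pole_mult_nz: "nz_meromorphic f \<Longrightarrow> pole_mult f z = nat (- zorder f z)"
  by (auto simp: pole_mult_def nz_is_pole_iff)

lemma pole_ind_nz: "nz_meromorphic f \<Longrightarrow> pole_ind f z = (if zorder f z < 0 then 1 else 0)"
  by (auto simp: pole_ind_def nz_is_pole_iff)

lemma pole_ind_le_mult: "nz_meromorphic f \<Longrightarrow> pole_ind f z \<le> pole_mult f z"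
  by (auto simp: pole_mult_nz pole_ind_nz)

lemma finite_sparse_cball:
  assumes "A sparse_in (UNIV :: complex set)"
  shows "finite {z. z \<in> A \<and> cmod z \<le> r}"
proof -
  have "finite (cball 0 r \<inter> A)"
    using assms by (intro sparse_in_compact_finite) (auto elim: sparse_in_subset)
  moreover have "{z. z \<in> A \<and> cmod z \<le> r} = cball 0 r \<inter> A" by auto
  ultimately show ?thesis by simp
qed

lemma locally_finite_pole_ind:
  assumes "f meromorphic_on UNIV" shows "locally_finite_weight (pole_ind f)"
  unfolding locally_finite_weight_def
proof
  fix r
  have "{z. is_pole f z} sparse_in UNIV"
    using meromorphic_on_imp_not_pole_cosparse[OF assms] by (simp add: eventually_cosparse)
  from finite_sparse_cball[OF this, of r]
  show "finite {z. pole_ind f z \<noteq> 0 \<and> cmod z \<le> r}"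
    by (rule rev_finite_subset) (auto simp: pole_ind_def)
qed

lemma locally_finite_pole_mult:
  "f meromorphic_on UNIV \<Longrightarrow> locally_finite_weight (pole_mult f)"
  by (erule locally_finite_weight_mono[OF locally_finite_pole_ind])
     (auto simp: pole_mult_def pole_ind_def split: if_splits)

lemma nev_N_eq:
  assumes "f meromorphic_on UNIV" "0 < r"
  shows "nev_N r f = weighted_N (pole_mult f) r"
  unfolding nev_N_def
proof (rule integrated_count_eq_weighted_N[OF locally_finite_pole_mult[OF assms(1)] assms(2)])
  fix t
  have "pole_mult f z \<noteq> 0 \<longleftrightarrow> is_pole f z" for z
    using isolated_pole_imp_neg_zorder[of f z] meromorphic_on_subset[OF assms(1), of "{z}"]
    by (auto simp: pole_mult_def meromorphic_at_iff)
  thus "pole_count f t = (\<Sum>z | pole_mult f z \<noteq> 0 \<and> cmod z \<le> t. pole_mult f z)"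
    unfolding pole_count_def by (intro sum.cong) (auto simp: pole_mult_def)
qed

lemma nev_Nbar_eq:
  assumes "f meromorphic_on UNIV" "0 < r"
  shows "nev_Nbar r f = weighted_N (pole_ind f) r"
  unfolding nev_Nbar_def
proof (rule integrated_count_eq_weighted_N[OF locally_finite_pole_ind[OF assms(1)] assms(2)])
  fix t
  have "distinct_pole_count f t = (\<Sum>z | is_pole f z \<and> cmod z \<le> t. 1)"
    by (simp add: distinct_pole_count_def)
  also have "\<dots> = (\<Sum>z | pole_ind f z \<noteq> 0 \<and> cmod z \<le> t. pole_ind f z)"
    by (intro sum.cong) (auto simp: pole_ind_def split: if_splits)
  finally show "distinct_pole_count f t = (\<Sum>z | pole_ind f z \<noteq> 0 \<and> cmod z \<le> t. pole_ind f z)" .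
qed

lemma nev_N_nonneg: "f meromorphic_on UNIV \<Longrightarrow> 1 \<le> r \<Longrightarrow> 0 \<le> nev_N r f"
  by (simp add: nev_N_eq weighted_N_nonneg)

text \<open>Analyticity is required of the function as given, so a removable singularity with a
  wrong value is bad as well. At good points the stored values and the derivative can be
  trusted.\<close>

definition good_point :: "(complex \<Rightarrow> complex) \<Rightarrow> complex \<Rightarrow> bool" where
  "good_point f z \<longleftrightarrow> f analytic_on {z} \<and> f z \<noteq> 0"

definition generic :: "(complex \<Rightarrow> complex) \<Rightarrow> real \<Rightarrow> bool" where
  "generic f r \<longleftrightarrow> 0 < r \<and> (\<forall>z. cmod z = r \<longrightarrow> good_point f z)"

lemma eventually_good_point:
  assumes "nz_meromorphic f" shows "eventually (good_point f) (cosparse UNIV)"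
  using meromorphic_on_imp_analytic_cosparse[OF nz_meromorphicD(1)[OF assms]] nz_meromorphicD(3)[OF assms]
  by eventually_elim (simp add: good_point_def)

lemma countable_not_generic:
  assumes "nz_meromorphic f" shows "countable {r. 0 < r \<and> \<not> generic f r}"
proof -
  have "countable {z. \<not> good_point f z}"
    using eventually_good_point[OF assms] unfolding eventually_cosparse
    using sparse_imp_countable[OF open_UNIV, of "{z. \<not> good_point f z}"] by simp
  hence "countable (cmod ` {z. \<not> good_point f z})" by simp
  moreover have "{r. 0 < r \<and> \<not> generic f r} \<subseteq> cmod ` {z. \<not> good_point f z}"
    by (auto simp: generic_def)
  ultimately show ?thesis by (rule countable_subset[rotated])
qed

lemma eventually_generic:
  assumes "nz_meromorphic f" shows "eventually (generic f) nev_filter"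
  using eventually_nev_not_in[OF finite_log_measure_countable[OF countable_not_generic[OF assms]]]
    eventually_at_top_imp_nev[OF eventually_gt_at_top[of 0]]
  by eventually_elim auto

lemma generic_exists:
  assumes "nz_meromorphic f" "0 \<le> a" "a < b"
  shows "\<exists>r. a < r \<and> r < b \<and> generic f r"
proof (rule ccontr)
  assume "\<not> ?thesis"
  hence "{a<..<b} \<subseteq> {r. 0 < r \<and> \<not> generic f r}" using assms by auto
  hence "countable {a<..<b}" using countable_not_generic[OF assms(1)] by (rule countable_subset)
  thus False using assms(3) uncountable_open_interval[of a b] by blast
qed

lemma good_point_zorder: "good_point f z \<Longrightarrow> zorder f z = 0"
  by (auto simp: good_point_def intro: zorder_eq_0I)

lemma generic_continuous: "generic f r \<Longrightarrow> continuous_on (sphere 0 r) f"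
proof -
  assume "generic f r"
  hence "f analytic_on sphere 0 r"
    by (subst analytic_on_analytic_at) (auto simp: generic_def good_point_def)
  thus ?thesis by (intro holomorphic_on_imp_continuous_on analytic_imp_holomorphic)
qed

lemma generic_pos: "generic f r \<Longrightarrow> 0 < r"
  by (simp add: generic_def)

lemma generic_nonzero: "generic f r \<Longrightarrow> cmod z = r \<Longrightarrow> f z \<noteq> 0"
  by (simp add: generic_def good_point_def)

lemma generic_inverse: "generic f r \<Longrightarrow> generic (\<lambda>z. 1 / f z) r"
  by (auto simp: generic_def good_point_def intro!: analytic_intros)

section \<open>Elementary inequalities for the positive part of the logarithm\<close>

lemma continuous_on_log_plus [continuous_intros]:
  "continuous_on A f \<Longrightarrow> continuous_on A (\<lambda>x. log_plus (f x))"
  unfolding log_plus_def by (intro continuous_intros) auto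

lemma log_plus_nonneg [simp]: "0 \<le> log_plus x"
  by (simp add: log_plus_def)

lemma log_plus_mono: "x \<le> y \<Longrightarrow> log_plus x \<le> log_plus y"
  unfolding log_plus_def by (intro ln_mono) auto

lemma log_plus_eq: "0 < x \<Longrightarrow> log_plus x = max 0 (ln x)"
  by (auto simp: log_plus_def max_def)

lemma log_plus_mult_le: "0 \<le> x \<Longrightarrow> 0 \<le> y \<Longrightarrow> log_plus (x * y) \<le> log_plus x + log_plus y"
proof -
  assume xy: "0 \<le> x" "0 \<le> y"
  have "x * y \<le> max 1 x * max 1 y" using xy by (intro mult_mono) auto
  moreover have "1 \<le> max 1 x * max 1 y" using mult_mono[of 1 "max 1 x" 1 "max 1 y"] by simp
  ultimately have "ln (max 1 (x * y)) \<le> ln (max 1 x * max 1 y)" by (intro ln_mono) auto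
  also have "\<dots> = ln (max 1 x) + ln (max 1 y)" by (rule ln_mult_pos) auto
  finally show ?thesis by (simp add: log_plus_def)
qed

lemma log_plus_add_le: "0 \<le> x \<Longrightarrow> 0 \<le> y \<Longrightarrow> log_plus (x + y) \<le> log_plus x + log_plus y + ln 2"
proof -
  assume xy: "0 \<le> x" "0 \<le> y"
  have "max 1 (x + y) \<le> 2 * (max 1 x * max 1 y)"
  proof -
    have "max 1 x * 1 \<le> max 1 x * max 1 y" "1 * max 1 y \<le> max 1 x * max 1 y"
      by (intro mult_left_mono mult_right_mono; simp)+
    thus ?thesis by simp
  qed
  hence "ln (max 1 (x + y)) \<le> ln (2 * (max 1 x * max 1 y))" by (intro ln_mono) auto
  also have "\<dots> = ln 2 + (ln (max 1 x) + ln (max 1 y))"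
    using ln_mult_pos[of 2 "max 1 x * max 1 y"] ln_mult_pos[of "max 1 x" "max 1 y"] by simp
  finally show ?thesis by (simp add: log_plus_def)
qed

lemma log_plus_power: "0 \<le> x \<Longrightarrow> log_plus (x ^ n) = real n * log_plus x"
proof (cases "x \<le> 1")
  case True
  moreover assume "0 \<le> x"
  ultimately show ?thesis by (simp add: log_plus_def power_le_one)
next
  case False
  thus ?thesis by (simp add: log_plus_def max_def ln_realpow)
qed

lemma abs_ln_eq_log_plus: "0 < x \<Longrightarrow> \<bar>ln x\<bar> = log_plus x + log_plus (1 / x)"
  by (auto simp: log_plus_eq ln_div)

lemma ln_eq_log_plus: "0 < x \<Longrightarrow> ln x = log_plus x - log_plus (1 / x)"
  by (auto simp: log_plus_eq ln_div)

lemma nev_m_eq: "nev_m r f = circle_mean r (\<lambda>z. log_plus (cmod (f z)))"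
  by (simp add: nev_m_def circle_mean_def)

lemma nev_m_nonneg: "continuous_on (sphere 0 r) f \<Longrightarrow> 0 \<le> r \<Longrightarrow> 0 \<le> nev_m r f"
  unfolding nev_m_eq by (intro circle_mean_nonneg continuous_intros) auto

section \<open>Blaschke factors of a disc\<close>

definition blaschke :: "real \<Rightarrow> complex \<Rightarrow> complex \<Rightarrow> complex" where
  "blaschke R a z = of_real R * (z - a) / (of_real (R\<^sup>2) - cnj a * z)"

lemma blaschke_norm_eq_1:
  assumes "cmod a < R" "cmod z = R" shows "cmod (blaschke R a z) = 1"
proof -
  have R: "0 < R" using assms norm_ge_zero[of a] by linarith
  have zz: "of_real (R\<^sup>2) = z * cnj z" using assms by (simp add: complex_norm_square[symmetric] del: of_real_power)
  have "of_real (R\<^sup>2) - cnj a * z = z * cnj (z - a)" unfolding zz by (simp add: algebra_simps)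
  hence "cmod (of_real (R\<^sup>2) - cnj a * z) = R * cmod (z - a)" using assms by (simp add: norm_mult del: complex_cnj_diff)
  moreover have "z \<noteq> a" using assms by auto
  ultimately show ?thesis using R by (simp add: blaschke_def norm_mult norm_divide)
qed

lemma blaschke_holomorphic: "cmod a < R \<Longrightarrow> blaschke R a holomorphic_on cball 0 R"
  unfolding blaschke_def[abs_def] using denominator_nonzero by (intro holomorphic_intros) auto

lemma blaschke_eq_0_iff:
  assumes "cmod a < R" "cmod z \<le> R" shows "blaschke R a z = 0 \<longleftrightarrow> z = a"
  using denominator_nonzero[OF assms] assms norm_ge_zero[of a] by (auto simp: blaschke_def)

lemma blaschke_norm_le_1:
  assumes "cmod a < R" "cmod z \<le> R" shows "cmod (blaschke R a z) \<le> 1"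
proof (rule maximum_modulus_frontier[of "blaschke R a" "cball 0 R"])
  have R: "0 < R" using assms norm_ge_zero[of a] by linarith
  show "blaschke R a holomorphic_on interior (cball 0 R)"
    using blaschke_holomorphic[OF assms(1)] by (rule holomorphic_on_subset) auto
  show "continuous_on (closure (cball 0 R)) (blaschke R a)"
    using holomorphic_on_imp_continuous_on[OF blaschke_holomorphic[OF assms(1)]] by simp
  show "cmod (blaschke R a z) \<le> 1" if "z \<in> frontier (cball 0 R)" for z
    using blaschke_norm_eq_1[OF assms(1), of z] that by auto
qed (use assms in auto)

lemma blaschke_meromorphic: "blaschke R a meromorphic_on A"
  unfolding blaschke_def[abs_def] by (intro meromorphic_intros)

lemma blaschke_nz:
  assumes "cmod a < R" shows "nz_meromorphic (blaschke R a)"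
proof (rule nz_meromorphic_ev_at[OF blaschke_meromorphic])
  have "eventually (\<lambda>w. w \<in> ball 0 R - {a}) (at a)"
    using assms by (intro eventually_at_in_open) auto
  thus "eventually (\<lambda>w. blaschke R a w \<noteq> 0) (at a)"
    by eventually_elim (use blaschke_eq_0_iff[OF assms] in auto)
qed

lemma linear_zorder: "zorder (\<lambda>w. w - a) z = (if z = a then 1 else 0)" for a z :: complex
proof (cases "z = a")
  case True
  have "zorder (\<lambda>z. z - a) a = 1" by (rule zorder_eqI[of UNIV _ "\<lambda>_. 1"]) auto
  thus ?thesis using True by simp
next
  case False
  thus ?thesis by (auto intro!: zorder_eq_0I analytic_intros)
qed

lemma blaschke_zorder:
  assumes a: "cmod a < R" and z: "cmod z \<le> R"
  shows "zorder (blaschke R a) z = (if z = a then 1 else 0)"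
proof -
  have R: "0 < R" using a norm_ge_zero[of a] by linarith
  have nz: "of_real (R\<^sup>2) - cnj a * z \<noteq> 0" by (rule denominator_nonzero[OF a z])
  have an: "(\<lambda>z. of_real (R\<^sup>2) - cnj a * z) analytic_on {z}" "(\<lambda>z. of_real R * (z - a)) analytic_on {z}"
    by (intro analytic_intros)+
  have nz1: "nz_meromorphic (\<lambda>z. z - a)"
    by (rule nz_meromorphic_ev_at[of _ a]) (auto intro!: meromorphic_intros simp: eventually_at_filter)
  have nz2: "nz_meromorphic (\<lambda>z. of_real (R\<^sup>2) - cnj a * z)"
  proof (rule nz_meromorphic_ev_at[of _ z])
    show "eventually (\<lambda>w. of_real (R\<^sup>2) - cnj a * w \<noteq> 0) (at z)"
      by (rule tendsto_imp_eventually_ne[OF _ nz]) (intro tendsto_intros)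
  qed (intro meromorphic_intros)
  have "zorder (blaschke R a) z = zorder (\<lambda>z. of_real R * (z - a)) z - zorder (\<lambda>z. of_real (R\<^sup>2) - cnj a * z) z"
    unfolding blaschke_def[abs_def]
    using nz_zorder_divide[OF nz_meromorphic_mult[OF nz_meromorphic_const nz1] nz2, of "of_real R" z] R by simp
  also have "zorder (\<lambda>z. of_real (R\<^sup>2) - cnj a * z) z = 0" by (rule zorder_eq_0I[OF an(1) nz])
  also have "zorder (\<lambda>z. of_real R * (z - a)) z = zorder (\<lambda>z. z - a) z"
    using nz_zorder_mult[OF nz_meromorphic_const nz1, of "of_real R" z] R by simp
  finally show ?thesis by (simp add: linear_zorder)
qed

section \<open>Jensen formula and monotonicity of the characteristic\<close>

definition divisor_in :: "(complex \<Rightarrow> complex) \<Rightarrow> real \<Rightarrow> complex set" where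
  "divisor_in f R = {z. zorder f z \<noteq> 0 \<and> cmod z \<le> R}"

lemma finite_divisor_in:
  assumes "nz_meromorphic f" shows "finite (divisor_in f R)"
proof -
  have "{z. \<not> good_point f z} sparse_in UNIV"
    using eventually_good_point[OF assms] by (simp add: eventually_cosparse)
  from finite_sparse_cball[OF this, of R] show ?thesis
    by (rule rev_finite_subset) (auto simp: divisor_in_def dest: good_point_zorder)
qed

lemma generic_zorder: "generic f r \<Longrightarrow> cmod z = r \<Longrightarrow> zorder f z = 0"
  by (simp add: generic_def good_point_zorder)

lemma divisor_in_generic:
  assumes "generic f R" "a \<in> divisor_in f R" shows "cmod a < R"
  using assms generic_zorder[OF assms(1), of a] by (auto simp: divisor_in_def less_le)

lemma has_field_derivative_prod_powi:
  fixes g :: "'b \<Rightarrow> complex \<Rightarrow> complex"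
  assumes "finite A" "\<And>a. a \<in> A \<Longrightarrow> (g a has_field_derivative g' a) (at z)" "\<And>a. a \<in> A \<Longrightarrow> g a z \<noteq> 0"
  shows "((\<lambda>z. \<Prod>a\<in>A. g a z powi k a) has_field_derivative
           (\<Prod>a\<in>A. g a z powi k a) * (\<Sum>a\<in>A. of_int (k a) * g' a / g a z)) (at z)"
  using assms
proof (induction A)
  case (insert b A)
  have "((\<lambda>z. g b z powi k b) has_field_derivative of_int (k b) * g b z powi (k b - 1) * g' b) (at z)"
    using insert.prems by (auto intro!: derivative_eq_intros)
  moreover have "of_int (k b) * g b z powi (k b - 1) * g' b = g b z powi k b * (of_int (k b) * g' b / g b z)"
    using insert.prems(2)[of b] by (simp add: power_int_diff)
  ultimately have "((\<lambda>z. g b z powi k b) has_field_derivative g b z powi k b * (of_int (k b) * g' b / g b z)) (at z)"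
    by simp
  from DERIV_mult[OF this insert.IH] insert show ?case
    by (simp add: algebra_simps)
qed simp

text \<open>Powers of Blaschke factors cancel all zeros and poles in the closed disc. Once
  singularities are removed, the product is holomorphic and zero-free near the disc and has a
  logarithm there. The margin R' > R matters because the Poisson formulas use holomorphy on the
  closed disc.\<close>

lemma blaschke_factorization:
  assumes f: "nz_meromorphic f" and R: "generic f R"
  obtains R' L where "R < R'" "L holomorphic_on ball 0 R'"
    "\<And>z. cmod z \<le> R \<Longrightarrow> good_point f z \<Longrightarrow>
       exp (L z) = f z * (\<Prod>a\<in>divisor_in f R. blaschke R a z powi (- zorder f a))"
proof -
  let ?Z = "divisor_in f R"
  have R0: "0 < R" using R by (rule generic_pos)
  have fin: "finite ?Z" using f by (rule finite_divisor_in)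
  have ZR: "cmod a < R" if "a \<in> ?Z" for a using divisor_in_generic[OF R that] .
  have nzpow: "nz_meromorphic (\<lambda>z. blaschke R a z powi k)" if "a \<in> ?Z" for a k
  proof (rule nz_meromorphic_ev_at)
    show "eventually (\<lambda>w. blaschke R a w powi k \<noteq> 0) (at 0)"
      using nz_meromorphicD(4)[OF blaschke_nz[OF ZR[OF that]], of 0] by eventually_elim (simp add: power_int_eq_0_iff)
  qed (intro meromorphic_intros blaschke_meromorphic)
  define g where "g z = f z * (\<Prod>a\<in>?Z. blaschke R a z powi (- zorder f a))" for z
  have nzprod: "nz_meromorphic (\<lambda>z. \<Prod>a\<in>?Z. blaschke R a z powi (- zorder f a))"
    by (intro nz_meromorphic_prod fin nzpow)
  have g_nz: "nz_meromorphic g"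
    unfolding g_def[abs_def] by (intro nz_meromorphic_mult f nzprod)
  have g_ord: "zorder g z = 0" if z: "cmod z \<le> R" for z
  proof -
    have "zorder g z = zorder f z + (\<Sum>a\<in>?Z. zorder (\<lambda>z. blaschke R a z powi (- zorder f a)) z)"
      unfolding g_def[abs_def] by (subst nz_zorder_mult[OF f nzprod], subst nz_zorder_prod[OF fin nzpow]) auto
    also have "(\<Sum>a\<in>?Z. zorder (\<lambda>z. blaschke R a z powi (- zorder f a)) z) = (\<Sum>a\<in>?Z. if z = a then - zorder f a else 0)"
    proof (rule sum.cong[OF refl])
      fix a assume a: "a \<in> ?Z"
      have "zorder (\<lambda>z. blaschke R a z powi (- zorder f a)) z = - zorder f a * zorder (blaschke R a) z"
        using nz_meromorphicD[OF blaschke_nz[OF ZR[OF a]]] by (intro zorder_power_int) auto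
      thus "zorder (\<lambda>z. blaschke R a z powi (- zorder f a)) z = (if z = a then - zorder f a else 0)"
        using blaschke_zorder[OF ZR[OF a] z] by simp
    qed
    also have "\<dots> = (if z \<in> ?Z then - zorder f z else 0)" using fin by simp
    finally show ?thesis using z by (auto simp: divisor_in_def)
  qed
  define G where "G = remove_sings g"
  \<comment> \<open>A union of open sets, hence open. Compactness of the closed disc then yields the
    margin \<open>e\<close>.\<close>
  define U where "U = \<Union>{s. open s \<and> G holomorphic_on s \<and> (\<forall>w\<in>s. G w \<noteq> 0)}"
  have "open U" unfolding U_def by (rule open_Union) auto
  have holU: "G holomorphic_on U"
    unfolding holomorphic_on_def
  proof
    fix z assume "z \<in> U"
    then obtain s where "open s" "z \<in> s" "G holomorphic_on s" unfolding U_def by blast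
    hence "G field_differentiable at z" using holomorphic_on_imp_differentiable_at by metis
    thus "G field_differentiable at z within U" by (rule field_differentiable_at_within)
  qed
  have nzU: "G w \<noteq> 0" if "w \<in> U" for w using that unfolding U_def by auto
  have "cball 0 R \<subseteq> U"
  proof
    fix z assume "z \<in> cball (0::complex) R"
    hence z: "cmod z \<le> R" by simp
    have "G analytic_on {z}" "G z \<noteq> 0" using nz_zorder_eq_0[OF g_nz g_ord[OF z]] by (simp_all add: G_def)
    then obtain s where s: "open s" "z \<in> s" "G holomorphic_on s" by (auto simp: analytic_at)
    have "open (s \<inter> G -` (- {0}))"
      by (rule continuous_open_preimage[OF holomorphic_on_imp_continuous_on[OF s(3)] s(1)]) auto
    moreover have "G holomorphic_on (s \<inter> G -` (- {0}))" using s(3) by (rule holomorphic_on_subset) auto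
    ultimately show "z \<in> U" unfolding U_def using s(2) \<open>G z \<noteq> 0\<close> by blast
  qed
  then obtain e where e: "0 < e" "(\<Union>x\<in>cball 0 R. ball x e) \<subseteq> U"
    using compact_subset_open_imp_ball_epsilon_subset[OF compact_cball \<open>open U\<close>] by metis
  have ballU: "ball 0 (R + e) \<subseteq> U"
  proof
    fix z assume "z \<in> ball (0::complex) (R + e)"
    hence z: "cmod z < R + e" by simp
    have "\<exists>x. cmod x \<le> R \<and> cmod (x - z) < e"
    proof (cases "cmod z \<le> R")
      case True thus ?thesis using e by (intro exI[of _ z]) auto
    next
      case False
      hence z0: "z \<noteq> 0" using R0 by auto
      \<comment> \<open>The radial projection of z to the circle of radius R, at distance |z| - R <
        e.\<close>
      define x where "x = of_real (R / cmod z) * z"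
      have "x - z = of_real (R / cmod z - 1) * z" by (simp add: x_def algebra_simps)
      hence "cmod (x - z) = (1 - R / cmod z) * cmod z"
        using False R0 by (simp add: norm_mult del: of_real_diff of_real_divide) (simp add: abs_if divide_simps)
      also have "\<dots> = cmod z - R" using z0 by (simp add: algebra_simps)
      finally have "cmod (x - z) = cmod z - R" .
      moreover have "cmod x = R" using z0 R0 by (simp add: x_def norm_mult norm_divide)
      ultimately show ?thesis using z by (intro exI[of _ x]) auto
    qed
    then obtain x where x: "cmod x \<le> R" "cmod (x - z) < e" by blast
    hence "z \<in> ball x e" "x \<in> cball 0 R" by (simp_all add: dist_norm)
    thus "z \<in> U" using e(2) by blast
  qed
  obtain L where L: "L holomorphic_on ball 0 (R + e)" "\<And>z. cmod z < R + e \<Longrightarrow> G z = exp (L z)"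
    using holomorphic_log_on_ball[of G "R + e"] holomorphic_on_subset[OF holU ballU] nzU ballU
    by (metis (no_types, lifting) in_mono mem_ball_0)
  show ?thesis
  proof (rule that[of "R + e" L])
    fix z assume z: "cmod z \<le> R" and gp: "good_point f z"
    have zZ: "z \<notin> ?Z" using good_point_zorder[OF gp] by (auto simp: divisor_in_def)
    have Ban: "blaschke R a analytic_on {z}" if a: "a \<in> ?Z" for a
      unfolding blaschke_def[abs_def] using denominator_nonzero[OF ZR[OF a] z] by (intro analytic_intros) auto
    have "(\<lambda>z. \<Prod>a\<in>?Z. blaschke R a z powi (- zorder f a)) analytic_on {z}"
      using blaschke_eq_0_iff[OF ZR z] zZ
      by (intro analytic_on_prod analytic_on_power_int Ban) auto
    hence "g analytic_on {z}" unfolding g_def[abs_def]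
      using gp by (intro analytic_on_mult) (auto simp: good_point_def)
    hence "G z = g z" by (simp add: G_def)
    thus "exp (L z) = f z * (\<Prod>a\<in>?Z. blaschke R a z powi (- zorder f a))"
      using L(2)[of z] z e by (simp add: g_def)
  qed (use e L in auto)
qed

lemma ln_norm_prod_powi:
  fixes g :: "'b \<Rightarrow> complex"
  assumes "finite A" "\<And>a. a \<in> A \<Longrightarrow> g a \<noteq> 0"
  shows "ln (cmod (\<Prod>a\<in>A. g a powi k a)) = (\<Sum>a\<in>A. of_int (k a) * ln (cmod (g a)))"
  using assms
proof (induction A)
  case (insert b A)
  have "ln (cmod (g b) powi k b) = of_int (k b) * ln (cmod (g b))"
    using insert.prems[of b] by (cases "k b \<ge> 0") (auto simp: power_int_def ln_realpow ln_inverse)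
  thus ?case using insert by (simp add: norm_mult ln_mult norm_power_int power_int_eq_0_iff)
qed simp

text \<open>The modulus, the boundary values and the logarithmic derivative of the factorisation. On
  the outer circle the Blaschke factors have modulus 1, which makes \<open>Re (L z)\<close> equal to
  ln |f| exactly where the Poisson formulas sample it.\<close>

lemma blaschke_log_factorization:
  assumes f: "nz_meromorphic f" and R: "generic f R"
  shows "\<exists>R' L. R < R' \<and> L holomorphic_on ball 0 R' \<and>
    (\<forall>z. cmod z \<le> R \<longrightarrow> good_point f z \<longrightarrow>
       ln (cmod (f z)) = Re (L z) + (\<Sum>a\<in>divisor_in f R. of_int (zorder f a) * ln (cmod (blaschke R a z)))) \<and>
    (\<forall>z. cmod z = R \<longrightarrow> Re (L z) = ln (cmod (f z))) \<and>
    (\<forall>z. cmod z < R \<longrightarrow> good_point f z \<longrightarrow>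
       deriv L z = deriv f z / f z
         - (\<Sum>a\<in>divisor_in f R. of_int (zorder f a) * (1 / (z - a) + cnj a / (of_real (R\<^sup>2) - cnj a * z))))"
proof -
  let ?Z = "divisor_in f R"
  have fin: "finite ?Z" using f by (rule finite_divisor_in)
  have ZR: "cmod a < R" if "a \<in> ?Z" for a using divisor_in_generic[OF R that] .
  obtain R' L where L: "R < R'" "L holomorphic_on ball 0 R'"
    "\<And>z. cmod z \<le> R \<Longrightarrow> good_point f z \<Longrightarrow>
       exp (L z) = f z * (\<Prod>a\<in>?Z. blaschke R a z powi (- zorder f a))"
    using blaschke_factorization[OF f R] by metis
  have B0: "blaschke R a z \<noteq> 0" if "a \<in> ?Z" "cmod z \<le> R" "good_point f z" for a z
    using blaschke_eq_0_iff[OF ZR[OF that(1)] that(2)] that good_point_zorder[OF that(3)]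
    by (auto simp: divisor_in_def)
  have main: "ln (cmod (f z)) = Re (L z) + (\<Sum>a\<in>?Z. of_int (zorder f a) * ln (cmod (blaschke R a z)))"
    if z: "cmod z \<le> R" "good_point f z" for z
  proof -
    have P: "(\<Prod>a\<in>?Z. blaschke R a z powi (- zorder f a)) \<noteq> 0"
      using B0[OF _ z] fin by (auto simp: power_int_eq_0_iff)
    have "Re (L z) = ln (cmod (exp (L z)))" by simp
    also have "\<dots> = ln (cmod (f z)) + ln (cmod (\<Prod>a\<in>?Z. blaschke R a z powi (- zorder f a)))"
      unfolding L(3)[OF z] using P z by (simp add: norm_mult ln_mult good_point_def)
    also have "ln (cmod (\<Prod>a\<in>?Z. blaschke R a z powi (- zorder f a)))
        = (\<Sum>a\<in>?Z. of_int (- zorder f a) * ln (cmod (blaschke R a z)))"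
      by (rule ln_norm_prod_powi[OF fin B0[OF _ z]])
    finally show ?thesis by (simp add: sum_negf)
  qed
  show ?thesis
  proof (intro exI[of _ R'] exI[of _ L] conjI allI impI L(1,2) main)
    fix z assume z: "cmod z = R"
    hence "good_point f z" using R by (simp add: generic_def)
    from main[OF _ this] show "Re (L z) = ln (cmod (f z))"
      using z ZR blaschke_norm_eq_1 by simp
  next
    fix z assume z: "cmod z < R" and gp: "good_point f z"
    define S where "S = (\<Sum>a\<in>?Z. of_int (zorder f a) * (1 / (z - a) + cnj a / (of_real (R\<^sup>2) - cnj a * z)))"
    define P where "P = (\<lambda>z. \<Prod>a\<in>?Z. blaschke R a z powi (- zorder f a))"
    define B' where "B' a = of_real R * (of_real (R\<^sup>2) - cnj a * a) / (of_real (R\<^sup>2) - cnj a * z)\<^sup>2" for a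
    have dB: "(blaschke R a has_field_derivative B' a) (at z)" if a: "a \<in> ?Z" for a
    proof -
      have "of_real (R\<^sup>2) - cnj a * z \<noteq> 0" using denominator_nonzero[OF ZR[OF a]] z by auto
      thus ?thesis unfolding blaschke_def[abs_def] B'_def
        by (auto intro!: derivative_eq_intros simp: power2_eq_square divide_simps) (simp add: algebra_simps)
    qed
    have qB: "B' a / blaschke R a z = 1 / (z - a) + cnj a / (of_real (R\<^sup>2) - cnj a * z)" if a: "a \<in> ?Z" for a
    proof -
      have d: "of_real (R\<^sup>2) - cnj a * z \<noteq> 0" using denominator_nonzero[OF ZR[OF a]] z by auto
      have za: "z - a \<noteq> 0" using good_point_zorder[OF gp] a by (auto simp: divisor_in_def)
      have R0: "complex_of_real R \<noteq> 0" using generic_pos[OF R] by simp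
      show ?thesis unfolding B'_def blaschke_def using d za R0
        by (simp add: divide_simps) (simp add: power2_eq_square algebra_simps)
    qed
    have "(P has_field_derivative P z * (\<Sum>a\<in>?Z. of_int (- zorder f a) * B' a / blaschke R a z)) (at z)"
      unfolding P_def using B0[OF _ less_imp_le[OF z] gp]
      by (intro has_field_derivative_prod_powi fin dB) auto
    also have "(\<Sum>a\<in>?Z. of_int (- zorder f a) * B' a / blaschke R a z) = - S"
      unfolding S_def sum_negf[symmetric] using qB
      by (intro sum.cong refl) (simp flip: times_divide_eq_right)
    finally have dP: "(P has_field_derivative P z * - S) (at z)" .
    have df: "(f has_field_derivative deriv f z) (at z)"
      using gp analytic_on_imp_differentiable_at[of f "{z}" z] by (simp add: good_point_def field_differentiable_derivI)
    \<comment> \<open>To be differentiated, the factorisation must hold in a neighbourhood; good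
      points form an open set.\<close>
    have ev: "eventually (\<lambda>w. exp (L w) = f w * P w) (nhds z)"
    proof -
      obtain s where s: "open s" "z \<in> s" "f holomorphic_on s" using gp by (auto simp: good_point_def analytic_at)
      have "open (s \<inter> f -` (- {0}))"
        by (rule continuous_open_preimage[OF holomorphic_on_imp_continuous_on[OF s(3)] s(1)]) auto
      hence "eventually (\<lambda>w. w \<in> s \<inter> f -` (- {0})) (nhds z)"
        using s(2) gp by (intro eventually_nhds_in_open) (auto simp: good_point_def)
      moreover have "eventually (\<lambda>w. w \<in> ball 0 R) (nhds z)"
        using z by (intro eventually_nhds_in_open) auto
      ultimately show ?thesis
      proof eventually_elim
        case (elim w)
        hence "good_point f w" using s analytic_at by (auto simp: good_point_def)
        thus ?case using L(3)[of w] elim by (simp add: P_def)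
      qed
    qed
    have dL: "(L has_field_derivative deriv L z) (at z)"
      using holomorphic_derivI[OF L(2), of z] z L(1) by simp
    have "((\<lambda>w. exp (L w)) has_field_derivative exp (L z) * deriv L z) (at z)"
      using dL by (auto intro!: derivative_eq_intros)
    moreover have "((\<lambda>w. f w * P w) has_field_derivative deriv f z * P z + P z * - S * f z) (at z)"
      by (rule DERIV_mult[OF df dP])
    hence "((\<lambda>w. exp (L w)) has_field_derivative deriv f z * P z + P z * - S * f z) (at z)"
      by (subst DERIV_cong_ev[OF refl ev refl])
    ultimately have "exp (L z) * deriv L z = deriv f z * P z + P z * - S * f z" by (rule DERIV_unique)
    moreover have eL: "exp (L z) = f z * P z" using L(3)[of z] z gp by (simp add: P_def)
    moreover have "P z \<noteq> 0" "f z \<noteq> 0" using eL by (metis exp_not_eq_zero mult_zero_left mult_zero_right)+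
    ultimately have "P z * (f z * deriv L z) = P z * (deriv f z - S * f z)" by (simp add: algebra_simps)
    hence "f z * deriv L z = deriv f z - S * f z" using \<open>P z \<noteq> 0\<close> by simp
    thus "deriv L z = deriv f z / f z - S" using \<open>f z \<noteq> 0\<close> by (simp add: field_simps)
  qed
qed

lemma circle_mean_Re_holomorphic:
  assumes "L holomorphic_on ball 0 R" "0 < r" "r < R"
  shows "circle_mean r (\<lambda>z. Re (L z)) = Re (L 0)"
proof -
  have "L holomorphic_on cball 0 r" using assms by (elim holomorphic_on_subset) auto
  from has_integral_Re[OF holomorphic_circle_mean[OF this assms(2)]]
  show ?thesis by (intro circle_mean_eqI) simp
qed

lemma continuous_on_ln_blaschke:
  assumes "cmod a < R" "r \<le> R" "cmod a \<noteq> r"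
  shows "continuous_on (sphere 0 r) (\<lambda>z. ln (cmod (blaschke R a z)))"
proof -
  have "continuous_on (sphere 0 r) (blaschke R a)"
    using holomorphic_on_imp_continuous_on[OF blaschke_holomorphic[OF assms(1)]]
    by (rule continuous_on_subset) (use assms in auto)
  thus ?thesis using assms blaschke_eq_0_iff[OF assms(1)] by (intro continuous_intros) auto
qed

text \<open>The denominator has no zeros in the disc, so its mean is the value 2 ln R at the centre.
  The numerator contributes \<open>ln R + ln (max r (cmod a))\<close>.\<close>

lemma circle_mean_ln_blaschke:
  assumes a: "cmod a < R" "cmod a \<noteq> r" and r: "0 < r" "r < R"
  shows "circle_mean r (\<lambda>z. ln (cmod (blaschke R a z))) = ln (max r (cmod a)) - ln R"
proof -
  have R: "0 < R" using r by simp
  have nz: "of_real (R\<^sup>2) - cnj a * z \<noteq> 0" if "cmod z < R" for z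
    using denominator_nonzero[OF a(1)] that by auto
  have c1: "continuous_on (sphere 0 r) (\<lambda>z. ln (cmod (z - a)))"
    using a by (intro continuous_intros) auto
  have c2: "continuous_on (sphere 0 r) (\<lambda>z. ln (cmod (of_real (R\<^sup>2) - cnj a * z)))"
    using nz r by (intro continuous_intros) auto
  have "circle_mean r (\<lambda>z. ln (cmod (blaschke R a z)))
      = circle_mean r (\<lambda>z. (ln R + ln (cmod (z - a))) - ln (cmod (of_real (R\<^sup>2) - cnj a * z)))"
  proof (rule circle_mean_cong)
    fix z assume z: "cmod z = r"
    hence "cmod (z - a) > 0" "cmod (of_real (R\<^sup>2) - cnj a * z) > 0" using a nz[of z] r by auto
    thus "ln (cmod (blaschke R a z)) = (ln R + ln (cmod (z - a))) - ln (cmod (of_real (R\<^sup>2) - cnj a * z))"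
      using R by (simp add: blaschke_def norm_mult norm_divide ln_mult ln_div del: of_real_power)
  qed (use r in simp)
  also have "\<dots> = (ln R + circle_mean r (\<lambda>z. ln (cmod (z - a)))) - circle_mean r (\<lambda>z. ln (cmod (of_real (R\<^sup>2) - cnj a * z)))"
    using r c1 c2 by (subst circle_mean_diff) (auto intro!: continuous_intros simp: circle_mean_add)
  also have "circle_mean r (\<lambda>z. ln (cmod (z - a))) = ln (max r (cmod a))"
    using circle_mean_ln_norm_diff[OF r(1) a(2)] .
  also have "circle_mean r (\<lambda>z. ln (cmod (of_real (R\<^sup>2) - cnj a * z))) = ln (cmod (of_real (R\<^sup>2) - cnj a * 0))"
    by (rule circle_mean_ln_norm_nonvanishing[OF _ nz r]) (auto intro!: holomorphic_intros)
  also have "\<dots> = 2 * ln R" using R by (simp add: norm_power ln_realpow)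
  finally show ?thesis by simp
qed

lemma divisor_sum_eq:
  assumes f: "nz_meromorphic f" and r: "0 < r" "r \<le> R"
  shows "(\<Sum>a\<in>divisor_in f R. real (pole_mult f a) * (ln R - ln (max r (cmod a)))) = nev_N R f - nev_N r f"
proof -
  have "(\<Sum>a\<in>divisor_in f R. real (pole_mult f a) * (ln R - ln (max r (cmod a))))
      = (\<Sum>z | pole_mult f z \<noteq> 0 \<and> cmod z \<le> R. real (pole_mult f z) * (ln R - ln (max r (cmod z))))"
    using finite_divisor_in[OF f, of R]
    by (intro sum.mono_neutral_right) (auto simp: divisor_in_def pole_mult_nz[OF f])
  also have "\<dots> = weighted_N (pole_mult f) R - weighted_N (pole_mult f) r"
    by (rule weighted_N_diff[OF locally_finite_pole_mult[OF nz_meromorphicD(1)[OF f]] r, symmetric])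
  also have "\<dots> = nev_N R f - nev_N r f" using f r by (simp add: nev_N_eq nz_meromorphicD)
  finally show ?thesis .
qed

lemma divisor_in_inverse:
  "nz_meromorphic f \<Longrightarrow> divisor_in (\<lambda>z. 1 / f z) R = divisor_in f R"
  by (simp add: divisor_in_def nz_zorder_inverse)

lemma zorder_eq_pole_mult:
  "nz_meromorphic f \<Longrightarrow> real_of_int (zorder f a) = real (pole_mult (\<lambda>z. 1 / f z) a) - real (pole_mult f a)"
  by (simp add: pole_mult_nz nz_meromorphic_inverse nz_zorder_inverse)

text \<open>Comparing two generic radii, instead of a radius with the centre, avoids the leading
  Laurent coefficient at 0 and any case distinction for a zero or pole there.\<close>

lemma Jensen_formula:
  assumes f: "nz_meromorphic f" and r: "generic f r" and R: "generic f R" and rR: "r < R"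
  shows "circle_mean r (\<lambda>z. ln (cmod (f z))) - nev_N r (\<lambda>z. 1 / f z) + nev_N r f
       = circle_mean R (\<lambda>z. ln (cmod (f z))) - nev_N R (\<lambda>z. 1 / f z) + nev_N R f"
proof -
  let ?Z = "divisor_in f R"
  have fin: "finite ?Z" using f by (rule finite_divisor_in)
  have pos: "0 < r" "0 < R" using r R by (auto dest: generic_pos)
  obtain R' L where L: "R < R'" "L holomorphic_on ball 0 R'"
    "\<And>z. cmod z \<le> R \<Longrightarrow> good_point f z \<Longrightarrow>
       ln (cmod (f z)) = Re (L z) + (\<Sum>a\<in>?Z. of_int (zorder f a) * ln (cmod (blaschke R a z)))"
    "\<And>z. cmod z = R \<Longrightarrow> Re (L z) = ln (cmod (f z))"
    using blaschke_log_factorization[OF f R] by blast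
  have Za: "cmod a < R" "cmod a \<noteq> r" if "a \<in> ?Z" for a
    using that divisor_in_generic[OF R that] generic_zorder[OF r, of a] by (auto simp: divisor_in_def)
  have cB: "continuous_on (sphere 0 r) (\<lambda>z. ln (cmod (blaschke R a z)))" if "a \<in> ?Z" for a
    using Za[OF that] rR by (intro continuous_on_ln_blaschke) auto
  have cL: "continuous_on (sphere 0 r) (\<lambda>z. Re (L z))"
    using L(1) rR by (intro continuous_intros holomorphic_on_imp_continuous_on holomorphic_on_subset[OF L(2)]) auto
  have "circle_mean r (\<lambda>z. ln (cmod (f z)))
      = circle_mean r (\<lambda>z. Re (L z) + (\<Sum>a\<in>?Z. of_int (zorder f a) * ln (cmod (blaschke R a z))))"
    using r rR pos by (intro circle_mean_cong L(3)) (auto simp: generic_def)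
  also have "\<dots> = circle_mean r (\<lambda>z. Re (L z)) + (\<Sum>a\<in>?Z. of_int (zorder f a) * circle_mean r (\<lambda>z. ln (cmod (blaschke R a z))))"
  proof -
    have "circle_mean r (\<lambda>z. \<Sum>a\<in>?Z. of_int (zorder f a) * ln (cmod (blaschke R a z)))
        = (\<Sum>a\<in>?Z. circle_mean r (\<lambda>z. of_int (zorder f a) * ln (cmod (blaschke R a z))))"
      using fin pos cB by (intro circle_mean_sum continuous_on_mult_left) auto
    thus ?thesis
      using pos cL cB by (subst circle_mean_add) (auto intro!: continuous_on_sum continuous_on_mult_left simp: circle_mean_cmult)
  qed
  also have "circle_mean r (\<lambda>z. Re (L z)) = circle_mean R (\<lambda>z. Re (L z))"
    using circle_mean_Re_holomorphic[OF L(2)] pos rR L(1) by simp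
  also have "\<dots> = circle_mean R (\<lambda>z. ln (cmod (f z)))"
    using pos L(4) by (intro circle_mean_cong) auto
  also have "(\<Sum>a\<in>?Z. of_int (zorder f a) * circle_mean r (\<lambda>z. ln (cmod (blaschke R a z))))
      = (\<Sum>a\<in>?Z. of_int (zorder f a) * (ln (max r (cmod a)) - ln R))"
    using Za pos rR by (intro sum.cong refl) (simp add: circle_mean_ln_blaschke)
  also have "\<dots> = (\<Sum>a\<in>?Z. real (pole_mult f a) * (ln R - ln (max r (cmod a))))
      - (\<Sum>a\<in>?Z. real (pole_mult (\<lambda>z. 1 / f z) a) * (ln R - ln (max r (cmod a))))"
    unfolding sum_subtractf[symmetric]
    by (intro sum.cong refl) (simp only: zorder_eq_pole_mult[OF f], simp add: algebra_simps)
  also have "\<dots> = (nev_N R f - nev_N r f) - (nev_N R (\<lambda>z. 1 / f z) - nev_N r (\<lambda>z. 1 / f z))"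
    using divisor_sum_eq[OF f, of r R] divisor_sum_eq[OF nz_meromorphic_inverse[OF f], of r R] pos rR
    by (simp add: divisor_in_inverse[OF f])
  finally show ?thesis by simp
qed

lemma continuous_on_log_plus_generic:
  "generic f r \<Longrightarrow> continuous_on (sphere 0 r) (\<lambda>z. log_plus (cmod (f z)))"
  by (intro continuous_intros generic_continuous)

lemma circle_mean_ln_eq_nev_m:
  assumes "generic f r"
  shows "circle_mean r (\<lambda>z. ln (cmod (f z))) = nev_m r f - nev_m r (\<lambda>z. 1 / f z)"
    and "circle_mean r (\<lambda>z. \<bar>ln (cmod (f z))\<bar>) = nev_m r f + nev_m r (\<lambda>z. 1 / f z)"
proof -
  note c = continuous_on_log_plus_generic[OF assms] continuous_on_log_plus_generic[OF generic_inverse[OF assms]]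
  have r: "0 \<le> r" using generic_pos[OF assms] by simp
  have "circle_mean r (\<lambda>z. ln (cmod (f z))) = circle_mean r (\<lambda>z. log_plus (cmod (f z)) - log_plus (cmod (1 / f z)))"
    using r generic_nonzero[OF assms] ln_eq_log_plus[of "cmod (f z)" for z]
    by (intro circle_mean_cong) (auto simp: norm_divide)
  thus "circle_mean r (\<lambda>z. ln (cmod (f z))) = nev_m r f - nev_m r (\<lambda>z. 1 / f z)"
    using c r by (simp add: circle_mean_diff nev_m_eq)
  have "circle_mean r (\<lambda>z. \<bar>ln (cmod (f z))\<bar>) = circle_mean r (\<lambda>z. log_plus (cmod (f z)) + log_plus (cmod (1 / f z)))"
    using r generic_nonzero[OF assms] abs_ln_eq_log_plus[of "cmod (f z)" for z]
    by (intro circle_mean_cong) (auto simp: norm_divide)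
  thus "circle_mean r (\<lambda>z. \<bar>ln (cmod (f z))\<bar>) = nev_m r f + nev_m r (\<lambda>z. 1 / f z)"
    using c r by (simp add: circle_mean_add nev_m_eq)
qed

text \<open>The Jensen expression has the same value at all generic radii. The constant is its value
  at one of them, so the relation is an equality and not just an estimate.\<close>

theorem first_main_theorem:
  assumes f: "nz_meromorphic f"
  shows "\<exists>C. \<forall>r. generic f r \<longrightarrow> nev_T r f = nev_T r (\<lambda>z. 1 / f z) + C"
proof -
  define J where "J r = circle_mean r (\<lambda>z. ln (cmod (f z))) - nev_N r (\<lambda>z. 1 / f z) + nev_N r f" for r
  obtain r0 where r0: "generic f r0" using generic_exists[OF f, of 0 1] by auto
  have "nev_T r f = nev_T r (\<lambda>z. 1 / f z) + J r0" if r: "generic f r" for r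
  proof -
    have "J r = J r0"
    proof (cases r r0 rule: linorder_cases)
      case less
      show ?thesis unfolding J_def by (rule Jensen_formula[OF f r r0 less])
    next
      case greater
      show ?thesis unfolding J_def by (rule Jensen_formula[OF f r0 r greater, symmetric])
    qed simp
    thus ?thesis using circle_mean_ln_eq_nev_m(1)[OF r] by (simp add: J_def nev_T_def)
  qed
  thus ?thesis by blast
qed

text \<open>Poisson--Jensen majorises \<open>log\<^sup>+ |f|\<close> on the circle of radius \<open>r\<close> by a Poisson integral and the
  Blaschke factors of the poles; the means of the latter are the increment of \<open>N\<close>.\<close>

lemma nev_T_mono:
  assumes f: "nz_meromorphic f" and r: "generic f r" and R: "generic f R" and rR: "r < R"
  shows "nev_T r f \<le> nev_T R f"
proof -
  let ?Z = "divisor_in f R"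
  have fin: "finite ?Z" using f by (rule finite_divisor_in)
  have pos: "0 < r" "0 < R" using r R by (auto dest: generic_pos)
  obtain R' L where L: "R < R'" "L holomorphic_on ball 0 R'"
    "\<And>z. cmod z \<le> R \<Longrightarrow> good_point f z \<Longrightarrow>
       ln (cmod (f z)) = Re (L z) + (\<Sum>a\<in>?Z. of_int (zorder f a) * ln (cmod (blaschke R a z)))"
    "\<And>z. cmod z = R \<Longrightarrow> Re (L z) = ln (cmod (f z))"
    using blaschke_log_factorization[OF f R] by blast
  have Za: "cmod a < R" "cmod a \<noteq> r" if "a \<in> ?Z" for a
    using that divisor_in_generic[OF R that] generic_zorder[OF r, of a] by (auto simp: divisor_in_def)
  have cB: "continuous_on (sphere 0 r) (\<lambda>z. ln (cmod (blaschke R a z)))" if "a \<in> ?Z" for a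
    using Za[OF that] rR by (intro continuous_on_ln_blaschke) auto
  define V where "V w = log_plus (cmod (f w))" for w
  have cV: "continuous_on (sphere 0 R) V" unfolding V_def[abs_def] by (rule continuous_on_log_plus_generic[OF R])
  define K where "K z = circle_mean R (\<lambda>w. V w * (1 / (cmod (w - z))\<^sup>2))" for z
  have cK: "continuous_on (sphere 0 r) K" and K_mean: "circle_mean r K = circle_mean R V / (R\<^sup>2 - r\<^sup>2)"
    using circle_mean_Poisson_kernel_swap[OF cV, of r] pos rR unfolding K_def[abs_def] by auto
  define S where "S z = (\<Sum>a\<in>?Z. real (pole_mult f a) * - ln (cmod (blaschke R a z)))" for z
  have cS: "continuous_on (sphere 0 r) S"
    unfolding S_def[abs_def] by (intro continuous_on_sum continuous_on_mult_left continuous_on_minus cB)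
  have kern: "continuous_on (sphere 0 R) (\<lambda>w. h w * (1 / (cmod (w - z))\<^sup>2))"
    if "continuous_on (sphere 0 R) h" "cmod z = r" for h z
    using that rR by (intro continuous_on_mult continuous_on_Poisson_kernel) auto
  have r2: "0 < R\<^sup>2 - r\<^sup>2" using power_strict_mono[of r R 2] rR pos by simp
  have le: "log_plus (cmod (f z)) \<le> (R\<^sup>2 - r\<^sup>2) * K z + S z" if z: "cmod z = r" for z
  proof -
    have gp: "good_point f z" using r z by (simp add: generic_def)
    have B1: "ln (cmod (blaschke R a z)) \<le> 0" if "a \<in> ?Z" for a
      using blaschke_norm_le_1[OF Za(1)[OF that], of z] blaschke_eq_0_iff[OF Za(1)[OF that], of z] Za[OF that] z rR
      by (intro ln_le_zero_iff[THEN iffD2]) auto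
    have S0: "0 \<le> S z" unfolding S_def using B1 by (intro sum_nonneg mult_nonneg_nonneg) auto
    have K0: "0 \<le> K z" unfolding K_def using pos z cV by (intro circle_mean_nonneg kern) (auto simp: V_def)
    have cL: "continuous_on (sphere 0 R) (\<lambda>w. Re (L w))"
      using L(1) by (intro continuous_intros holomorphic_on_imp_continuous_on holomorphic_on_subset[OF L(2)]) auto
    have "Re (L z) = circle_mean R (\<lambda>w. (R\<^sup>2 - r\<^sup>2) * (Re (L w) * (1 / (cmod (w - z))\<^sup>2)))"
    proof (rule circle_mean_eqI[symmetric])
      have "L holomorphic_on cball 0 R" using L(1) by (intro holomorphic_on_subset[OF L(2)]) auto
      from Poisson_formula[OF this, of z] show "((\<lambda>\<theta>. (R\<^sup>2 - r\<^sup>2) *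
          (Re (L (of_real R * cis \<theta>)) * (1 / (cmod (of_real R * cis \<theta> - z))\<^sup>2))) has_integral 2 * pi * Re (L z)) {0..2 * pi}"
        using z rR by (simp add: mult_ac)
    qed
    also have "\<dots> = (R\<^sup>2 - r\<^sup>2) * circle_mean R (\<lambda>w. Re (L w) * (1 / (cmod (w - z))\<^sup>2))"
      by (rule circle_mean_cmult)
    also have "\<dots> \<le> (R\<^sup>2 - r\<^sup>2) * K z"
      unfolding K_def
    proof (intro mult_left_mono circle_mean_mono kern cL cV z)
      fix w assume w: "cmod w = R"
      have "Re (L w) \<le> V w" using L(4)[OF w] generic_nonzero[OF R w] by (simp add: V_def log_plus_eq)
      thus "Re (L w) * (1 / (cmod (w - z))\<^sup>2) \<le> V w * (1 / (cmod (w - z))\<^sup>2)" by (intro mult_right_mono) auto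
    qed (use pos r2 rR in auto)
    finally have 1: "Re (L z) \<le> (R\<^sup>2 - r\<^sup>2) * K z" .
    have 2: "(\<Sum>a\<in>?Z. of_int (zorder f a) * ln (cmod (blaschke R a z))) \<le> S z"
      unfolding S_def
    proof (rule sum_mono)
      fix a assume "a \<in> ?Z"
      have "- real (pole_mult f a) \<le> of_int (zorder f a)" using zorder_eq_pole_mult[OF f, of a] by simp
      hence "of_int (zorder f a) * ln (cmod (blaschke R a z)) \<le> - real (pole_mult f a) * ln (cmod (blaschke R a z))"
        using B1[OF \<open>a \<in> ?Z\<close>] by (rule mult_right_mono_neg)
      thus "of_int (zorder f a) * ln (cmod (blaschke R a z)) \<le> real (pole_mult f a) * - ln (cmod (blaschke R a z))"
        by simp
    qed
    have "ln (cmod (f z)) \<le> (R\<^sup>2 - r\<^sup>2) * K z + S z" using L(3)[OF _ gp] z rR 1 2 by simp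
    moreover have "0 \<le> (R\<^sup>2 - r\<^sup>2) * K z + S z" using S0 K0 r2 by simp
    ultimately show ?thesis using generic_nonzero[OF r z] by (simp add: log_plus_eq)
  qed
  have "nev_m r f \<le> circle_mean r (\<lambda>z. (R\<^sup>2 - r\<^sup>2) * K z + S z)"
    unfolding nev_m_eq using pos le
    by (intro circle_mean_mono continuous_on_log_plus_generic[OF r] continuous_on_add continuous_on_mult_left cK cS) auto
  also have "\<dots> = (R\<^sup>2 - r\<^sup>2) * circle_mean r K + circle_mean r S"
    using pos by (subst circle_mean_add) (auto intro!: continuous_on_mult_left cK cS simp: circle_mean_cmult)
  also have "(R\<^sup>2 - r\<^sup>2) * circle_mean r K = nev_m R f"
    using r2 by (simp add: K_mean V_def[abs_def] nev_m_eq)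
  also have "circle_mean r S = (\<Sum>a\<in>?Z. real (pole_mult f a) * (ln R - ln (max r (cmod a))))"
  proof -
    have "circle_mean r S = (\<Sum>a\<in>?Z. circle_mean r (\<lambda>z. real (pole_mult f a) * - ln (cmod (blaschke R a z))))"
      unfolding S_def[abs_def] using fin pos cB
      by (intro circle_mean_sum) (auto intro!: continuous_on_mult_left continuous_on_minus)
    also have "\<dots> = (\<Sum>a\<in>?Z. real (pole_mult f a) * (ln R - ln (max r (cmod a))))"
      using Za pos rR
      by (intro sum.cong refl) (subst circle_mean_cmult, subst circle_mean_minus, subst circle_mean_ln_blaschke, auto)
    finally show ?thesis .
  qed
  also have "\<dots> = nev_N R f - nev_N r f" using pos rR by (intro divisor_sum_eq f) auto
  finally show ?thesis by (simp add: nev_T_def)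
qed

section \<open>Logarithmic derivatives and difference quotients\<close>

lemma nev_T_controls:
  assumes f: "nz_meromorphic f"
  shows "\<exists>D\<ge>0. \<forall>r. generic f r \<longrightarrow> 1 \<le> r \<longrightarrow> 0 \<le> nev_T r f \<and>
     nev_m r f + nev_m r (\<lambda>z. 1 / f z) \<le> 2 * nev_T r f + D \<and>
     nev_N r f + nev_N r (\<lambda>z. 1 / f z) \<le> 2 * nev_T r f + D"
proof -
  obtain C where C: "\<And>r. generic f r \<Longrightarrow> nev_T r f = nev_T r (\<lambda>z. 1 / f z) + C"
    using first_main_theorem[OF f] by blast
  show ?thesis
  proof (intro exI[of _ "\<bar>C\<bar>"] conjI allI impI)
    fix r assume r: "generic f r" "1 \<le> r"
    have "0 \<le> nev_m r f" "0 \<le> nev_m r (\<lambda>z. 1 / f z)"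
      using r by (auto intro!: nev_m_nonneg generic_continuous generic_inverse)
    moreover have "0 \<le> nev_N r f" "0 \<le> nev_N r (\<lambda>z. 1 / f z)"
      using r by (auto intro!: nev_N_nonneg nz_meromorphicD nz_meromorphic_inverse f)
    ultimately show "0 \<le> nev_T r f"
      "nev_m r f + nev_m r (\<lambda>z. 1 / f z) \<le> 2 * nev_T r f + \<bar>C\<bar>"
      "nev_N r f + nev_N r (\<lambda>z. 1 / f z) \<le> 2 * nev_T r f + \<bar>C\<bar>"
      using C[OF r(1)] by (auto simp: nev_T_def)
  qed simp
qed

lemma divisor_count_le:
  assumes f: "nz_meromorphic f" and r: "1 \<le> r" "r \<le> R"
  shows "(\<Sum>a\<in>divisor_in f r. real_of_int \<bar>zorder f a\<bar>) * (ln R - ln r)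
           \<le> nev_N R f + nev_N R (\<lambda>z. 1 / f z)"
proof -
  let ?w = "\<lambda>z. pole_mult f z + pole_mult (\<lambda>z. 1 / f z) z"
  have lf: "locally_finite_weight (pole_mult f)" "locally_finite_weight (pole_mult (\<lambda>z. 1 / f z))"
    by (intro locally_finite_pole_mult nz_meromorphicD nz_meromorphic_inverse f)+
  have w: "real (?w z) = real_of_int \<bar>zorder f z\<bar>" for z
    by (simp add: pole_mult_nz f nz_meromorphic_inverse nz_zorder_inverse)
  have "(\<Sum>a\<in>divisor_in f r. real_of_int \<bar>zorder f a\<bar>) = real (\<Sum>z | ?w z \<noteq> 0 \<and> cmod z \<le> r. ?w z)"
    unfolding of_nat_sum w
    by (intro sum.cong) (auto simp: divisor_in_def pole_mult_nz f nz_meromorphic_inverse nz_zorder_inverse)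
  also have "\<dots> * (ln R - ln r) \<le> weighted_N ?w R"
    by (rule weighted_N_ge_count[OF locally_finite_weight_add[OF lf] r])
  also have "\<dots> = nev_N R f + nev_N R (\<lambda>z. 1 / f z)"
    using r f by (simp add: weighted_N_add[OF lf] nev_N_eq nz_meromorphicD nz_meromorphic_inverse)
  finally show ?thesis .
qed

section \<open>The lemma on the logarithmic derivative\<close>

lemma ln_diff_ge:
  fixes R R2 :: real assumes "0 < R" "R \<le> R2" shows "(R2 - R) / R2 \<le> ln R2 - ln R"
proof -
  have "ln (R / R2) \<le> R / R2 - 1" using assms by (intro ln_le_minus_one) auto
  thus ?thesis using assms by (simp add: ln_div field_simps)
qed

lemma sqrt_add_sum_le:
  assumes "finite A" "0 \<le> c" "\<And>a. a \<in> A \<Longrightarrow> 0 \<le> y a"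
  shows "sqrt (c + (\<Sum>a\<in>A. y a)) \<le> sqrt c + (\<Sum>a\<in>A. sqrt (y a))"
  using assms
proof (induction A)
  case (insert a A)
  have "sqrt (c + sum y (insert a A)) = sqrt (y a + (c + sum y A))" using insert by (simp add: algebra_simps)
  also have "\<dots> \<le> sqrt (y a) + sqrt (c + sum y A)"
    using insert by (intro sqrt_add_le_add_sqrt add_nonneg_nonneg sum_nonneg) auto
  finally show ?case using insert by simp
qed simp

text \<open>The square root tames the singularities 1 / |z - a|: their means are unbounded as a
  approaches the circle, whereas those of the square roots have a bound uniform in a.\<close>

lemma log_plus_le_sqrt: "0 \<le> x \<Longrightarrow> log_plus x \<le> 2 * ln (1 + sqrt x)"
proof (cases "x \<le> 1")
  case False
  assume "0 \<le> x"
  have "log_plus x = 2 * ln (sqrt x)" using False by (simp add: log_plus_def max_def ln_sqrt)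
  also have "\<dots> \<le> 2 * ln (1 + sqrt x)" using False by (intro mult_left_mono ln_mono) auto
  finally show ?thesis .
qed (simp add: log_plus_def)

text \<open>Concavity of the logarithm through the tangent at \<open>M\<close>: ln y <= y / M + ln M
  - 1.\<close>

lemma circle_mean_ln_le:
  assumes cont: "continuous_on (sphere 0 r) Y" and r: "0 \<le> r" and pos: "\<And>z. cmod z = r \<Longrightarrow> 0 < Y z"
    and M: "0 < M" "circle_mean r Y \<le> M"
  shows "circle_mean r (\<lambda>z. ln (Y z)) \<le> ln M"
proof -
  have le: "ln (Y z) \<le> 1 / M * Y z + (ln M - 1)" if z: "cmod z = r" for z
  proof -
    have "ln (Y z / M) \<le> Y z / M - 1" using M pos[OF z] by (intro ln_le_minus_one) auto
    thus ?thesis using M pos[OF z] by (simp add: ln_div)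
  qed
  have "circle_mean r (\<lambda>z. ln (Y z)) \<le> circle_mean r (\<lambda>z. 1 / M * Y z + (ln M - 1))"
    using r by (intro circle_mean_mono le continuous_intros cont) (use pos in force)+
  also have "\<dots> = 1 / M * circle_mean r Y + (ln M - 1)"
    using r cont by (subst circle_mean_add) (auto intro!: continuous_on_mult_left simp del: times_divide_eq_left simp: circle_mean_cmult)
  also have "1 / M * circle_mean r Y \<le> 1 / M * M" using M by (intro mult_left_mono) auto
  finally show ?thesis using M by simp
qed

lemma blaschke_denominator_bound:
  assumes "cmod a < R" "cmod z = r" "r < R"
  shows "cmod (cnj a / (of_real (R\<^sup>2) - cnj a * z)) \<le> 1 / (R - r)"
proof -
  have R: "0 \<le> r" using assms by auto
  have "cmod a * (R - r) \<le> R\<^sup>2 - cmod a * r"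
    using assms R mult_right_mono[of "cmod a" R R] by (simp add: power2_eq_square algebra_simps)
  also have "\<dots> = cmod (of_real (R\<^sup>2) :: complex) - cmod (cnj a * z)"
    using assms by (simp add: norm_mult norm_power)
  also have "\<dots> \<le> cmod (of_real (R\<^sup>2) - cnj a * z)" by (rule norm_triangle_ineq2)
  finally have 1: "cmod a * (R - r) \<le> cmod (of_real (R\<^sup>2) - cnj a * z)" .
  have "of_real (R\<^sup>2) - cnj a * z \<noteq> 0" using denominator_nonzero[OF assms(1), of z] assms by auto
  hence "0 < cmod (of_real (R\<^sup>2) - cnj a * z)" by simp
  thus ?thesis using 1 assms by (simp add: norm_divide divide_simps mult.commute)
qed

lemma generic_logderiv_continuous:
  assumes "generic f r" shows "continuous_on (sphere 0 r) (\<lambda>z. deriv f z / f z)"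
proof -
  have "(\<lambda>z. deriv f z / f z) analytic_on sphere 0 r"
    by (subst analytic_on_analytic_at) (use assms in \<open>auto simp: generic_def good_point_def intro!: analytic_intros analytic_deriv\<close>)
  thus ?thesis by (intro holomorphic_on_imp_continuous_on analytic_imp_holomorphic)
qed

text \<open>The remainder is L' plus the terms from the Blaschke denominators. The Poisson formula
  bounds L' with a kernel at most 1 / (R - |z|)^2, and each denominator term is at most 1 / (R -
  |z|) times its multiplicity.\<close>

lemma logderiv_error_le:
  assumes f: "nz_meromorphic f" and R: "generic f R" and z: "cmod z < R" "good_point f z"
  shows "cmod (deriv f z / f z - (\<Sum>a\<in>divisor_in f R. of_int (zorder f a) / (z - a)))
    \<le> 2 * R / (R - cmod z)\<^sup>2 * circle_mean R (\<lambda>w. \<bar>ln (cmod (f w))\<bar>)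
      + (\<Sum>a\<in>divisor_in f R. real_of_int \<bar>zorder f a\<bar>) / (R - cmod z)"
proof -
  let ?Z = "divisor_in f R" and ?c = "\<lambda>a. cnj a / (of_real (R\<^sup>2) - cnj a * z)"
  have R0: "0 < R" using z(1) norm_ge_zero[of z] by linarith
  obtain R' L where L: "R < R'" "L holomorphic_on ball 0 R'"
    "\<And>z. cmod z = R \<Longrightarrow> Re (L z) = ln (cmod (f z))"
    "\<And>z. cmod z < R \<Longrightarrow> good_point f z \<Longrightarrow>
     deriv L z = deriv f z / f z
       - (\<Sum>a\<in>?Z. of_int (zorder f a) * (1 / (z - a) + cnj a / (of_real (R\<^sup>2) - cnj a * z)))"
    using blaschke_log_factorization[OF f R] by blast
  have holL: "L holomorphic_on cball 0 R" using L(1) by (intro holomorphic_on_subset[OF L(2)]) auto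
  have cln: "continuous_on (sphere 0 R) (\<lambda>w. \<bar>ln (cmod (f w))\<bar>)"
    using generic_continuous[OF R] generic_nonzero[OF R] by (intro continuous_intros) auto
  have "cmod (deriv L z) \<le> 2 * R * circle_mean R (\<lambda>w. \<bar>Re (L w)\<bar> * (1 / (cmod (w - z))\<^sup>2))"
    by (rule Poisson_deriv_bound[OF holL z(1)])
  also have "circle_mean R (\<lambda>w. \<bar>Re (L w)\<bar> * (1 / (cmod (w - z))\<^sup>2)) = circle_mean R (\<lambda>w. \<bar>ln (cmod (f w))\<bar> * (1 / (cmod (w - z))\<^sup>2))"
    using L(3) R0 by (intro circle_mean_cong) auto
  also have "\<dots> \<le> circle_mean R (\<lambda>w. 1 / (R - cmod z)\<^sup>2 * \<bar>ln (cmod (f w))\<bar>)"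
  proof (intro circle_mean_mono continuous_on_mult continuous_on_Poisson_kernel cln z(1) continuous_on_const)
    fix w assume w: "cmod w = R"
    have "(R - cmod z)\<^sup>2 \<le> (cmod (w - z))\<^sup>2"
      using norm_triangle_ineq2[of w z] w z(1) by (intro power_mono) auto
    moreover have "0 < (R - cmod z)\<^sup>2" using z(1) by simp
    ultimately have "1 / (cmod (w - z))\<^sup>2 \<le> 1 / (R - cmod z)\<^sup>2"
      by (intro divide_left_mono mult_pos_pos) (auto intro: less_le_trans)
    from mult_left_mono[OF this, of "\<bar>ln (cmod (f w))\<bar>"]
    show "\<bar>ln (cmod (f w))\<bar> * (1 / (cmod (w - z))\<^sup>2) \<le> 1 / (R - cmod z)\<^sup>2 * \<bar>ln (cmod (f w))\<bar>"
      by (simp only: abs_ge_zero mult.commute)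
  qed (use R0 in auto)
  also have "\<dots> = 1 / (R - cmod z)\<^sup>2 * circle_mean R (\<lambda>w. \<bar>ln (cmod (f w))\<bar>)" by (rule circle_mean_cmult)
  finally have dL: "cmod (deriv L z) \<le> 2 * R / (R - cmod z)\<^sup>2 * circle_mean R (\<lambda>w. \<bar>ln (cmod (f w))\<bar>)"
    using R0 by (simp add: mult_left_mono)
  have "cmod (\<Sum>a\<in>?Z. of_int (zorder f a) * ?c a) \<le> (\<Sum>a\<in>?Z. real_of_int \<bar>zorder f a\<bar> * (1 / (R - cmod z)))"
  proof (rule order_trans[OF norm_sum sum_mono])
    fix a assume "a \<in> ?Z"
    hence "cmod (?c a) \<le> 1 / (R - cmod z)"
      by (intro blaschke_denominator_bound[OF divisor_in_generic[OF R] refl z(1)])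
    hence "real_of_int \<bar>zorder f a\<bar> * cmod (?c a) \<le> real_of_int \<bar>zorder f a\<bar> * (1 / (R - cmod z))"
      by (intro mult_left_mono) auto
    thus "cmod (of_int (zorder f a) * ?c a) \<le> real_of_int \<bar>zorder f a\<bar> * (1 / (R - cmod z))"
      by (simp only: norm_mult norm_of_int of_int_abs)
  qed
  moreover have "deriv f z / f z - (\<Sum>a\<in>?Z. of_int (zorder f a) / (z - a))
      = deriv L z + (\<Sum>a\<in>?Z. of_int (zorder f a) * ?c a)"
    using L(4)[OF z] by (simp add: ring_distribs sum.distrib)
  ultimately show ?thesis
    using order_trans[OF norm_triangle_ineq add_mono[OF dL]] by (simp flip: sum_divide_distrib)
qed

text \<open>Only the logarithm of T survives because ln is applied after averaging: by concavity the
  mean of ln Y is at most the logarithm of a bound for the mean of Y, and that bound is linear in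
  \<open>R2\<close> and in 1 + T(R2).\<close>

lemma log_derivative_estimate:
  assumes f: "nz_meromorphic f"
  shows "\<exists>K\<ge>0. \<forall>r R2. 1 \<le> r \<longrightarrow> r + 1 \<le> R2 \<longrightarrow> generic f r \<longrightarrow> generic f R2 \<longrightarrow>
      nev_m r (\<lambda>z. deriv f z / f z) \<le> K * (1 + ln R2 + log_plus (nev_T R2 f))"
proof -
  obtain D where D: "0 \<le> D" and T0: "\<And>r. generic f r \<Longrightarrow> 1 \<le> r \<Longrightarrow> 0 \<le> nev_T r f"
    and Dm: "\<And>r. generic f r \<Longrightarrow> 1 \<le> r \<Longrightarrow> nev_m r f + nev_m r (\<lambda>z. 1 / f z) \<le> 2 * nev_T r f + D"
    and DN: "\<And>r. generic f r \<Longrightarrow> 1 \<le> r \<Longrightarrow> nev_N r f + nev_N r (\<lambda>z. 1 / f z) \<le> 2 * nev_T r f + D"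
    using nev_T_controls[OF f] by blast
  obtain K where K: "0 \<le> K" "\<And>r b. 0 < r \<Longrightarrow> cmod b \<noteq> r \<Longrightarrow>
       circle_mean r (\<lambda>z. cmod (z - b) powr - (1/2)) \<le> K * r powr - (1/2)"
    using circle_mean_powr_le[of "1/2"] by auto
  \<comment> \<open>As R - r > 1/4, the kernel bound gives 2 / (1/4)^2 = 32 and the sum over the
    divisor gives 4 + K times \<nu>; the bound for \<nu> doubles the latter, and 32 + 2(4 + K) = 40
    + 2K.\<close>
  define C where "C = 2 + (40 + 2 * K) * (2 + D)"
  have C: "2 \<le> C" using K D by (simp add: C_def)
  have "nev_m r (\<lambda>z. deriv f z / f z) \<le> 2 * (ln C + 1) * (1 + ln R2 + log_plus (nev_T R2 f))"
    if r1: "1 \<le> r" and rR2: "r + 1 \<le> R2" and r: "generic f r" and R2: "generic f R2" for r R2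
  proof -
    \<comment> \<open>The factorisation lives on the circle of radius R: far enough from r to bound
      the kernel, far enough from \<open>R2\<close> to bound the number of zeros and poles.\<close>
    obtain R where R: "r + 1/4 < R" "R < r + 1/2" "generic f R"
      using generic_exists[OF f, of "r + 1/4" "r + 1/2"] r1 by auto
    let ?Z = "divisor_in f R"
    have fin: "finite ?Z" using f by (rule finite_divisor_in)
    have Za: "cmod a < R" "cmod a \<noteq> r" if "a \<in> ?Z" for a
      using that divisor_in_generic[OF R(3) that] generic_zorder[OF r, of a] by (auto simp: divisor_in_def)
    define T2 where "T2 = nev_T R2 f"
    have T2: "0 \<le> T2" unfolding T2_def using T0[OF R2] r1 rR2 by simp
    have TR: "nev_T R f \<le> T2" unfolding T2_def using nev_T_mono[OF f R(3) R2] R rR2 by simp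
    define V where "V = circle_mean R (\<lambda>w. \<bar>ln (cmod (f w))\<bar>)"
    have V: "V \<le> 2 * T2 + D"
      unfolding V_def circle_mean_ln_eq_nev_m(2)[OF R(3)] using Dm[OF R(3)] TR R r1 by simp
    have cln: "continuous_on (sphere 0 R) (\<lambda>w. \<bar>ln (cmod (f w))\<bar>)"
      using generic_continuous[OF R(3)] generic_nonzero[OF R(3)] by (intro continuous_intros) auto
    have V0: "0 \<le> V" unfolding V_def using R r1 by (intro circle_mean_nonneg cln) auto
    define \<nu> where "\<nu> = (\<Sum>a\<in>?Z. real_of_int \<bar>zorder f a\<bar>)"
    have \<nu>0: "0 \<le> \<nu>" unfolding \<nu>_def by (intro sum_nonneg) auto
    have \<nu>: "\<nu> \<le> 2 * R2 * (2 * T2 + D)"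
    proof -
      have "1 / (2 * R2) \<le> (R2 - R) / R2" using R rR2 r1 by (simp add: field_simps)
      also have "\<dots> \<le> ln R2 - ln R" using R rR2 r1 by (intro ln_diff_ge) auto
      finally have "\<nu> * (1 / (2 * R2)) \<le> \<nu> * (ln R2 - ln R)" using \<nu>0 by (rule mult_left_mono)
      also have "\<dots> \<le> nev_N R2 f + nev_N R2 (\<lambda>z. 1 / f z)"
        unfolding \<nu>_def using R rR2 r1 by (intro divisor_count_le f) auto
      also have "\<dots> \<le> 2 * T2 + D" unfolding T2_def using DN[OF R2] rR2 r1 by simp
      finally show ?thesis using rR2 r1 by (simp add: field_simps)
    qed
    define A1 where "A1 = 32 * R * V + 4 * \<nu>"
    have A1: "0 \<le> A1" using V0 \<nu>0 R r1 by (simp add: A1_def)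
    \<comment> \<open>A majorant of 1 + sqrt |f'/f|; the 2 is this 1 plus the 1 in sqrt A1 <= 1 +
      A1. Multiplicities are at least 1, so their square roots can be replaced by
      themselves.\<close>
    define Y where "Y z = 2 + A1 + (\<Sum>a\<in>?Z. real_of_int \<bar>zorder f a\<bar> * cmod (z - a) powr - (1/2))" for z
    have Y2: "2 \<le> Y z" for z unfolding Y_def using A1 by (simp add: sum_nonneg)
    have Y0: "Y z \<noteq> 0" for z using Y2[of z] by linarith
    have cpow: "continuous_on (sphere 0 r) (\<lambda>z. cmod (z - a) powr - (1/2))" if "a \<in> ?Z" for a
      using Za[OF that] by (intro continuous_intros) auto
    have cY: "continuous_on (sphere 0 r) Y"
      unfolding Y_def[abs_def] by (intro continuous_on_add continuous_on_const continuous_on_sum continuous_on_mult_left cpow)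
    have le: "log_plus (cmod (deriv f z / f z)) \<le> 2 * ln (Y z)" if z: "cmod z = r" for z
    proof -
      have gp: "good_point f z" using r z by (simp add: generic_def)
      have zR: "cmod z < R" using z R by simp
      have za: "z \<noteq> a" if "a \<in> ?Z" for a using Za[OF that] z by auto
      have Rz: "1/4 < R - cmod z" using R z by simp
      hence "(1/4)\<^sup>2 \<le> (R - cmod z)\<^sup>2" by (intro power_mono) auto
      hence "2 * R / (R - cmod z)\<^sup>2 \<le> 2 * R / (1/4)\<^sup>2"
        using R r1 Rz by (intro divide_left_mono mult_pos_pos) auto
      hence "2 * R / (R - cmod z)\<^sup>2 \<le> 32 * R" by (simp add: power_one_over)
      from mult_right_mono[OF this V0] have kV: "2 * R / (R - cmod z)\<^sup>2 * V \<le> 32 * R * V" .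
      have "\<nu> / (R - cmod z) \<le> \<nu> / (1/4)"
        using \<nu>0 Rz by (intro divide_left_mono mult_pos_pos) auto
      with kV have "cmod (deriv f z / f z - (\<Sum>a\<in>?Z. of_int (zorder f a) / (z - a))) \<le> A1"
        using logderiv_error_le[OF f R(3) zR gp] unfolding A1_def V_def \<nu>_def by simp
      moreover have "cmod (\<Sum>a\<in>?Z. of_int (zorder f a) / (z - a)) \<le> (\<Sum>a\<in>?Z. real_of_int \<bar>zorder f a\<bar> * (1 / cmod (z - a)))"
        by (rule order_trans[OF norm_sum]) (simp add: norm_divide)
      ultimately have "cmod (deriv f z / f z) \<le> A1 + (\<Sum>a\<in>?Z. real_of_int \<bar>zorder f a\<bar> * (1 / cmod (z - a)))"
        using norm_triangle_sub[of "deriv f z / f z" "\<Sum>a\<in>?Z. of_int (zorder f a) / (z - a)"] by linarith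
      hence "sqrt (cmod (deriv f z / f z)) \<le> sqrt (A1 + (\<Sum>a\<in>?Z. real_of_int \<bar>zorder f a\<bar> * (1 / cmod (z - a))))"
        by (rule real_sqrt_le_mono)
      also have "\<dots> \<le> sqrt A1 + (\<Sum>a\<in>?Z. sqrt (real_of_int \<bar>zorder f a\<bar> * (1 / cmod (z - a))))"
        using fin A1 by (intro sqrt_add_sum_le) auto
      also have "sqrt A1 \<le> 1 + A1"
      proof (rule real_le_lsqrt)
        show "A1 \<le> (1 + A1)\<^sup>2" using A1 by (simp add: power2_eq_square algebra_simps)
      qed (use A1 in auto)
      also have "(\<Sum>a\<in>?Z. sqrt (real_of_int \<bar>zorder f a\<bar> * (1 / cmod (z - a))))
           \<le> (\<Sum>a\<in>?Z. real_of_int \<bar>zorder f a\<bar> * cmod (z - a) powr - (1/2))"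
      proof (rule sum_mono)
        fix a assume a: "a \<in> ?Z"
        have "sqrt (real_of_int \<bar>zorder f a\<bar> * (1 / cmod (z - a))) = sqrt (real_of_int \<bar>zorder f a\<bar>) * cmod (z - a) powr - (1/2)"
          using za[OF a] by (simp add: real_sqrt_mult real_sqrt_divide powr_minus powr_half_sqrt field_simps)
        moreover have "1 \<le> \<bar>zorder f a\<bar>" using a by (auto simp: divisor_in_def)
        hence one: "1 \<le> real_of_int \<bar>zorder f a\<bar>" by linarith
        have "sqrt x \<le> x" if "1 \<le> x" for x :: real
          using that by (intro real_le_lsqrt) (auto simp: power2_eq_square)
        from this[OF one] have "sqrt (real_of_int \<bar>zorder f a\<bar>) \<le> real_of_int \<bar>zorder f a\<bar>" .
        ultimately show "sqrt (real_of_int \<bar>zorder f a\<bar> * (1 / cmod (z - a))) \<le> real_of_int \<bar>zorder f a\<bar> * cmod (z - a) powr - (1/2)"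
          by (simp only: mult_right_mono powr_ge_zero)
      qed
      finally have "1 + sqrt (cmod (deriv f z / f z)) \<le> Y z" unfolding Y_def by linarith
      hence "ln (1 + sqrt (cmod (deriv f z / f z))) \<le> ln (Y z)" by (intro ln_mono) (auto intro: add_pos_nonneg)
      thus ?thesis using log_plus_le_sqrt[of "cmod (deriv f z / f z)"] by simp
    qed
    define M where "M = 2 + A1 + \<nu> * K"
    have Ymean: "circle_mean r Y \<le> M"
    proof -
      have "circle_mean r Y = circle_mean r (\<lambda>z. 2 + A1) + circle_mean r (\<lambda>z. \<Sum>a\<in>?Z. real_of_int \<bar>zorder f a\<bar> * cmod (z - a) powr - (1/2))"
        unfolding Y_def[abs_def] using r1 by (intro circle_mean_add continuous_on_const continuous_on_sum continuous_on_mult_left cpow) auto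
      also have "circle_mean r (\<lambda>z. \<Sum>a\<in>?Z. real_of_int \<bar>zorder f a\<bar> * cmod (z - a) powr - (1/2))
          = (\<Sum>a\<in>?Z. circle_mean r (\<lambda>z. real_of_int \<bar>zorder f a\<bar> * cmod (z - a) powr - (1/2)))"
        using r1 fin by (intro circle_mean_sum continuous_on_mult_left cpow) auto
      also have "\<dots> \<le> (\<Sum>a\<in>?Z. real_of_int \<bar>zorder f a\<bar> * K)"
      proof (rule sum_mono)
        fix a assume a: "a \<in> ?Z"
        have "circle_mean r (\<lambda>z. cmod (z - a) powr - (1/2)) \<le> K * r powr - (1/2)"
          using K(2)[of r a] Za[OF a] r1 by simp
        also have "\<dots> \<le> K * 1"
          using K r1 powr_mono[of "- (1/2)" 0 r] by (intro mult_left_mono) auto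
        finally show "circle_mean r (\<lambda>z. real_of_int \<bar>zorder f a\<bar> * cmod (z - a) powr - (1/2)) \<le> real_of_int \<bar>zorder f a\<bar> * K"
          unfolding circle_mean_cmult by (intro mult_left_mono) auto
      qed
      finally show ?thesis by (simp add: M_def \<nu>_def sum_distrib_right)
    qed
    have M_le: "M \<le> C * (R2 * (1 + T2))"
    proof -
      have b: "2 * T2 + D \<le> (2 + D) * (1 + T2)" using T2 D by (simp add: algebra_simps)
      have RV: "R * V \<le> R2 * ((2 + D) * (1 + T2))"
        using V0 V b R rR2 r1 T2 D by (intro mult_mono) auto
      have \<nu>': "\<nu> \<le> 2 * (R2 * ((2 + D) * (1 + T2)))"
        using order_trans[OF \<nu> mult_left_mono[OF b, of "2 * R2"]] rR2 r1 by (simp only: mult.assoc)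
      have "2 \<le> 2 * (R2 * (1 + T2))" using mult_mono[of 1 R2 1 "1 + T2"] rR2 r1 T2 by simp
      moreover have "(4 + K) * \<nu> \<le> (4 + K) * (2 * (R2 * ((2 + D) * (1 + T2))))"
        using \<nu>' K by (intro mult_left_mono) auto
      ultimately have "M \<le> 2 * (R2 * (1 + T2)) + 32 * (R2 * ((2 + D) * (1 + T2))) + (4 + K) * (2 * (R2 * ((2 + D) * (1 + T2))))"
        using RV unfolding M_def A1_def by (simp add: algebra_simps)
      also have "\<dots> = C * (R2 * (1 + T2))" by (simp add: C_def algebra_simps)
      finally show ?thesis .
    qed
    have M2: "2 \<le> M" using A1 \<nu>0 K by (simp add: M_def)
    have "nev_m r (\<lambda>z. deriv f z / f z) \<le> circle_mean r (\<lambda>z. 2 * ln (Y z))"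
      unfolding nev_m_eq using r1 le Y0
      by (intro circle_mean_mono continuous_on_log_plus continuous_on_norm generic_logderiv_continuous[OF r]
           continuous_on_mult_left continuous_on_ln cY) auto
    also have "\<dots> = 2 * circle_mean r (\<lambda>z. ln (Y z))" by (rule circle_mean_cmult)
    also have "circle_mean r (\<lambda>z. ln (Y z)) \<le> ln M"
      using r1 M2 Ymean Y2 by (intro circle_mean_ln_le cY) (auto intro: less_le_trans[of 0 2])
    also have "ln M \<le> ln (C * (R2 * (1 + T2)))" using M2 M_le by (intro ln_mono) auto
    also have "\<dots> = ln C + ln R2 + ln (1 + T2)" using C rR2 r1 T2 by (simp add: ln_mult)
    also have "ln (1 + T2) \<le> log_plus T2 + 1"
    proof -
      have "ln (1 + T2) = log_plus (1 + T2)" using T2 by (simp add: log_plus_def max_def)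
      also have "\<dots> \<le> log_plus 1 + log_plus T2 + ln 2" using T2 by (intro log_plus_add_le) auto
      also have "ln 2 \<le> (1::real)" using ln_le_minus_one[of 2] by simp
      finally show ?thesis by (simp add: log_plus_def)
    qed
    also have "ln C + ln R2 + (log_plus T2 + 1) \<le> (ln C + 1) * (1 + ln R2 + log_plus T2)"
    proof -
      have "0 \<le> ln C * (ln R2 + log_plus T2)" using C rR2 r1 by (intro mult_nonneg_nonneg add_nonneg_nonneg) auto
      thus ?thesis by (simp add: algebra_simps)
    qed
    finally show ?thesis by (simp only: T2_def mult.assoc)
  qed
  moreover have "0 \<le> 2 * (ln C + 1)" using C by simp
  ultimately show ?thesis by blast
qed

section \<open>The lemma on the difference quotient\<close>

lemma good_point_shift: "good_point (\<lambda>z. f (z + c)) z \<longleftrightarrow> good_point f (z + c)"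
  by (simp add: good_point_def shift_analytic_iff)

text \<open>The factorisation at a radius R with R - r of order r^\<delta> splits ln |f(z + c) /
  f(z)|. The increment of L is at most |c| times a bound for |L'| along the segment, which is again
  a Poisson integral and can be averaged exactly; the increment of each Blaschke factor is reduced
  to shifts of linear factors.\<close>

lemma difference_estimate:
  assumes f: "nz_meromorphic f" and \<delta>: "0 < \<delta>" "\<delta> < 1"
  shows "\<exists>K\<ge>0. \<exists>r0\<ge>1. \<forall>r R2. r0 \<le> r \<longrightarrow> r + r powr \<delta> / 2 \<le> R2 \<longrightarrow> R2 \<le> r + r powr \<delta> \<longrightarrow>
      generic f r \<longrightarrow> generic (\<lambda>z. f (z + c)) r \<longrightarrow> generic f R2 \<longrightarrow>
      circle_mean r (\<lambda>z. \<bar>ln (cmod (f (z + c))) - ln (cmod (f z))\<bar>) \<le> K * (nev_T R2 f + 1) * r powr - (\<delta> / 2)"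
proof -
  obtain D where D: "0 \<le> D" and T0: "\<And>r. generic f r \<Longrightarrow> 1 \<le> r \<Longrightarrow> 0 \<le> nev_T r f"
    and Dm: "\<And>r. generic f r \<Longrightarrow> 1 \<le> r \<Longrightarrow> nev_m r f + nev_m r (\<lambda>z. 1 / f z) \<le> 2 * nev_T r f + D"
    and DN: "\<And>r. generic f r \<Longrightarrow> 1 \<le> r \<Longrightarrow> nev_N r f + nev_N r (\<lambda>z. 1 / f z) \<le> 2 * nev_T r f + D"
    using nev_T_controls[OF f] by blast
  \<comment> \<open>There are O(T r^(1 - \<delta>)) zeros and poles, each contributing
    O(r^-\<alpha>); this choice makes the total exponent 1 - \<delta> - \<alpha> = -
    \<delta>/2.\<close>
  define \<alpha> where "\<alpha> = 1 - \<delta> / 2"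
  have \<alpha>: "0 < \<alpha>" "\<alpha> < 1" using \<delta> by (auto simp: \<alpha>_def)
  define m where "m b z = \<bar>ln (cmod (z + c - b)) - ln (cmod (z - b))\<bar>" for b z
  obtain K where K: "0 \<le> K" "\<And>r b. 0 < r \<Longrightarrow> cmod b \<noteq> r \<Longrightarrow> cmod (b - c) \<noteq> r \<Longrightarrow> circle_mean r (m b) \<le> K * r powr - \<alpha>"
    using circle_mean_ln_norm_shift_le[OF \<alpha>, of c] unfolding m_def[abs_def] by blast
  \<comment> \<open>With R - r > r^\<delta> / 8 this yields R - r > 2 |c|. The segment from z to z +
    c then stays in the disc, and distances from its points to the outer circle are at least half of
    those from z, so the squared kernels differ by a factor of at most 4.\<close>
  have "eventually (\<lambda>r. 16 * cmod c + 16 \<le> r powr \<delta>) at_top"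
    using \<delta> by real_asymp
  then obtain r0 where r0: "1 \<le> r0" "\<And>r. r0 \<le> r \<Longrightarrow> 16 * cmod c + 16 \<le> r powr \<delta>"
    by (metis (mono_tags, lifting) eventually_at_top_linorder max.bounded_iff order_refl)
  define C where "C = (64 * cmod c + 16 * K) * (2 + D)"
  have C: "0 \<le> C" using K D by (simp add: C_def)
  have "circle_mean r (\<lambda>z. \<bar>ln (cmod (f (z + c))) - ln (cmod (f z))\<bar>) \<le> C * (nev_T R2 f + 1) * r powr - (\<delta> / 2)"
    if rr0: "r0 \<le> r" and R2_ge: "r + r powr \<delta> / 2 \<le> R2" and R2_le: "R2 \<le> r + r powr \<delta>"
    and r: "generic f r" and rc: "generic (\<lambda>z. f (z + c)) r" and R2: "generic f R2" for r R2
  proof -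
    have r1: "1 \<le> r" using r0 rr0 by simp
    have rd: "16 * cmod c + 16 \<le> r powr \<delta>" using r0 rr0 by simp
    obtain R where R: "r + r powr \<delta> / 8 < R" "R < r + r powr \<delta> / 4" "generic f R"
      using generic_exists[OF f, of "r + r powr \<delta> / 8" "r + r powr \<delta> / 4"] r1 by (auto simp: powr_gt_zero)
    have rR: "r < R" and RR2: "R < R2" and R1: "1 \<le> R" and hc: "2 * cmod c < R - r"
      using R R2_ge rd norm_ge_zero[of c] r1 by linarith+
    let ?Z = "divisor_in f R"
    have fin: "finite ?Z" using f by (rule finite_divisor_in)
    have Za: "cmod a < R" "cmod a \<noteq> r" "cmod (a - c) \<noteq> r" if "a \<in> ?Z" for a
    proof -
      show "cmod a < R" by (rule divisor_in_generic[OF R(3) that])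
      show "cmod a \<noteq> r" using generic_zorder[OF r, of a] that by (auto simp: divisor_in_def)
      have "zorder (\<lambda>z. f (z + c)) (a - c) = zorder f a" by (simp add: zorder_shift_arg)
      thus "cmod (a - c) \<noteq> r" using generic_zorder[OF rc, of "a - c"] that by (auto simp: divisor_in_def)
    qed
    obtain R' L where L: "R < R'" "L holomorphic_on ball 0 R'"
      "\<And>z. cmod z \<le> R \<Longrightarrow> good_point f z \<Longrightarrow>
         ln (cmod (f z)) = Re (L z) + (\<Sum>a\<in>?Z. of_int (zorder f a) * ln (cmod (blaschke R a z)))"
      "\<And>z. cmod z = R \<Longrightarrow> Re (L z) = ln (cmod (f z))"
      using blaschke_log_factorization[OF f R(3)] by blast
    have holL: "L holomorphic_on cball 0 R" using L(1) by (intro holomorphic_on_subset[OF L(2)]) auto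
    define T2 where "T2 = nev_T R2 f"
    have T2: "0 \<le> T2" unfolding T2_def using T0[OF R2] RR2 R1 by simp
    have TR: "nev_T R f \<le> T2" unfolding T2_def by (rule nev_T_mono[OF f R(3) R2 RR2])
    define V where "V w = \<bar>ln (cmod (f w))\<bar>" for w
    have cV: "continuous_on (sphere 0 R) V"
      using generic_continuous[OF R(3)] generic_nonzero[OF R(3)] unfolding V_def[abs_def] by (intro continuous_intros) auto
    have V: "circle_mean R V \<le> 2 * T2 + D"
      unfolding V_def[abs_def] circle_mean_ln_eq_nev_m(2)[OF R(3)] using Dm[OF R(3) R1] TR by simp
    have V0: "0 \<le> circle_mean R V" using R1 by (intro circle_mean_nonneg cV) (auto simp: V_def)
    define P where "P z = circle_mean R (\<lambda>w. V w * (1 / (cmod (w - z))\<^sup>2))" for z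
    have cP: "continuous_on (sphere 0 r) P" and P_mean: "circle_mean r P = circle_mean R V / (R\<^sup>2 - r\<^sup>2)"
      using circle_mean_Poisson_kernel_swap[OF cV, of r] r1 rR unfolding P_def[abs_def] by auto
    define \<nu> where "\<nu> = (\<Sum>a\<in>?Z. real_of_int \<bar>zorder f a\<bar>)"
    have \<nu>0: "0 \<le> \<nu>" unfolding \<nu>_def by (intro sum_nonneg) auto
    \<comment> \<open>Besides its zero a, a Blaschke factor with a nonzero has a pole at the
      reflected point R^2 / cnj a; the shift acts on both linear factors.\<close>
    define mm where "mm a z = m a z + (if a = 0 then 0 else m (of_real (R\<^sup>2) / cnj a) z)" for a z
    have b_norm: "R < cmod (of_real (R\<^sup>2) / cnj a)" if a: "a \<in> ?Z" "a \<noteq> 0" for a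
    proof -
      have "cmod (of_real (R\<^sup>2) / cnj a) = R * R / cmod a"
        by (simp add: norm_divide norm_mult power2_eq_square)
      moreover have "R * cmod a < R * R" using Za(1)[OF a(1)] R1 by (intro mult_strict_left_mono) auto
      hence "R < R * R / cmod a" using a by (simp add: less_divide_eq)
      ultimately show ?thesis by (simp only:)
    qed
    have b_ok: "cmod (of_real (R\<^sup>2) / cnj a) \<noteq> r" "cmod (of_real (R\<^sup>2) / cnj a - c) \<noteq> r" if a: "a \<in> ?Z" "a \<noteq> 0" for a
    proof -
      let ?b = "of_real (R\<^sup>2) / cnj a"
      show "cmod ?b \<noteq> r" using b_norm[OF a] rR by linarith
      have "cmod ?b \<le> cmod (?b - c) + cmod c" using norm_triangle_sub[of ?b c] by linarith
      thus "cmod (?b - c) \<noteq> r" using b_norm[OF a] hc norm_ge_zero[of c] by linarith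
    qed
    have cm: "continuous_on (sphere 0 r) (m b)" if "cmod b \<noteq> r" "cmod (b - c) \<noteq> r" for b
      unfolding m_def[abs_def] using that by (intro continuous_intros) (auto simp: algebra_simps)
    have cmm: "continuous_on (sphere 0 r) (mm a)" if "a \<in> ?Z" for a
      using cm[OF Za(2,3)[OF that]] cm[OF b_ok[OF that]] unfolding mm_def[abs_def]
      by (cases "a = 0") (auto intro!: continuous_on_add)
    have mm_mean: "circle_mean r (mm a) \<le> 2 * K * r powr - \<alpha>" if a: "a \<in> ?Z" for a
    proof (cases "a = 0")
      case True
      have "circle_mean r (m a) \<le> K * r powr - \<alpha>" using K(2)[OF _ Za(2,3)[OF a]] r1 by simp
      also have "\<dots> \<le> 2 * K * r powr - \<alpha>" using K by simp
      finally show ?thesis using True by (simp add: mm_def[abs_def])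
    next
      case False
      have "circle_mean r (mm a) = circle_mean r (m a) + circle_mean r (m (of_real (R\<^sup>2) / cnj a))"
        unfolding mm_def[abs_def] using False circle_mean_add[OF cm[OF Za(2,3)[OF a]] cm[OF b_ok[OF a False]]] r1 by simp
      also have "\<dots> \<le> K * r powr - \<alpha> + K * r powr - \<alpha>"
        using K(2)[OF _ Za(2,3)[OF a]] K(2)[OF _ b_ok[OF a False]] r1 by (intro add_mono) auto
      finally show ?thesis by simp
    qed
    have le: "\<bar>ln (cmod (f (z + c))) - ln (cmod (f z))\<bar>
        \<le> cmod c * (8 * R) * P z + (\<Sum>a\<in>?Z. real_of_int \<bar>zorder f a\<bar> * mm a z)" if z: "cmod z = r" for z
    proof -
      have gp: "good_point f z" using r z by (simp add: generic_def)
      have gpc: "good_point f (z + c)" using rc z good_point_shift[of f c z] by (simp add: generic_def)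
      have zR: "cmod z < R" using z rR by simp
      have zcR: "cmod (z + c) < R" using norm_triangle_ineq[of z c] z hc norm_ge_zero[of c] by linarith
      have seg: "cmod (t - z) \<le> cmod c" "cmod t < R" if "t \<in> closed_segment z (z + c)" for t
      proof -
        show 1: "cmod (t - z) \<le> cmod c"
          using segment_bound(1)[OF that] by (simp add: norm_minus_commute)
        show "cmod t < R" using norm_triangle_sub[of t z] 1 z hc norm_ge_zero[of c] by linarith
      qed
      have "cmod (L (z + c) - L z) \<le> (8 * R * P z) * cmod (z + c - z)"
      proof (rule field_differentiable_bound[of "closed_segment z (z + c)" L "deriv L"])
        fix t assume t: "t \<in> closed_segment z (z + c)"
        have "t \<in> ball 0 R'" using seg(2)[OF t] L(1) by simp
        thus "(L has_field_derivative deriv L t) (at t within closed_segment z (z + c))"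
          using holomorphic_derivI[OF L(2)] by (simp add: has_field_derivative_at_within)
        have "cmod (deriv L t) \<le> 2 * R * circle_mean R (\<lambda>w. \<bar>Re (L w)\<bar> * (1 / (cmod (w - t))\<^sup>2))"
          by (rule Poisson_deriv_bound[OF holL seg(2)[OF t]])
        also have "circle_mean R (\<lambda>w. \<bar>Re (L w)\<bar> * (1 / (cmod (w - t))\<^sup>2)) = circle_mean R (\<lambda>w. V w * (1 / (cmod (w - t))\<^sup>2))"
          using L(4) R1 by (intro circle_mean_cong) (auto simp: V_def)
        also have "\<dots> \<le> circle_mean R (\<lambda>w. 4 * (V w * (1 / (cmod (w - z))\<^sup>2)))"
        proof (intro circle_mean_mono continuous_on_mult_left continuous_on_mult continuous_on_Poisson_kernel cV zR seg(2)[OF t])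
          fix w assume w: "cmod w = R"
          have wz: "R - r \<le> cmod (w - z)" using norm_triangle_ineq2[of w z] w z by simp
          have "cmod (w - z) \<le> cmod (w - t) + cmod (t - z)"
            using norm_triangle_ineq[of "w - t" "t - z"] by simp
          hence "cmod (w - z) / 2 \<le> cmod (w - t)" using wz seg(1)[OF t] hc by linarith
          hence "(cmod (w - z) / 2)\<^sup>2 \<le> (cmod (w - t))\<^sup>2" by (intro power_mono) auto
          moreover have "0 < cmod (w - z)" using wz rR by linarith
          ultimately have "1 / (cmod (w - t))\<^sup>2 \<le> 1 / (cmod (w - z) / 2)\<^sup>2"
            by (intro divide_left_mono mult_pos_pos) (auto intro: less_le_trans[rotated])
          also have "\<dots> = 4 * (1 / (cmod (w - z))\<^sup>2)" by (simp add: power_divide)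
          finally have "V w * (1 / (cmod (w - t))\<^sup>2) \<le> V w * (4 * (1 / (cmod (w - z))\<^sup>2))"
            by (intro mult_left_mono) (auto simp: V_def)
          thus "V w * (1 / (cmod (w - t))\<^sup>2) \<le> 4 * (V w * (1 / (cmod (w - z))\<^sup>2))"
            by (simp only: mult.left_commute[of 4])
        qed (use R1 in auto)
        also have "\<dots> = 4 * P z" unfolding P_def by (rule circle_mean_cmult)
        finally show "cmod (deriv L t) \<le> 8 * R * P z" using R1 by (simp add: mult_left_mono)
      qed auto
      hence Lb: "\<bar>Re (L (z + c)) - Re (L z)\<bar> \<le> cmod c * (8 * R) * P z"
        using abs_Re_le_cmod[of "L (z + c) - L z"] by (simp add: mult_ac)
      have Bb: "\<bar>ln (cmod (blaschke R a (z + c))) - ln (cmod (blaschke R a z))\<bar> \<le> mm a z" if a: "a \<in> ?Z" for a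
      proof -
        have d: "of_real (R\<^sup>2) - cnj a * z \<noteq> 0" "of_real (R\<^sup>2) - cnj a * (z + c) \<noteq> 0"
          using denominator_nonzero[OF Za(1)[OF a]] zR zcR by auto
        have za: "z - a \<noteq> 0" "z + c - a \<noteq> 0" using Za(2,3)[OF a] z by (auto simp: algebra_simps)
        have lnB: "ln (cmod (blaschke R a t)) = ln R + ln (cmod (t - a)) - ln (cmod (of_real (R\<^sup>2) - cnj a * t))"
          if "of_real (R\<^sup>2) - cnj a * t \<noteq> 0" "t - a \<noteq> 0" for t
        proof -
          have "0 < cmod (of_real (R\<^sup>2) - cnj a * t)" "0 < cmod (t - a)" using that by simp_all
          thus ?thesis using R1 by (simp add: blaschke_def norm_mult norm_divide ln_mult ln_div del: of_real_power)
        qed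
        have den: "ln (cmod (of_real (R\<^sup>2) - cnj a * t)) = ln (cmod a) + ln (cmod (t - of_real (R\<^sup>2) / cnj a))"
          if "of_real (R\<^sup>2) - cnj a * t \<noteq> 0" "a \<noteq> 0" for t
        proof -
          have "of_real (R\<^sup>2) - cnj a * t = - cnj a * (t - of_real (R\<^sup>2) / cnj a)"
            using that by (simp add: field_simps)
          hence "cmod (of_real (R\<^sup>2) - cnj a * t) = cmod a * cmod (t - of_real (R\<^sup>2) / cnj a)"
            by (simp only: norm_mult norm_minus_cancel complex_mod_cnj)
          moreover from this have "cmod (t - of_real (R\<^sup>2) / cnj a) \<noteq> 0" using that by auto
          ultimately show ?thesis using that by (simp add: ln_mult)
        qed
        show ?thesis
        proof (cases "a = 0")
          case True
          thus ?thesis using lnB[OF d(1) za(1)] lnB[OF d(2) za(2)] by (simp add: mm_def m_def)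
        next
          case False
          show ?thesis unfolding lnB[OF d(1) za(1)] lnB[OF d(2) za(2)] den[OF d(1) False] den[OF d(2) False]
            using False by (simp add: mm_def m_def)
        qed
      qed
      have "ln (cmod (f (z + c))) - ln (cmod (f z)) = (Re (L (z + c)) - Re (L z))
         + (\<Sum>a\<in>?Z. of_int (zorder f a) * (ln (cmod (blaschke R a (z + c))) - ln (cmod (blaschke R a z))))"
        using L(3)[OF _ gp] L(3)[OF _ gpc] zR zcR by (simp add: right_diff_distrib sum_subtractf)
      also have "\<bar>\<dots>\<bar> \<le> \<bar>Re (L (z + c)) - Re (L z)\<bar>
         + (\<Sum>a\<in>?Z. \<bar>of_int (zorder f a) * (ln (cmod (blaschke R a (z + c))) - ln (cmod (blaschke R a z)))\<bar>)"
        by (rule order_trans[OF abs_triangle_ineq add_left_mono[OF sum_abs]])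
      also have "\<dots> \<le> cmod c * (8 * R) * P z + (\<Sum>a\<in>?Z. real_of_int \<bar>zorder f a\<bar> * mm a z)"
        using Lb Bb by (intro add_mono sum_mono) (auto simp: abs_mult intro!: mult_left_mono)
      finally show ?thesis .
    qed
    have cont: "continuous_on (sphere 0 r) (\<lambda>z. \<bar>ln (cmod (f (z + c))) - ln (cmod (f z))\<bar>)"
      using generic_continuous[OF r] generic_continuous[OF rc] generic_nonzero[OF r] generic_nonzero[OF rc]
      by (intro continuous_intros) auto
    have "circle_mean r (\<lambda>z. \<bar>ln (cmod (f (z + c))) - ln (cmod (f z))\<bar>)
        \<le> circle_mean r (\<lambda>z. cmod c * (8 * R) * P z + (\<Sum>a\<in>?Z. real_of_int \<bar>zorder f a\<bar> * mm a z))"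
      using r1 le by (intro circle_mean_mono cont continuous_on_add continuous_on_mult_left continuous_on_sum cP cmm) auto
    also have "\<dots> = cmod c * (8 * R) * circle_mean r P + circle_mean r (\<lambda>z. \<Sum>a\<in>?Z. real_of_int \<bar>zorder f a\<bar> * mm a z)"
      using r1 by (subst circle_mean_add) (auto intro!: continuous_on_mult_left continuous_on_sum cP cmm simp: circle_mean_cmult)
    also have "circle_mean r (\<lambda>z. \<Sum>a\<in>?Z. real_of_int \<bar>zorder f a\<bar> * mm a z)
        = (\<Sum>a\<in>?Z. circle_mean r (\<lambda>z. real_of_int \<bar>zorder f a\<bar> * mm a z))"
      using r1 fin by (intro circle_mean_sum continuous_on_mult_left cmm) auto
    also have "\<dots> \<le> (\<Sum>a\<in>?Z. real_of_int \<bar>zorder f a\<bar> * (2 * K * r powr - \<alpha>))"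
      unfolding circle_mean_cmult using mm_mean by (intro sum_mono mult_left_mono) auto
    also have "\<dots> = \<nu> * (2 * K * r powr - \<alpha>)" by (simp add: \<nu>_def sum_distrib_right)
    also have "cmod c * (8 * R) * circle_mean r P \<le> 64 * cmod c * (2 * T2 + D) * r powr - (\<delta> / 2)"
    proof -
      \<comment> \<open>This is where averaging pays: a pointwise bound on the kernel would leave R
        / (R - r)^2, whereas here 1 / (R - r) is left, which tends to 0.\<close>
      have "R / (R\<^sup>2 - r\<^sup>2) \<le> 1 / (R - r)"
      proof -
        have "R\<^sup>2 - r\<^sup>2 = (R - r) * (R + r)" by (simp add: power2_eq_square algebra_simps)
        moreover have "R * (R - r) \<le> 1 * ((R - r) * (R + r))" using rR r1 by (simp add: algebra_simps)
        ultimately show ?thesis using rR r1 by (simp add: divide_simps)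
      qed
      also have "\<dots> \<le> 1 / (r powr \<delta> / 8)" using R rR r1 by (intro divide_left_mono mult_pos_pos) auto
      also have "\<dots> = 8 * r powr - \<delta>" by (simp add: powr_minus divide_simps)
      also have "\<dots> \<le> 8 * r powr - (\<delta> / 2)" using r1 \<delta> by (intro mult_left_mono powr_mono) auto
      finally have q: "R / (R\<^sup>2 - r\<^sup>2) \<le> 8 * r powr - (\<delta> / 2)" .
      have "cmod c * (8 * R) * circle_mean r P = 8 * cmod c * (R / (R\<^sup>2 - r\<^sup>2)) * circle_mean R V"
        by (simp add: P_mean mult_ac)
      also have "\<dots> \<le> 8 * cmod c * (8 * r powr - (\<delta> / 2)) * (2 * T2 + D)"
        using q V V0 by (intro mult_mono mult_left_mono) auto
      also have "\<dots> = 64 * cmod c * (2 * T2 + D) * r powr - (\<delta> / 2)" by simp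
      finally show ?thesis .
    qed
    also have "\<nu> * (2 * K * r powr - \<alpha>) \<le> 16 * K * (2 * T2 + D) * r powr - (\<delta> / 2)"
    proof -
      have "r powr \<delta> \<le> r" using r1 \<delta> powr_mono[of \<delta> 1 r] by simp
      hence R2r: "R2 \<le> 2 * r" using R2_le by simp
      have "r powr \<delta> / (8 * r) = (r powr \<delta> / 4) / (2 * r)" by simp
      also have "\<dots> \<le> (R2 - R) / R2" using R R2_ge R2r RR2 R1 r1 by (intro frac_le) auto
      also have "\<dots> \<le> ln R2 - ln R" using RR2 R1 by (intro ln_diff_ge) auto
      finally have "\<nu> * (r powr \<delta> / (8 * r)) \<le> \<nu> * (ln R2 - ln R)" using \<nu>0 by (rule mult_left_mono)
      also have "\<dots> \<le> nev_N R2 f + nev_N R2 (\<lambda>z. 1 / f z)"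
        unfolding \<nu>_def using RR2 R1 by (intro divisor_count_le f) auto
      also have "\<dots> \<le> 2 * T2 + D" unfolding T2_def using DN[OF R2] RR2 R1 by simp
      finally have "\<nu> \<le> (2 * T2 + D) * (8 * r * r powr - \<delta>)"
        using r1 by (simp add: powr_minus field_simps)
      hence "\<nu> * (2 * K * r powr - \<alpha>) \<le> (2 * T2 + D) * (8 * r * r powr - \<delta>) * (2 * K * r powr - \<alpha>)"
        using K by (intro mult_right_mono) auto
      also have "\<dots> = 16 * K * (2 * T2 + D) * (r * r powr - \<delta> * r powr - \<alpha>)" by simp
      also have "r * r powr - \<delta> * r powr - \<alpha> = r powr (1 + - \<delta> + - \<alpha>)"
        using r1 by (simp only: powr_add powr_one)
      also have "1 + - \<delta> + - \<alpha> = - (\<delta> / 2)" by (simp add: \<alpha>_def)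
      finally show ?thesis .
    qed
    also have "64 * cmod c * (2 * T2 + D) * r powr - (\<delta> / 2) + 16 * K * (2 * T2 + D) * r powr - (\<delta> / 2)
        = (64 * cmod c + 16 * K) * r powr - (\<delta> / 2) * (2 * T2 + D)" by (simp add: algebra_simps)
    also have "\<dots> \<le> (64 * cmod c + 16 * K) * r powr - (\<delta> / 2) * ((2 + D) * (T2 + 1))"
      using K D T2 by (intro mult_left_mono) (auto simp: algebra_simps)
    finally show ?thesis by (simp add: C_def T2_def mult_ac)
  qed
  thus ?thesis using C r0(1) by blast
qed

section \<open>Growth of transcendental functions\<close>

lemma nz_meromorphic_linear_powi: "nz_meromorphic (\<lambda>z. (z - a) powi k)"
proof (rule nz_meromorphic_ev_at[of _ a])
  show "eventually (\<lambda>w. (w - a) powi k \<noteq> 0) (at a)"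
    using eventually_neq_at_within[of a a UNIV] by eventually_elim simp
qed (intro meromorphic_intros)

text \<open>Dividing f by the rational function with the same zeros and poles gives a function with
  vanishing logarithmic derivative, which extends to an entire function and must be
  constant.\<close>

lemma rational_if_logderiv:
  assumes f: "nz_meromorphic f" and fin: "finite {z. zorder f z \<noteq> 0}"
    and ld: "\<And>z. good_point f z \<Longrightarrow> deriv f z / f z = (\<Sum>a | zorder f a \<noteq> 0. of_int (zorder f a) / (z - a))"
  shows "rational_meromorphic f"
proof -
  define Z where "Z = {z. zorder f z \<noteq> 0}"
  have finZ: "finite Z" using fin by (simp add: Z_def)
  define P where "P z = (\<Prod>a\<in>Z. (z - a) powi (- zorder f a))" for z
  define g where "g z = f z * P z" for z
  have nzP: "nz_meromorphic P"
    unfolding P_def[abs_def] by (intro nz_meromorphic_prod finZ nz_meromorphic_linear_powi)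
  have g_nz: "nz_meromorphic g" unfolding g_def[abs_def] by (intro nz_meromorphic_mult f nzP)
  have g_ord: "zorder g z = 0" for z
  proof -
    have nz1: "nz_meromorphic (\<lambda>z. z - a)" for a using nz_meromorphic_linear_powi[of a 1] by simp
    have "zorder P z = (\<Sum>a\<in>Z. zorder (\<lambda>z. (z - a) powi (- zorder f a)) z)"
      unfolding P_def[abs_def] by (intro nz_zorder_prod finZ nz_meromorphic_linear_powi)
    also have "\<dots> = (\<Sum>a\<in>Z. if z = a then - zorder f a else 0)"
    proof (rule sum.cong[OF refl])
      fix a
      have "zorder (\<lambda>z. (z - a) powi (- zorder f a)) z = - zorder f a * zorder (\<lambda>z. z - a) z"
        by (intro zorder_power_int nz_meromorphicD nz1)
      thus "zorder (\<lambda>z. (z - a) powi (- zorder f a)) z = (if z = a then - zorder f a else 0)"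
        by (simp add: linear_zorder)
    qed
    also have "\<dots> = - zorder f z" using finZ by (simp add: Z_def)
    finally show ?thesis unfolding g_def[abs_def] by (simp add: nz_zorder_mult[OF f nzP])
  qed
  define G where "G = remove_sings g"
  have G: "G analytic_on {z}" "G z \<noteq> 0" for z
    using nz_zorder_eq_0[OF g_nz g_ord] by (simp_all add: G_def)
  have holG: "G holomorphic_on UNIV"
    by (rule analytic_imp_holomorphic, subst analytic_on_analytic_at) (simp add: G)
  have at_good: "G z = g z \<and> deriv G z = 0" if gp: "good_point f z" for z
  proof -
    have zZ: "z - a \<noteq> 0" if "a \<in> Z" for a using good_point_zorder[OF gp] that by (auto simp: Z_def)
    have "P analytic_on {z}" unfolding P_def[abs_def] using zZ by (intro analytic_intros) auto
    hence gan: "g analytic_on {z}" unfolding g_def[abs_def] using gp by (intro analytic_on_mult) (auto simp: good_point_def)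
    have ev: "eventually (\<lambda>w. G w = g w) (nhds z)" unfolding G_def by (rule eventually_remove_sings_eq_nhds[OF gan])
    have dP: "(P has_field_derivative P z * (\<Sum>a\<in>Z. of_int (- zorder f a) * 1 / (z - a))) (at z)"
      unfolding P_def[abs_def] using zZ
      by (intro has_field_derivative_prod_powi[where g = "\<lambda>a z. z - a"] finZ) (auto intro!: derivative_eq_intros)
    have df: "(f has_field_derivative deriv f z) (at z)"
      using gp analytic_on_imp_differentiable_at[of f "{z}" z] by (simp add: good_point_def field_differentiable_derivI)
    have "(\<Sum>a\<in>Z. of_int (- zorder f a) * 1 / (z - a)) = - (deriv f z / f z)"
      unfolding ld[OF gp] Z_def by (simp add: sum_negf)
    hence "(P has_field_derivative P z * - (deriv f z / f z)) (at z)" using dP by simp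
    from DERIV_mult[OF df this] have "(g has_field_derivative 0) (at z)"
      unfolding g_def[abs_def] using gp by (simp add: good_point_def)
    hence "(G has_field_derivative 0) (at z)" by (subst DERIV_cong_ev[OF refl ev refl])
    thus ?thesis using eventually_nhds_x_imp_x[OF ev] by (simp add: DERIV_imp_deriv)
  qed
  \<comment> \<open>Known at good points only; continuity of G' carries it over to the sparse
    remainder.\<close>
  have "deriv G z = 0" for z
  proof -
    have "eventually (\<lambda>w. deriv G w = 0) (at z)"
    proof -
      have "eventually (good_point f) (at z)"
        by (rule eventually_cosparse_imp_eventually_at[OF eventually_good_point[OF f]]) auto
      thus ?thesis by eventually_elim (simp add: at_good)
    qed
    hence "(deriv G \<longlongrightarrow> 0) (at z)" by (rule tendsto_eventually)
    moreover have "deriv G holomorphic_on UNIV" by (rule holomorphic_deriv[OF holG]) simp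
    hence "isCont (deriv G) z" using holomorphic_on_imp_continuous_on continuous_on_eq_continuous_at[OF open_UNIV] by blast
    hence "(deriv G \<longlongrightarrow> deriv G z) (at z)" by (simp add: isCont_def)
    ultimately show ?thesis by (rule tendsto_unique[OF at_neq_bot, symmetric])
  qed
  hence "(G has_field_derivative 0) (at z)" for z
    using holomorphic_derivI[OF holG, of z] by simp
  then obtain C where C: "\<And>z. G z = C"
    using has_field_derivative_zero_constant[of UNIV G] by auto
  define p where "p = smult C (\<Prod>a\<in>Z. [:- a, 1:] ^ nat (zorder f a))"
  define q where "q = (\<Prod>a\<in>Z. [:- a, 1:] ^ nat (- zorder f a))"
  have "q \<noteq> 0" unfolding q_def using finZ by simp
  moreover have "eventually (\<lambda>z. f z = poly p z / poly q z) (cosparse UNIV)"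
    using eventually_good_point[OF f]
  proof eventually_elim
    case (elim z)
    have zZ: "z - a \<noteq> 0" if "a \<in> Z" for a using good_point_zorder[OF elim] that by (auto simp: Z_def)
    have "f z * P z = C" using at_good[OF elim] C by (simp add: g_def)
    moreover have "P z = poly q z / (\<Prod>a\<in>Z. (z - a) ^ nat (zorder f a))"
      unfolding P_def q_def poly_prod prod_dividef[symmetric]
    proof (rule prod.cong[OF refl])
      fix a assume "a \<in> Z"
      thus "(z - a) powi - zorder f a = poly ([:- a, 1:] ^ nat (- zorder f a)) z / (z - a) ^ nat (zorder f a)"
        using zZ[of a] by (cases "zorder f a \<ge> 0") (auto simp: power_int_def poly_power field_simps)
    qed
    moreover have "poly p z = C * (\<Prod>a\<in>Z. (z - a) ^ nat (zorder f a))"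
      by (simp add: p_def poly_prod poly_power)
    moreover have "poly q z \<noteq> 0" "(\<Prod>a\<in>Z. (z - a) ^ nat (zorder f a)) \<noteq> 0"
      using zZ finZ by (auto simp: q_def poly_prod poly_power)
    ultimately show ?case by (simp add: field_simps)
  qed
  ultimately show ?thesis unfolding rational_meromorphic_def by blast
qed

text \<open>If T(r,f) < K ln r along an unbounded sequence of generic radii, the zeros and poles
  number at most 2K + 1. Letting R tend to infinity along that sequence in
  \<open>logderiv_error_le\<close> identifies f'/f with a finite sum of simple fractions, so f is
  rational.\<close>

theorem transcendental_growth:
  assumes f: "nz_meromorphic f" and nr: "\<not> rational_meromorphic f"
  shows "\<exists>x0. \<forall>r\<ge>x0. generic f r \<longrightarrow> K * ln r \<le> nev_T r f"
proof (rule ccontr)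
  assume "\<not> ?thesis"
  hence small: "\<exists>r\<ge>x. generic f r \<and> nev_T r f < K * ln r" for x by (force simp: not_le)
  obtain D where D: "0 \<le> D" and T0: "\<And>r. generic f r \<Longrightarrow> 1 \<le> r \<Longrightarrow> 0 \<le> nev_T r f"
    and Dm: "\<And>r. generic f r \<Longrightarrow> 1 \<le> r \<Longrightarrow> nev_m r f + nev_m r (\<lambda>z. 1 / f z) \<le> 2 * nev_T r f + D"
    and DN: "\<And>r. generic f r \<Longrightarrow> 1 \<le> r \<Longrightarrow> nev_N r f + nev_N r (\<lambda>z. 1 / f z) \<le> 2 * nev_T r f + D"
    using nev_T_controls[OF f] by blast
  define \<nu> where "\<nu> \<rho> = (\<Sum>a\<in>divisor_in f \<rho>. real_of_int \<bar>zorder f a\<bar>)" for \<rho>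
  have \<nu>_le: "\<nu> \<rho> \<le> 2 * K + 1" if \<rho>: "1 \<le> \<rho>" for \<rho>
  proof (rule ccontr)
    assume "\<not> \<nu> \<rho> \<le> 2 * K + 1"
    hence gt: "1 < \<nu> \<rho> - 2 * K" by simp
    \<comment> \<open>Large enough that ln r exceeds the right-hand side of the inequality for
      (\<nu> - 2K) ln r derived below.\<close>
    define x where "x = max \<rho> (exp (\<bar>D + \<nu> \<rho> * ln \<rho>\<bar> + 1))"
    obtain r where r: "x \<le> r" "generic f r" "nev_T r f < K * ln r" using small by blast
    have r1: "1 \<le> r" "\<rho> \<le> r" using r \<rho> by (auto simp: x_def)
    have "\<nu> \<rho> * (ln r - ln \<rho>) \<le> nev_N r f + nev_N r (\<lambda>z. 1 / f z)"
      unfolding \<nu>_def using \<rho> r1 by (intro divisor_count_le f)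
    also have "\<dots> \<le> 2 * (K * ln r) + D" using DN[OF r(2) r1(1)] r(3) by simp
    finally have "(\<nu> \<rho> - 2 * K) * ln r \<le> D + \<nu> \<rho> * ln \<rho>" by (simp add: algebra_simps)
    moreover have "1 * ln r \<le> (\<nu> \<rho> - 2 * K) * ln r" using gt r1 by (intro mult_right_mono) auto
    moreover have "\<bar>D + \<nu> \<rho> * ln \<rho>\<bar> + 1 \<le> ln r"
    proof -
      have "exp (\<bar>D + \<nu> \<rho> * ln \<rho>\<bar> + 1) \<le> r" using r(1) by (simp add: x_def)
      hence "ln (exp (\<bar>D + \<nu> \<rho> * ln \<rho>\<bar> + 1)) \<le> ln r" by (intro ln_mono) auto
      thus ?thesis by simp
    qed
    ultimately show False by linarith
  qed
  have fin: "finite {z. zorder f z \<noteq> 0}"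
  proof (rule ccontr)
    assume "infinite {z. zorder f z \<noteq> 0}"
    then obtain B where B: "finite B" "card B = nat \<lceil>2 * K + 2\<rceil>" "B \<subseteq> {z. zorder f z \<noteq> 0}"
      using infinite_arbitrarily_large by blast
    define \<rho> where "\<rho> = Max (insert 1 (cmod ` B))"
    have \<rho>: "1 \<le> \<rho>" "\<And>b. b \<in> B \<Longrightarrow> cmod b \<le> \<rho>" using B(1) by (auto simp: \<rho>_def)
    have "2 * K + 2 \<le> real (card B)" unfolding B(2) by linarith
    also have "\<dots> = (\<Sum>a\<in>B. 1)" by simp
    also have "\<dots> \<le> (\<Sum>a\<in>B. real_of_int \<bar>zorder f a\<bar>)"
    proof (rule sum_mono)
      fix a assume "a \<in> B"
      hence "1 \<le> \<bar>zorder f a\<bar>" using B(3) by auto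
      thus "1 \<le> real_of_int \<bar>zorder f a\<bar>" by linarith
    qed
    also have "\<dots> \<le> \<nu> \<rho>"
      unfolding \<nu>_def using B \<rho> by (intro sum_mono2 finite_divisor_in f) (auto simp: divisor_in_def)
    finally show False using \<nu>_le[OF \<rho>(1)] by simp
  qed
  define Z where "Z = {z. zorder f z \<noteq> 0}"
  have finZ: "finite Z" using fin by (simp add: Z_def)
  define N where "N = (\<Sum>a\<in>Z. real_of_int \<bar>zorder f a\<bar>)"
  have N0: "0 \<le> N" unfolding N_def by (intro sum_nonneg) auto
  \<comment> \<open>The error bound at radius R once |z| <= R/2: 2R / (R/2)^2 = 8/R times 2 K ln R +
    D, plus 2N / R.\<close>
  define h where "h R = 16 * K * (ln R / R) + (8 * D + 2 * N) * (1 / R)" for R :: real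
  have h_lim: "(h \<longlongrightarrow> 0) at_top"
  proof -
    have "((\<lambda>R::real. ln R / R) \<longlongrightarrow> 0) at_top" "((\<lambda>R::real. 1 / R) \<longlongrightarrow> 0) at_top"
      by real_asymp+
    hence "(h \<longlongrightarrow> 16 * K * 0 + (8 * D + 2 * N) * 0) at_top"
      unfolding h_def[abs_def] by (intro tendsto_intros)
    thus ?thesis by simp
  qed
  have ld: "deriv f z / f z = (\<Sum>a\<in>Z. of_int (zorder f a) / (z - a))" if gp: "good_point f z" for z
  proof -
    define e where "e = cmod (deriv f z / f z - (\<Sum>a\<in>Z. of_int (zorder f a) / (z - a)))"
    have e_le: "e \<le> h R" if R: "generic f R" "nev_T R f < K * ln R" "Max (insert 1 (cmod ` Z)) + 2 * cmod z + 1 \<le> R" for R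
    proof -
      have "1 \<le> Max (insert 1 (cmod ` Z))" using finZ by simp
      hence R1: "1 \<le> R" and zR: "cmod z \<le> R / 2" "cmod z < R" using R(3) norm_ge_zero[of z] by linarith+
      have ZR: "cmod a \<le> R" if "a \<in> Z" for a
      proof -
        have "cmod a \<le> Max (insert 1 (cmod ` Z))" using that finZ by (intro Max_ge) auto
        thus ?thesis using R(3) norm_ge_zero[of z] by linarith
      qed
      have ZZ: "divisor_in f R = Z" using ZR by (auto simp: divisor_in_def Z_def)
      have "(R / 2)\<^sup>2 \<le> (R - cmod z)\<^sup>2" using zR R1 by (intro power_mono) auto
      hence k: "2 * R / (R - cmod z)\<^sup>2 \<le> 2 * R / (R / 2)\<^sup>2"
        using zR R1 by (intro divide_left_mono mult_pos_pos) auto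
      have V: "circle_mean R (\<lambda>w. \<bar>ln (cmod (f w))\<bar>) \<le> 2 * (K * ln R) + D"
        unfolding circle_mean_ln_eq_nev_m(2)[OF R(1)] using Dm[OF R(1) R1] R(2) by simp
      have cln: "continuous_on (sphere 0 R) (\<lambda>w. \<bar>ln (cmod (f w))\<bar>)"
        using generic_continuous[OF R(1)] generic_nonzero[OF R(1)] by (intro continuous_intros) auto
      have "e \<le> 2 * R / (R - cmod z)\<^sup>2 * circle_mean R (\<lambda>w. \<bar>ln (cmod (f w))\<bar>) + N / (R - cmod z)"
        unfolding e_def N_def using logderiv_error_le[OF f R(1) zR(2) gp] unfolding ZZ .
      also have "\<dots> \<le> 2 * R / (R / 2)\<^sup>2 * (2 * (K * ln R) + D) + N / (R / 2)"
        using k V zR R1 N0 by (intro add_mono mult_mono divide_left_mono mult_pos_pos circle_mean_nonneg cln) auto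
      also have "\<dots> = h R" using R1 unfolding h_def by (simp add: field_simps power2_eq_square)
      finally show ?thesis by simp
    qed
    have "\<not> 0 < e"
    proof
      assume "0 < e"
      hence "eventually (\<lambda>R. h R < e) at_top" using h_lim by (auto simp: order_tendsto_iff)
      then obtain y where y: "\<And>R. y \<le> R \<Longrightarrow> h R < e" by (auto simp: eventually_at_top_linorder)
      obtain R where R: "max y (Max (insert 1 (cmod ` Z)) + 2 * cmod z + 1) \<le> R" "generic f R" "nev_T R f < K * ln R"
        using small by blast
      show False using e_le[OF R(2,3)] y[of R] R(1) by simp
    qed
    hence "e = 0" unfolding e_def by simp
    thus ?thesis by (simp add: e_def)
  qed
  have "rational_meromorphic f"
    using rational_if_logderiv[OF f fin] ld unfolding Z_def by blast
  thus False using nr by contradiction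
qed

section \<open>Orders and arithmetic of the characteristic\<close>

lemma eventually_nev_circle:
  assumes "eventually P (cosparse (UNIV :: complex set))"
  shows "eventually (\<lambda>r. \<forall>z. cmod z = r \<longrightarrow> P z) nev_filter"
proof -
  have "countable {z. \<not> P z}"
    using assms sparse_imp_countable[OF open_UNIV, of "{z. \<not> P z}"] by (simp add: eventually_cosparse)
  hence "countable (cmod ` {z. \<not> P z})" by simp
  from eventually_nev_not_in[OF finite_log_measure_countable[OF this]]
  show ?thesis by eventually_elim auto
qed

text \<open>A lower bound on the order that also makes sense for functions vanishing near z, where
  \<open>zorder\<close> carries no information. Sums, products and derivatives can thus be estimated
  without first proving them nonzero.\<close>

definition order_ge :: "(complex \<Rightarrow> complex) \<Rightarrow> complex \<Rightarrow> int \<Rightarrow> bool" where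
  "order_ge g z n \<longleftrightarrow> (\<exists>G. (\<lambda>w. g (z + w)) has_laurent_expansion G \<and> (\<forall>k<n. fls_nth G k = 0))"

lemma order_ge_iff_zorder:
  assumes "nz_meromorphic g" shows "order_ge g z n \<longleftrightarrow> n \<le> zorder g z"
proof
  assume "order_ge g z n"
  then obtain G where G: "(\<lambda>w. g (z + w)) has_laurent_expansion G" "\<And>k. k < n \<Longrightarrow> fls_nth G k = 0"
    by (auto simp: order_ge_def)
  have "G \<noteq> 0" using has_laurent_expansion_eventually_nonzero_iff[OF G(1)] nz_meromorphicD(4)[OF assms] by simp
  thus "n \<le> zorder g z" using has_laurent_expansion_zorder[OF G(1)] G(2) by (auto intro: fls_subdegree_geI)
next
  assume n: "n \<le> zorder g z"
  obtain G where G: "(\<lambda>w. g (z + w)) has_laurent_expansion G"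
    using nz_meromorphicD(2)[OF assms, of z] by (auto simp: meromorphic_on_def)
  have "G \<noteq> 0" using has_laurent_expansion_eventually_nonzero_iff[OF G] nz_meromorphicD(4)[OF assms] by simp
  hence "zorder g z = fls_subdegree G" by (rule has_laurent_expansion_zorder[OF G])
  thus "order_ge g z n" using G n unfolding order_ge_def by (intro exI[of _ G]) auto
qed

lemma order_ge_mono: "order_ge g z n \<Longrightarrow> m \<le> n \<Longrightarrow> order_ge g z m"
  unfolding order_ge_def by (meson order_less_le_trans)

lemma order_ge_cong:
  assumes "order_ge g z n" "eventually (\<lambda>w. g w = h w) (at z)" shows "order_ge h z n"
  using assms has_laurent_expansion_cong'[OF assms(2) refl refl] unfolding order_ge_def by metis

lemma order_ge_add: "order_ge g z n \<Longrightarrow> order_ge h z n \<Longrightarrow> order_ge (\<lambda>w. g w + h w) z n"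
proof -
  assume "order_ge g z n" "order_ge h z n"
  then obtain G H where "(\<lambda>w. g (z + w)) has_laurent_expansion G" "\<forall>k<n. fls_nth G k = 0"
    "(\<lambda>w. h (z + w)) has_laurent_expansion H" "\<forall>k<n. fls_nth H k = 0"
    by (auto simp: order_ge_def)
  thus ?thesis unfolding order_ge_def
    by (intro exI[of _ "G + H"] conjI has_laurent_expansion_add) auto
qed

lemma order_ge_uminus: "order_ge g z n \<Longrightarrow> order_ge (\<lambda>w. - g w) z n"
proof -
  assume "order_ge g z n"
  then obtain G where "(\<lambda>w. g (z + w)) has_laurent_expansion G" "\<forall>k<n. fls_nth G k = 0"
    by (auto simp: order_ge_def)
  thus ?thesis unfolding order_ge_def
    by (intro exI[of _ "- G"] conjI has_laurent_expansion_minus) auto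
qed

lemma order_ge_diff: "order_ge g z n \<Longrightarrow> order_ge h z n \<Longrightarrow> order_ge (\<lambda>w. g w - h w) z n"
  using order_ge_add[OF _ order_ge_uminus] by simp

lemma order_ge_mult:
  assumes "order_ge g z n" "order_ge h z m" shows "order_ge (\<lambda>w. g w * h w) z (n + m)"
proof -
  obtain G H where G: "(\<lambda>w. g (z + w)) has_laurent_expansion G" "\<forall>k<n. fls_nth G k = 0"
    and H: "(\<lambda>w. h (z + w)) has_laurent_expansion H" "\<forall>k<m. fls_nth H k = 0"
    using assms by (auto simp: order_ge_def)
  have "fls_nth (G * H) k = 0" if "k < n + m" for k
  proof (cases "G = 0 \<or> H = 0")
    case False
    hence "n \<le> fls_subdegree G" "m \<le> fls_subdegree H" using G(2) H(2) by (auto intro: fls_subdegree_geI)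
    thus ?thesis using that False by (intro fls_eq0_below_subdegree) simp
  qed auto
  thus ?thesis unfolding order_ge_def using has_laurent_expansion_mult[OF G(1) H(1)] by blast
qed

lemma order_ge_const: "order_ge (\<lambda>_. c) z 0"
  unfolding order_ge_def by (intro exI[of _ "fls_const c"]) (auto intro: laurent_expansion_intros)

lemma laurent_expansion_deriv_at:
  assumes "(\<lambda>w. g (z + w)) has_laurent_expansion G"
  shows "(\<lambda>w. deriv g (z + w)) has_laurent_expansion fls_deriv G"
proof -
  have "deriv (\<lambda>w. g (z + w)) has_laurent_expansion fls_deriv G"
    using assms by (rule has_laurent_expansion_deriv)
  also have "deriv (\<lambda>w. g (z + w)) = (\<lambda>w. deriv g (z + w))"
    by (simp add: deriv_shift_0' add_ac o_def fun_eq_iff)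
  finally show ?thesis .
qed

text \<open>The only delicate index is -1: differentiation gives that coefficient the factor
  0.\<close>

lemma order_ge_deriv:
  assumes "order_ge g z 0" shows "order_ge (deriv g) z 0"
proof -
  obtain G where G: "(\<lambda>w. g (z + w)) has_laurent_expansion G" "\<forall>k<0. fls_nth G k = 0"
    using assms by (auto simp: order_ge_def)
  have "fls_nth (fls_deriv G) k = 0" if "k < 0" for k
    using that G(2) by (cases "k = - 1") auto
  thus ?thesis unfolding order_ge_def using laurent_expansion_deriv_at[OF G(1)] by blast
qed

lemma order_ge_logderiv:
  assumes g: "nz_meromorphic g"
  shows "order_ge (\<lambda>w. deriv g w / g w) z (if zorder g z = 0 then 0 else - 1)"
proof -
  obtain G where G: "(\<lambda>w. g (z + w)) has_laurent_expansion G"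
    using nz_meromorphicD(2)[OF g, of z] by (auto simp: meromorphic_on_def)
  have G0: "G \<noteq> 0" using has_laurent_expansion_eventually_nonzero_iff[OF G] nz_meromorphicD(4)[OF g] by simp
  have zo: "zorder g z = fls_subdegree G" using has_laurent_expansion_zorder[OF G G0] .
  have exp: "(\<lambda>w. deriv g (z + w) / g (z + w)) has_laurent_expansion fls_deriv G / G"
    by (intro laurent_expansion_intros laurent_expansion_deriv_at G)
  have "fls_nth (fls_deriv G / G) k = 0" if k: "k < (if zorder g z = 0 then 0 else - 1)" for k
  proof (cases "fls_deriv G = 0")
    case False
    have "fls_subdegree G - 1 \<le> fls_subdegree (fls_deriv G)"
      by (rule fls_subdegree_geI[OF False]) auto
    moreover have "0 \<le> fls_subdegree (fls_deriv G)" if "fls_subdegree G = 0"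
    proof (rule fls_subdegree_geI[OF False])
      fix k :: int assume "k < 0"
      thus "fls_nth (fls_deriv G) k = 0" using that by (cases "k = - 1") auto
    qed
    ultimately have "k < fls_subdegree (fls_deriv G / G)"
      using k zo False G0 by (auto simp: fls_divide_subdegree split: if_splits)
    thus ?thesis by (rule fls_eq0_below_subdegree)
  qed simp
  thus ?thesis unfolding order_ge_def using exp by blast
qed

text \<open>The quotient has derivative 0 on some ball of good points, so it is constant there; the
  alternative for meromorphic functions between being constant and avoiding the value extends this
  to the plane.\<close>

lemma logderiv_eq_imp_proportional:
  assumes g: "nz_meromorphic g" and h: "nz_meromorphic h"
    and eq: "eventually (\<lambda>z. deriv g z / g z = deriv h z / h z) (cosparse UNIV)"
  shows "\<exists>C. eventually (\<lambda>z. g z = C * h z) (cosparse UNIV)"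
proof -
  define q where "q z = g z / h z" for z
  have q: "nz_meromorphic q" unfolding q_def[abs_def] by (intro nz_meromorphic_divide g h)
  have ev: "eventually (\<lambda>z. good_point g z \<and> good_point h z \<and> deriv g z / g z = deriv h z / h z) (cosparse UNIV)"
    by (intro eventually_conj eventually_good_point g h eq)
  have "eventually (\<lambda>z. good_point g z \<and> good_point h z \<and> deriv g z / g z = deriv h z / h z) (at 0)"
    by (rule eventually_cosparse_imp_eventually_at[OF ev]) auto
  then obtain d where d: "0 < d" and good: "\<And>z. z \<noteq> 0 \<Longrightarrow> cmod z < d \<Longrightarrow>
      good_point g z \<and> good_point h z \<and> deriv g z / g z = deriv h z / h z"
    by (auto simp: eventually_at)
  \<comment> \<open>The ball about \<open>z0\<close> with radius d/2 has the origin, a possibly bad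
    point, on its boundary.\<close>
  define z0 where "z0 = complex_of_real (d / 2)"
  have B: "z \<noteq> 0 \<and> cmod z < d" if "z \<in> ball z0 (d / 2)" for z
  proof -
    have n0: "cmod z0 = d / 2" using d by (simp add: z0_def)
    have zz: "cmod (z0 - z) < d / 2" using that by (simp add: dist_norm)
    have "cmod z \<le> cmod z0 + cmod (z0 - z)" by (metis norm_minus_commute norm_triangle_sub)
    moreover have "z \<noteq> 0" using zz n0 by auto
    ultimately show ?thesis using n0 zz by simp
  qed
  have dq: "(q has_field_derivative 0) (at z within ball z0 (d / 2))" if z: "z \<in> ball z0 (d / 2)" for z
  proof -
    have gd: "good_point g z" "good_point h z" "deriv g z / g z = deriv h z / h z" using good[of z] B[OF z] by auto
    have "(g has_field_derivative deriv g z) (at z)" "(h has_field_derivative deriv h z) (at z)"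
      using gd analytic_on_imp_differentiable_at[of _ "{z}" z] by (simp_all add: good_point_def field_differentiable_derivI)
    from DERIV_divide[OF this] gd have "(q has_field_derivative (deriv g z * h z - g z * deriv h z) / (h z * h z)) (at z)"
      by (simp add: q_def[abs_def] good_point_def)
    moreover have "deriv g z * h z - g z * deriv h z = 0" using gd by (simp add: good_point_def field_simps)
    ultimately show ?thesis by (simp add: has_field_derivative_at_within)
  qed
  obtain C where C: "\<And>z. z \<in> ball z0 (d / 2) \<Longrightarrow> q z = C"
    using has_field_derivative_zero_constant[OF convex_ball dq] by auto
  have "eventually (\<lambda>z. q z = C) (cosparse UNIV)"
  proof (rule ccontr)
    assume "\<not> ?thesis"
    hence "eventually (\<lambda>z. q z \<noteq> C) (cosparse UNIV)"
      using meromorphic_imp_constant_or_avoid[OF nz_meromorphicD(1)[OF q], of C] by auto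
    hence "eventually (\<lambda>z. q z \<noteq> C) (at z0)" by (rule eventually_cosparse_imp_eventually_at) auto
    moreover have "eventually (\<lambda>z. z \<in> ball z0 (d / 2) - {z0}) (at z0)"
      using d by (intro eventually_at_in_open) auto
    ultimately have "eventually (\<lambda>z. False) (at z0)" by eventually_elim (use C in auto)
    thus False by simp
  qed
  moreover note nz_meromorphicD(3)[OF h]
  ultimately have "eventually (\<lambda>z. g z = C * h z) (cosparse UNIV)"
    by eventually_elim (simp add: q_def field_simps)
  thus ?thesis by blast
qed

section \<open>Arithmetic of pole multiplicities, proximity functions and characteristics\<close>

lemma pole_mult_mult_le:
  assumes "nz_meromorphic f" "nz_meromorphic g"
  shows "pole_mult (\<lambda>z. f z * g z) z \<le> pole_mult f z + pole_mult g z"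
  using assms by (simp add: pole_mult_nz nz_meromorphic_mult nz_zorder_mult)

lemma pole_mult_power: "nz_meromorphic f \<Longrightarrow> pole_mult (\<lambda>z. f z ^ n) z = n * pole_mult f z"
  by (simp add: pole_mult_nz nz_meromorphic_power nz_zorder_power nat_mult_distrib flip: mult_minus_right)

lemma pole_mult_diff_le:
  assumes "nz_meromorphic f" "nz_meromorphic g" "nz_meromorphic (\<lambda>z. f z - g z)"
  shows "pole_mult (\<lambda>z. f z - g z) z \<le> pole_mult f z + pole_mult g z"
proof -
  have "order_ge (\<lambda>z. f z - g z) z (min (zorder f z) (zorder g z))"
    by (intro order_ge_diff; rule order_ge_mono[where n = "zorder f z"] order_ge_mono[where n = "zorder g z"])
       (auto simp: order_ge_iff_zorder assms)
  thus ?thesis using assms by (auto simp: order_ge_iff_zorder pole_mult_nz)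
qed

lemma nev_m_mult_le:
  assumes "continuous_on (sphere 0 r) g" "continuous_on (sphere 0 r) h" "0 \<le> r"
  shows "nev_m r (\<lambda>z. g z * h z) \<le> nev_m r g + nev_m r h"
proof -
  have c: "continuous_on (sphere 0 r) (\<lambda>z. log_plus (cmod (g z)))" "continuous_on (sphere 0 r) (\<lambda>z. log_plus (cmod (h z)))"
    by (intro continuous_on_log_plus continuous_on_norm assms)+
  have "nev_m r (\<lambda>z. g z * h z) \<le> circle_mean r (\<lambda>z. log_plus (cmod (g z)) + log_plus (cmod (h z)))"
    unfolding nev_m_eq norm_mult
    by (intro circle_mean_mono continuous_on_log_plus continuous_on_mult continuous_on_norm continuous_on_add
        log_plus_mult_le assms) auto
  thus ?thesis using circle_mean_add[OF c assms(3)] by (simp add: nev_m_eq)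
qed

lemma nev_m_le_add:
  assumes "continuous_on (sphere 0 r) f" "continuous_on (sphere 0 r) g" "continuous_on (sphere 0 r) h" "0 \<le> r"
    and "\<And>z. cmod z = r \<Longrightarrow> log_plus (cmod (f z)) \<le> log_plus (cmod (g z)) + log_plus (cmod (h z)) + C"
  shows "nev_m r f \<le> nev_m r g + nev_m r h + C"
proof -
  have c: "continuous_on (sphere 0 r) (\<lambda>z. log_plus (cmod (f z)))" "continuous_on (sphere 0 r) (\<lambda>z. log_plus (cmod (g z)))"
    "continuous_on (sphere 0 r) (\<lambda>z. log_plus (cmod (h z)))"
    by (intro continuous_on_log_plus continuous_on_norm assms)+
  have "nev_m r f \<le> circle_mean r (\<lambda>z. (log_plus (cmod (g z)) + log_plus (cmod (h z))) + C)"
    unfolding nev_m_eq using assms(5) by (intro circle_mean_mono continuous_on_add continuous_on_const c assms(4)) auto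
  also have "\<dots> = nev_m r g + nev_m r h + C"
    unfolding nev_m_eq
    by (simp only: circle_mean_add[OF continuous_on_add[OF c(2,3)] continuous_on_const assms(4)]
        circle_mean_add[OF c(2,3) assms(4)] circle_mean_const)
  finally show ?thesis .
qed

lemma nev_m_diff_le:
  assumes "continuous_on (sphere 0 r) g" "continuous_on (sphere 0 r) h" "0 \<le> r"
  shows "nev_m r (\<lambda>z. g z - h z) \<le> nev_m r g + nev_m r h + ln 2"
proof (rule nev_m_le_add[OF continuous_on_diff[OF assms(1,2)] assms])
  show "log_plus (cmod (g z - h z)) \<le> log_plus (cmod (g z)) + log_plus (cmod (h z)) + ln 2" for z
    by (rule order_trans[OF log_plus_mono[OF norm_triangle_ineq4] log_plus_add_le]) auto
qed

lemma nev_m_add_le: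
  assumes "continuous_on (sphere 0 r) g" "continuous_on (sphere 0 r) h" "0 \<le> r"
  shows "nev_m r (\<lambda>z. g z + h z) \<le> nev_m r g + nev_m r h + ln 2"
proof (rule nev_m_le_add[OF continuous_on_add[OF assms(1,2)] assms])
  show "log_plus (cmod (g z + h z)) \<le> log_plus (cmod (g z)) + log_plus (cmod (h z)) + ln 2" for z
    by (rule order_trans[OF log_plus_mono[OF norm_triangle_ineq] log_plus_add_le]) auto
qed

lemma nev_m_const [simp]: "nev_m r (\<lambda>_. c) = log_plus (cmod c)"
  by (simp add: nev_m_eq)

lemma nev_m_power: "nev_m r (\<lambda>z. f z ^ n) = real n * nev_m r f"
  by (simp add: nev_m_eq norm_power log_plus_power circle_mean_cmult)

lemma nev_m_prod_le:
  assumes "finite A" "\<And>a. a \<in> A \<Longrightarrow> continuous_on (sphere 0 r) (g a)" "0 \<le> r"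
  shows "nev_m r (\<lambda>z. \<Prod>a\<in>A. g a z ^ k a) \<le> (\<Sum>a\<in>A. real (k a) * nev_m r (g a))"
  using assms
proof (induction A)
  case empty
  show ?case by (simp add: log_plus_def)
next
  case (insert b A)
  have "nev_m r (\<lambda>z. \<Prod>a\<in>insert b A. g a z ^ k a) = nev_m r (\<lambda>z. g b z ^ k b * (\<Prod>a\<in>A. g a z ^ k a))"
    using insert.hyps by simp
  also have "\<dots> \<le> nev_m r (\<lambda>z. g b z ^ k b) + nev_m r (\<lambda>z. \<Prod>a\<in>A. g a z ^ k a)"
    using insert.prems by (intro nev_m_mult_le continuous_on_power continuous_on_prod) auto
  also have "\<dots> \<le> real (k b) * nev_m r (g b) + (\<Sum>a\<in>A. real (k a) * nev_m r (g a))"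
    using insert by (intro add_mono) (auto simp: nev_m_power)
  finally show ?case using insert.hyps by simp
qed

lemma nev_m_cong: "0 \<le> r \<Longrightarrow> (\<And>z. cmod z = r \<Longrightarrow> g z = h z) \<Longrightarrow> nev_m r g = nev_m r h"
  unfolding nev_m_eq by (intro circle_mean_cong) auto

lemma nev_N_le_add:
  assumes "nz_meromorphic f" "nz_meromorphic g" "nz_meromorphic h" "1 \<le> r"
    and "\<And>z. pole_mult f z \<le> pole_mult g z + pole_mult h z"
  shows "nev_N r f \<le> nev_N r g + nev_N r h"
proof -
  have lf: "locally_finite_weight (pole_mult g)" "locally_finite_weight (pole_mult h)"
    by (intro locally_finite_pole_mult nz_meromorphicD assms)+
  have "nev_N r f \<le> weighted_N (\<lambda>z. pole_mult g z + pole_mult h z) r"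
    using weighted_N_mono_weight[OF locally_finite_weight_add[OF lf] assms(5,4)] assms(4)
    by (simp add: nev_N_eq nz_meromorphicD[OF assms(1)])
  thus ?thesis using assms(4) by (simp add: weighted_N_add[OF lf] nev_N_eq nz_meromorphicD[OF assms(2)] nz_meromorphicD[OF assms(3)])
qed

lemma nev_T_mult_le:
  assumes "nz_meromorphic f" "nz_meromorphic g" "generic f r" "generic g r" "1 \<le> r"
  shows "nev_T r (\<lambda>z. f z * g z) \<le> nev_T r f + nev_T r g"
  using nev_m_mult_le[of r f g] nev_N_le_add[of "\<lambda>z. f z * g z" f g r] assms
  by (simp add: nev_T_def generic_continuous nz_meromorphic_mult pole_mult_mult_le)

lemma nev_T_diff_le:
  assumes "nz_meromorphic f" "nz_meromorphic g" "nz_meromorphic (\<lambda>z. f z - g z)" "generic f r" "generic g r" "1 \<le> r"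
  shows "nev_T r (\<lambda>z. f z - g z) \<le> nev_T r f + nev_T r g + ln 2"
  using nev_m_diff_le[of r f g] nev_N_le_add[of "\<lambda>z. f z - g z" f g r] assms
  by (simp add: nev_T_def generic_continuous pole_mult_diff_le)

lemma nev_T_power:
  assumes "nz_meromorphic f" "0 < r" shows "nev_T r (\<lambda>z. f z ^ n) = real n * nev_T r f"
proof -
  have "pole_mult (\<lambda>z. f z ^ n) = (\<lambda>z. n * pole_mult f z)" by (rule ext) (rule pole_mult_power[OF assms(1)])
  thus ?thesis using assms
    by (simp add: nev_T_def nev_m_power nev_N_eq nz_meromorphicD nz_meromorphic_power weighted_N_cmult
        locally_finite_pole_mult distrib_left)
qed

lemma generic_mult: "generic f r \<Longrightarrow> generic g r \<Longrightarrow> generic (\<lambda>z. f z * g z) r"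
  by (auto simp: generic_def good_point_def intro!: analytic_intros)

lemma generic_power: "generic f r \<Longrightarrow> generic (\<lambda>z. f z ^ n) r"
  by (auto simp: generic_def good_point_def intro!: analytic_intros)

lemma generic_prod:
  "finite A \<Longrightarrow> 0 < r \<Longrightarrow> (\<And>a. a \<in> A \<Longrightarrow> generic (g a) r) \<Longrightarrow> generic (\<lambda>z. \<Prod>a\<in>A. g a z ^ k a) r"
proof (induction A rule: finite_induct)
  case empty
  thus ?case by (simp add: generic_def good_point_def)
qed (simp add: generic_mult generic_power)

lemma nev_T_prod_le:
  assumes "finite A" "\<And>a. a \<in> A \<Longrightarrow> nz_meromorphic (g a)" "\<And>a. a \<in> A \<Longrightarrow> generic (g a) r" "1 \<le> r"
  shows "nev_T r (\<lambda>z. \<Prod>a\<in>A. g a z ^ k a) \<le> (\<Sum>a\<in>A. real (k a) * nev_T r (g a))"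
  using assms
proof (induction A)
  case empty
  have "pole_mult (\<lambda>z. 1) = (\<lambda>z. 0)" by (rule ext) (simp add: pole_mult_nz)
  hence "nev_N r (\<lambda>z. 1) = 0" using empty by (simp add: nev_N_eq[OF meromorphic_on_const] weighted_N_def)
  thus ?case by (simp add: nev_T_def log_plus_def)
next
  case (insert b A)
  have "nev_T r (\<lambda>z. \<Prod>a\<in>insert b A. g a z ^ k a) = nev_T r (\<lambda>z. g b z ^ k b * (\<Prod>a\<in>A. g a z ^ k a))"
    using insert.hyps by simp
  also have "\<dots> \<le> nev_T r (\<lambda>z. g b z ^ k b) + nev_T r (\<lambda>z. \<Prod>a\<in>A. g a z ^ k a)"
    using insert.prems insert.hyps
    by (intro nev_T_mult_le nz_meromorphic_power nz_meromorphic_prod generic_power generic_prod) auto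
  also have "\<dots> \<le> real (k b) * nev_T r (g b) + (\<Sum>a\<in>A. real (k a) * nev_T r (g a))"
    using insert by (intro add_mono) (auto simp: nev_T_power)
  finally show ?case using insert.hyps by simp
qed

lemma eventually_nev_T_cong:
  assumes f: "nz_meromorphic f" and g: "nz_meromorphic g" and eq: "eventually (\<lambda>z. f z = g z) (cosparse UNIV)"
  shows "eventually (\<lambda>r. nev_T r f = nev_T r g) nev_filter"
  using eventually_nev_circle[OF eq] eventually_at_top_imp_nev[OF eventually_gt_at_top[of 0]]
proof eventually_elim
  case (elim r)
  have "pole_mult f = pole_mult g" by (rule ext) (simp add: pole_mult_nz f g zorder_cong_cosparse[OF eq])
  thus ?case using elim by (simp add: nev_T_def nev_N_eq nz_meromorphicD[OF f] nz_meromorphicD[OF g] nev_m_cong[of r f g])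
qed

section \<open>Inequalities modulo small error terms\<close>

lemma le_exp_log_plus: "x \<le> exp (log_plus x)"
  by (simp add: log_plus_def)

lemma double_powr_le:
  assumes "0 < \<rho>" "\<rho> < \<rho>'"
  shows "eventually (\<lambda>r::real. (2 * r) powr \<rho> \<le> r powr \<rho>') at_top"
  using assms by real_asymp

lemma const_add_powr_le:
  assumes "0 < \<rho>" "\<rho> < \<rho>'"
  shows "eventually (\<lambda>r::real. c + r powr \<rho> \<le> r powr \<rho>') at_top"
  using assms by real_asymp

text \<open>T is known to be monotone only along generic radii; \<Phi>, the supremum over generic
  radii up to r, is monotone everywhere, so \<open>growth_lemma\<close> applies to it. A bound at
  one radius in each [x, 2x] suffices, as monotonicity spreads it.\<close>

lemma nev_T_growth:
  assumes g: "nz_meromorphic g" and \<rho>: "0 < \<rho>" "\<rho> < 1" and \<eta>: "0 < \<eta>"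
    and bound: "\<exists>x0. \<forall>x\<ge>x0. \<exists>t\<in>{x..2*x}. generic g t \<and> nev_T t g \<le> exp (t powr \<rho>)"
  shows "eventually (\<lambda>r. \<forall>R. generic g R \<longrightarrow> r \<le> R \<longrightarrow> R \<le> r + r powr ((1 - \<rho>) / 4) \<longrightarrow>
           nev_T R g \<le> (1 + \<eta>) * max 1 (nev_T r g)) nev_filter"
proof -
  \<comment> \<open>Slack to absorb the doubling of the radius: (2r)^\<rho> <= r^\<rho>' eventually.
    It also explains the gap, since (1 - \<rho>')/2 = (1 - \<rho>)/4.\<close>
  define \<rho>' where "\<rho>' = (1 + \<rho>) / 2"
  have \<rho>': "0 < \<rho>'" "\<rho>' < 1" "\<rho> < \<rho>'" and \<delta>: "(1 - \<rho>') / 2 = (1 - \<rho>) / 4"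
    using \<rho> by (auto simp: \<rho>'_def field_simps)
  \<comment> \<open>Inserting 1 keeps the set nonempty and its supremum at least 1, even when no
    generic radius qualifies.\<close>
  define V where "V r = insert 1 {nev_T t g | t. generic g t \<and> 1 \<le> t \<and> t \<le> r}" for r
  define \<Phi> where "\<Phi> r = Sup (V r)" for r
  have V_le: "v \<le> max 1 (nev_T R g)" if "generic g R" "r \<le> R" "v \<in> V r" for v r R
  proof -
    have "nev_T t g \<le> nev_T R g" if "generic g t" "t \<le> r" for t
      using nev_T_mono[OF g that(1) \<open>generic g R\<close>] that \<open>r \<le> R\<close> by (cases "t = R") auto
    thus ?thesis using that(3) by (fastforce simp: V_def)
  qed
  have bdd: "bdd_above (V r)" for r
  proof -
    obtain R where "max 0 r < R" "generic g R" using generic_exists[OF g, of "max 0 r" "max 0 r + 1"] by auto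
    thus ?thesis by (intro bdd_aboveI[of _ "max 1 (nev_T R g)"] V_le) auto
  qed
  have \<Phi>1: "1 \<le> \<Phi> r" for r unfolding \<Phi>_def by (rule cSup_upper[OF _ bdd]) (simp add: V_def)
  have \<Phi>_mono: "\<Phi> x \<le> \<Phi> y" if "x \<le> y" for x y
    unfolding \<Phi>_def using that by (intro cSup_subset_mono bdd) (auto simp: V_def intro: order_trans)
  have \<Phi>_le: "\<Phi> r \<le> max 1 (nev_T R g)" if "generic g R" "r \<le> R" for r R
    unfolding \<Phi>_def using V_le[OF that] by (intro cSup_least) (auto simp: V_def)
  have T_le: "nev_T R g \<le> \<Phi> r" if "generic g R" "1 \<le> R" "R \<le> r" for r R
    unfolding \<Phi>_def using that by (intro cSup_upper bdd) (auto simp: V_def)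
  have "eventually (\<lambda>r. \<Phi> r \<le> exp (r powr \<rho>')) at_top"
  proof -
    obtain x0 where x0: "\<And>x. x \<ge> x0 \<Longrightarrow> \<exists>t\<in>{x..2*x}. generic g t \<and> nev_T t g \<le> exp (t powr \<rho>)"
      using bound by blast
    show ?thesis
      using double_powr_le[OF \<rho>(1) \<rho>'(3)] eventually_ge_at_top[of "max 1 x0"]
    proof eventually_elim
      case (elim r)
      obtain t where t: "t \<in> {r..2*r}" "generic g t" "nev_T t g \<le> exp (t powr \<rho>)" using x0[of r] elim by auto
      have "\<Phi> r \<le> max 1 (nev_T t g)" using t by (intro \<Phi>_le) auto
      also have "\<dots> \<le> exp (t powr \<rho>)" using t by simp
      also have "t powr \<rho> \<le> (2 * r) powr \<rho>" using t elim \<rho> by (intro powr_mono2) auto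
      also note elim(1)
      finally show ?case by simp
    qed
  qed
  from growth_lemma[OF \<Phi>_mono \<Phi>1 this \<rho>'(1,2) \<eta>]
  have "eventually (\<lambda>r. \<Phi> (r + r powr ((1 - \<rho>) / 4)) \<le> (1 + \<eta>) * \<Phi> r) nev_filter" by (simp add: \<delta>)
  moreover note eventually_generic[OF g]
  moreover note eventually_at_top_imp_nev[OF eventually_ge_at_top[of 1]]
  ultimately show ?thesis
  proof eventually_elim
    case (elim r)
    show ?case
    proof (intro allI impI)
      fix R assume R: "generic g R" "r \<le> R" "R \<le> r + r powr ((1 - \<rho>) / 4)"
      have "nev_T R g \<le> \<Phi> (r + r powr ((1 - \<rho>) / 4))" using R elim by (intro T_le) auto
      also note elim(1)
      also have "(1 + \<eta>) * \<Phi> r \<le> (1 + \<eta>) * max 1 (nev_T r g)"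
        using \<eta> elim by (intro mult_left_mono \<Phi>_le) auto
      finally show "nev_T R g \<le> (1 + \<eta>) * max 1 (nev_T r g)" .
    qed
  qed
qed

lemma hyper_order_bound:
  assumes "hyper_order f < 1"
  obtains \<rho> where "0 < \<rho>" "\<rho> < 1" "eventually (\<lambda>r. nev_T r f \<le> exp (r powr \<rho>)) at_top"
proof -
  obtain y where y: "hyper_order f < ereal y" "ereal y < 1" using ereal_dense2[OF assms] by blast
  \<comment> \<open>The bound y for the hyper order may be nonpositive; raising it to 1/2 keeps the
    exponent in (0, 1).\<close>
  define \<rho> where "\<rho> = max y (1/2)"
  have "eventually (\<lambda>r. ereal (log_plus (log_plus (nev_T r f)) / ln r) < ereal y) at_top"
    using y(1) unfolding hyper_order_def by (rule Limsup_lessD)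
  hence "eventually (\<lambda>r. nev_T r f \<le> exp (r powr \<rho>)) at_top"
    using eventually_gt_at_top[of 1]
  proof eventually_elim
    case (elim r)
    have l: "0 < ln r" using elim by simp
    have "log_plus (log_plus (nev_T r f)) / ln r \<le> \<rho>" using elim(1) by (simp add: \<rho>_def)
    hence "log_plus (log_plus (nev_T r f)) \<le> \<rho> * ln r" using l by (simp add: divide_le_eq)
    hence "exp (log_plus (log_plus (nev_T r f))) \<le> exp (\<rho> * ln r)" by simp
    moreover have "exp (\<rho> * ln r) = r powr \<rho>" using elim(2) by (simp add: powr_def)
    ultimately have "log_plus (nev_T r f) \<le> r powr \<rho>"
      using le_exp_log_plus[of "log_plus (nev_T r f)"] by linarith
    hence "exp (log_plus (nev_T r f)) \<le> exp (r powr \<rho>)" by simp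
    thus ?case using le_exp_log_plus[of "nev_T r f"] by linarith
  qed
  moreover have "0 < \<rho>" "\<rho> < 1" using y(2) by (auto simp: \<rho>_def)
  ultimately show ?thesis using that by blast
qed

lemma pole_mult_shift: "nz_meromorphic f \<Longrightarrow> pole_mult (\<lambda>z. f (z + c)) z = pole_mult f (z + c)"
  by (simp add: pole_mult_nz nz_meromorphic_shift zorder_shift_arg)

lemma pole_ind_shift: "nz_meromorphic f \<Longrightarrow> pole_ind (\<lambda>z. f (z + c)) z = pole_ind f (z + c)"
  by (simp add: pole_ind_nz nz_meromorphic_shift zorder_shift_arg)

section \<open>Calculus of inequalities with errors o(T(r,f))\<close>

locale small_hyper_order =
  fixes f :: "complex \<Rightarrow> complex"
  assumes transcendental: "transcendental_meromorphic f" and hyper_order: "hyper_order f < 1"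
begin

text \<open>Stands for X <= Y + S(r,f). The exceptional set may depend on e, which makes the
  relation closed under sums, nonnegative multiples and chains by plain \<open>eventually\<close>
  reasoning.\<close>

definition asym_le :: "(real \<Rightarrow> real) \<Rightarrow> (real \<Rightarrow> real) \<Rightarrow> bool" (infix "\<preceq>" 50) where
  "X \<preceq> Y \<longleftrightarrow> (\<forall>e>0. eventually (\<lambda>r. X r \<le> Y r + e * nev_T r f) nev_filter)"

lemma nz: "nz_meromorphic f"
proof -
  have "\<not> eventually (\<lambda>z. f z = 0) (cosparse UNIV)"
  proof
    assume "eventually (\<lambda>z. f z = 0) (cosparse UNIV)"
    hence "rational_meromorphic f" unfolding rational_meromorphic_def
      by (intro exI[of _ 0] exI[of _ 1]) simp
    thus False using transcendental by (simp add: transcendental_meromorphic_def)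
  qed
  thus ?thesis using transcendental by (simp add: transcendental_meromorphic_def nz_meromorphic_def)
qed

lemma T_ge_ln: "eventually (\<lambda>r. K * ln r \<le> nev_T r f) nev_filter"
proof -
  obtain x0 where x0: "\<And>r. x0 \<le> r \<Longrightarrow> generic f r \<Longrightarrow> K * ln r \<le> nev_T r f"
    using transcendental_growth[OF nz, of K] transcendental by (auto simp: transcendental_meromorphic_def)
  show ?thesis using eventually_at_top_imp_nev[OF eventually_ge_at_top[of x0]] eventually_generic[OF nz]
    by eventually_elim (rule x0)
qed

lemma T_at_top: "filterlim (\<lambda>r. nev_T r f) at_top nev_filter"
proof (rule filterlim_at_top_mono)
  show "filterlim ln at_top nev_filter" by (rule filterlim_mono[OF ln_at_top order_refl nev_filter_le_at_top])
  show "eventually (\<lambda>r. ln r \<le> nev_T r f) nev_filter" using T_ge_ln[of 1] by simp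
qed

lemma eventually_T_ge: "eventually (\<lambda>r. K \<le> nev_T r f) nev_filter"
  using T_at_top by (simp add: filterlim_at_top)

lemma eventually_r_ge: "eventually (\<lambda>r. K \<le> r) nev_filter"
  by (rule eventually_at_top_imp_nev[OF eventually_ge_at_top])

lemma asym_leI: "eventually (\<lambda>r. X r \<le> Y r) nev_filter \<Longrightarrow> X \<preceq> Y"
  unfolding asym_le_def
proof (intro allI impI)
  fix e :: real assume le: "eventually (\<lambda>r. X r \<le> Y r) nev_filter" and e: "0 < e"
  show "eventually (\<lambda>r. X r \<le> Y r + e * nev_T r f) nev_filter"
    using le eventually_T_ge[of 0] by eventually_elim (use e in \<open>simp add: add_increasing2\<close>)
qed

lemma asym_le_trans [trans]:
  assumes "X \<preceq> Y" "Y \<preceq> Z" shows "X \<preceq> Z"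
  unfolding asym_le_def
proof (intro allI impI)
  fix e :: real assume "0 < e"
  hence "eventually (\<lambda>r. X r \<le> Y r + e/2 * nev_T r f) nev_filter" "eventually (\<lambda>r. Y r \<le> Z r + e/2 * nev_T r f) nev_filter"
    using assms half_gt_zero unfolding asym_le_def by blast+
  thus "eventually (\<lambda>r. X r \<le> Z r + e * nev_T r f) nev_filter" by eventually_elim (simp add: field_simps)
qed

lemma asym_le_add:
  assumes "X \<preceq> Y" "X' \<preceq> Y'" shows "(\<lambda>r. X r + X' r) \<preceq> (\<lambda>r. Y r + Y' r)"
  unfolding asym_le_def
proof (intro allI impI)
  fix e :: real assume "0 < e"
  hence "eventually (\<lambda>r. X r \<le> Y r + e/2 * nev_T r f) nev_filter" "eventually (\<lambda>r. X' r \<le> Y' r + e/2 * nev_T r f) nev_filter"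
    using assms half_gt_zero unfolding asym_le_def by blast+
  thus "eventually (\<lambda>r. X r + X' r \<le> Y r + Y' r + e * nev_T r f) nev_filter" by eventually_elim (simp add: field_simps)
qed

lemma asym_le_cmult:
  assumes "X \<preceq> Y" "0 \<le> c" shows "(\<lambda>r. c * X r) \<preceq> (\<lambda>r. c * Y r)"
proof (cases "c = 0")
  case False
  hence c: "0 < c" using assms by simp
  show ?thesis unfolding asym_le_def
  proof (intro allI impI)
    fix e :: real assume "0 < e"
    hence "eventually (\<lambda>r. X r \<le> Y r + e/c * nev_T r f) nev_filter"
      using assms(1) divide_pos_pos[OF _ c] unfolding asym_le_def by blast
    thus "eventually (\<lambda>r. c * X r \<le> c * Y r + e * nev_T r f) nev_filter"
    proof eventually_elim
      case (elim r)
      have "c * X r \<le> c * (Y r + e / c * nev_T r f)" using c elim by (intro mult_left_mono) auto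
      thus ?case using c by (simp add: distrib_left)
    qed
  qed
qed (simp add: asym_leI)

lemma asym_le_sum:
  assumes "finite A" "\<And>a. a \<in> A \<Longrightarrow> X a \<preceq> Y a"
  shows "(\<lambda>r. \<Sum>a\<in>A. X a r) \<preceq> (\<lambda>r. \<Sum>a\<in>A. Y a r)"
  using assms
proof (induction A)
  case empty
  show ?case by (simp add: asym_leI)
qed (simp add: asym_le_add)

lemma asym_le_const: "(\<lambda>_. c) \<preceq> (\<lambda>_. 0)"
  unfolding asym_le_def
proof (intro allI impI)
  fix e :: real assume e: "0 < e"
  show "eventually (\<lambda>r. c \<le> 0 + e * nev_T r f) nev_filter"
    using eventually_T_ge[of "c / e"] by eventually_elim (use e in \<open>simp add: field_simps\<close>)
qed

lemma asym_le_ln: "0 \<le> K \<Longrightarrow> (\<lambda>r. K * ln r) \<preceq> (\<lambda>_. 0)"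
  unfolding asym_le_def
proof (intro allI impI)
  fix e :: real assume e: "0 < e" "0 \<le> K"
  show "eventually (\<lambda>r. K * ln r \<le> 0 + e * nev_T r f) nev_filter"
    using T_ge_ln[of "K / e"] by eventually_elim (use e in \<open>simp add: field_simps\<close>)
qed

lemma asym_le_compose_T:
  assumes "h \<in> o(\<lambda>x. x)" shows "(\<lambda>r. h (nev_T r f)) \<preceq> (\<lambda>_. 0)"
  unfolding asym_le_def
proof (intro allI impI)
  fix e :: real assume "0 < e"
  hence "eventually (\<lambda>x. norm (h x) \<le> e * norm x) at_top" using landau_o.smallD[OF assms] by blast
  from eventually_compose_filterlim[OF this T_at_top] eventually_T_ge[of 0]
  show "eventually (\<lambda>r. h (nev_T r f) \<le> 0 + e * nev_T r f) nev_filter"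
    by eventually_elim auto
qed

text \<open>The error term is the defect itself, cut off at 0. Adding it to X makes the inequality
  true at every r, so only its size has to be estimated, and only along the filter.\<close>

lemma asym_le_imp_nev_S:
  assumes "X \<preceq> Y" shows "(\<lambda>r. min 0 (Y r - X r)) \<in> nev_S f"
  unfolding nev_S_eq_smallo
proof (rule landau_o.smallI)
  fix c :: real assume "0 < c"
  hence "eventually (\<lambda>r. X r \<le> Y r + c * nev_T r f) nev_filter" using assms by (simp add: asym_le_def)
  thus "eventually (\<lambda>r. norm (min 0 (Y r - X r)) \<le> c * norm (nev_T r f)) nev_filter"
    using eventually_T_ge[of 0]
    by eventually_elim (use \<open>0 < c\<close> in \<open>auto simp: min_def\<close>)
qed

lemma nev_S_imp_asym_le: "X \<in> nev_S f \<Longrightarrow> X \<preceq> (\<lambda>_. 0)"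
  unfolding nev_S_eq_smallo asym_le_def
proof (intro allI impI)
  fix e :: real assume "X \<in> o[nev_filter](\<lambda>r. nev_T r f)" "0 < e"
  from landau_o.smallD[OF this] eventually_T_ge[of 0]
  show "eventually (\<lambda>r. X r \<le> 0 + e * nev_T r f) nev_filter" by eventually_elim auto
qed

definition growth_exponent :: real where
  "growth_exponent = (SOME \<rho>. 0 < \<rho> \<and> \<rho> < 1 \<and> eventually (\<lambda>r. nev_T r f \<le> exp (r powr \<rho>)) at_top)"

lemma growth_exponent:
  "0 < growth_exponent" "growth_exponent < 1" "eventually (\<lambda>r. nev_T r f \<le> exp (r powr growth_exponent)) at_top"
proof -
  have "\<exists>\<rho>. 0 < \<rho> \<and> \<rho> < 1 \<and> eventually (\<lambda>r. nev_T r f \<le> exp (r powr \<rho>)) at_top"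
    using hyper_order_bound[OF hyper_order] by metis
  from someI_ex[OF this] show "0 < growth_exponent" "growth_exponent < 1"
    "eventually (\<lambda>r. nev_T r f \<le> exp (r powr growth_exponent)) at_top"
    unfolding growth_exponent_def by blast+
qed

text \<open>After \<open>weighted_N_shift_le\<close>, N(r + |c|) has to be compared with N(r). The
  growth lemma is applied to N directly, with the assumption on \<open>w\<close> and the bound for T
  supplying the growth condition; the gap eventually exceeds |c|.\<close>

lemma asym_le_weighted_N_shift:
  assumes le: "\<And>z. w z \<le> pole_mult f z"
  shows "weighted_N (\<lambda>z. w (z + c)) \<preceq> weighted_N w"
  unfolding asym_le_def
proof (intro allI impI)
  fix e :: real assume e: "0 < e"
  let ?\<rho> = "growth_exponent"
  note \<rho> = growth_exponent
  define \<rho>' where "\<rho>' = (1 + ?\<rho>) / 2"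
  have \<rho>': "0 < \<rho>'" "\<rho>' < 1" "?\<rho> < \<rho>'" using \<rho> by (auto simp: \<rho>'_def)
  have lfp: "locally_finite_weight (pole_mult f)" by (rule locally_finite_pole_mult[OF nz_meromorphicD(1)[OF nz]])
  have lf: "locally_finite_weight w" by (rule locally_finite_weight_mono[OF lfp]) (use le in \<open>fastforce simp: order_less_le_trans\<close>)
  have wT: "weighted_N w r \<le> nev_T R f" if "1 \<le> r" "r \<le> R" "generic f R" for r R
  proof -
    have "weighted_N w r \<le> weighted_N w R" using that by (intro weighted_N_mono_radius lf) auto
    also have "\<dots> \<le> weighted_N (pole_mult f) R" using that le by (intro weighted_N_mono_weight lfp) auto
    also have "\<dots> = nev_N R f" using that nz by (simp add: nev_N_eq nz_meromorphicD)
    also have "\<dots> \<le> nev_T R f" using that by (simp add: nev_T_def nev_m_nonneg generic_continuous)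
    finally show ?thesis .
  qed
  \<comment> \<open>For \<eta> <= 1 the two factors satisfy (1 + \<eta>)^2 <= 1 + 3 \<eta>, and 3
    \<eta> N <= (e/4) T. The constants and the logarithm take another e/4 each.\<close>
  define \<eta> where "\<eta> = min 1 (e / 12)"
  have \<eta>: "0 < \<eta>" "\<eta> \<le> 1" "\<eta> \<le> e / 12" using e by (auto simp: \<eta>_def)
  define \<Phi> where "\<Phi> r = max 1 (weighted_N w r)" for r
  have "eventually (\<lambda>r. \<Phi> r \<le> exp (r powr \<rho>')) at_top"
  proof -
    obtain x0 where x0: "\<And>r. x0 \<le> r \<Longrightarrow> nev_T r f \<le> exp (r powr ?\<rho>)"
      using \<rho>(3) by (auto simp: eventually_at_top_linorder)
    show ?thesis using double_powr_le[OF \<rho>(1) \<rho>'(3)] eventually_ge_at_top[of "max 1 x0"]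
    proof eventually_elim
      case (elim r)
      obtain t where t: "r < t" "t < 2 * r" "generic f t" using generic_exists[OF nz, of r "2 * r"] elim by auto
      have "weighted_N w r \<le> nev_T t f" using wT[of r t] t elim by simp
      also have "\<dots> \<le> exp (t powr ?\<rho>)" using x0[of t] t elim by simp
      also have "t powr ?\<rho> \<le> (2 * r) powr ?\<rho>" using t elim \<rho> by (intro powr_mono2) auto
      also note elim(1)
      finally have "weighted_N w r \<le> exp (r powr \<rho>')" by simp
      thus ?case by (simp add: \<Phi>_def)
    qed
  qed
  hence gr: "eventually (\<lambda>r. \<Phi> (r + r powr ((1 - \<rho>') / 2)) \<le> (1 + \<eta>) * \<Phi> r) nev_filter"
  proof (rule growth_lemma[rotated 2, OF _ \<rho>'(1,2) \<eta>(1)])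
    show "\<Phi> x \<le> \<Phi> y" if "1 \<le> x" "x \<le> y" for x y
      unfolding \<Phi>_def using that by (intro max.mono order_refl weighted_N_mono_radius lf) auto
  qed (simp add: \<Phi>_def)
  have "0 < (1 - \<rho>') / 2" using \<rho>' by simp
  hence "eventually (\<lambda>r. cmod c \<le> r powr ((1 - \<rho>') / 2)) at_top" by real_asymp
  hence c: "eventually (\<lambda>r. cmod c \<le> r powr ((1 - \<rho>') / 2)) nev_filter" by (rule eventually_at_top_imp_nev)
  obtain K where K: "0 \<le> K" "\<And>r. 1 \<le> r \<Longrightarrow> weighted_N (\<lambda>z. w (z + c)) r \<le> (1 + \<eta>) * weighted_N w (r + cmod c) + K * (1 + ln r)"
    using weighted_N_shift_le[OF lf \<eta>(1), of c] by blast
  have s: "eventually (\<lambda>r. K * ln r \<le> e/4 * nev_T r f) nev_filter"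
    using asym_le_ln[OF K(1)] e unfolding asym_le_def by (auto dest: spec[of _ "e/4"])
  show "eventually (\<lambda>r. weighted_N (\<lambda>z. w (z + c)) r \<le> weighted_N w r + e * nev_T r f) nev_filter"
    using gr c s eventually_r_ge[of 1] eventually_generic[OF nz] eventually_T_ge[of "(4 + K) / (e / 4)"]
  proof eventually_elim
    case (elim r)
    have N0: "0 \<le> weighted_N w r" using elim by (intro weighted_N_nonneg)
    have NT: "weighted_N w r \<le> nev_T r f" using elim by (intro wT) auto
    have "weighted_N w (r + cmod c) \<le> \<Phi> (r + r powr ((1 - \<rho>') / 2))"
      using weighted_N_mono_radius[OF lf, of "r + cmod c" "r + r powr ((1 - \<rho>') / 2)"] elim(2,4) norm_ge_zero[of c]
      by (simp add: \<Phi>_def)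
    also have "\<dots> \<le> (1 + \<eta>) * \<Phi> r" by (rule elim(1))
    also have "\<dots> \<le> (1 + \<eta>) * (1 + weighted_N w r)" using N0 \<eta> by (intro mult_left_mono) (auto simp: \<Phi>_def)
    finally have "(1 + \<eta>) * weighted_N w (r + cmod c) \<le> (1 + \<eta>) * ((1 + \<eta>) * (1 + weighted_N w r))"
      using \<eta> by (intro mult_left_mono) auto
    also have "\<dots> = (1 + \<eta>) * (1 + \<eta>) * (1 + weighted_N w r)" by simp
    also have "\<dots> \<le> (1 + 3 * \<eta>) * (1 + weighted_N w r)"
      using N0 \<eta> mult_left_mono[of \<eta> 1 \<eta>] by (intro mult_right_mono) (auto simp: algebra_simps)
    also have "\<dots> = 1 + 3 * \<eta> + weighted_N w r + 3 * \<eta> * weighted_N w r" by (simp add: algebra_simps)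
    also have "\<dots> \<le> 4 + weighted_N w r + e / 4 * nev_T r f"
    proof -
      have "3 * \<eta> * weighted_N w r \<le> e / 4 * nev_T r f" using \<eta> N0 NT by (intro mult_mono) auto
      thus ?thesis using \<eta> by linarith
    qed
    finally have "weighted_N (\<lambda>z. w (z + c)) r \<le> 4 + weighted_N w r + e / 4 * nev_T r f + (K + K * ln r)"
      using K(2)[OF elim(4)] by (simp add: algebra_simps)
    moreover have "4 + K \<le> e / 4 * nev_T r f" using elim(6) e by (simp add: field_simps)
    moreover have "0 \<le> e / 4 * nev_T r f" using NT N0 e by simp
    ultimately show ?case using elim(3) by (simp add: field_simps)
  qed
qed

lemma eventually_shift_generic: "eventually (generic (\<lambda>z. f (z + c))) nev_filter"
  by (rule eventually_generic[OF nz_meromorphic_shift[OF nz]])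

text \<open>Within the gap r^\<delta> the characteristic at most doubles, so the difference estimate
  is at most 3K T(r,f) r^(-\<delta>/2), and the power of r makes it o(T).\<close>

lemma asym_le_difference:
  "(\<lambda>r. circle_mean r (\<lambda>z. \<bar>ln (cmod (f (z + c))) - ln (cmod (f z))\<bar>)) \<preceq> (\<lambda>_. 0)"
  unfolding asym_le_def
proof (intro allI impI)
  fix e :: real assume e: "0 < e"
  let ?\<rho> = "growth_exponent"
  note \<rho> = growth_exponent
  define \<delta> where "\<delta> = (1 - ?\<rho>) / 4"
  have \<delta>: "0 < \<delta>" "\<delta> < 1" using \<rho> by (auto simp: \<delta>_def)
  obtain x0 where x0: "\<And>r. x0 \<le> r \<Longrightarrow> nev_T r f \<le> exp (r powr ?\<rho>)"
    using \<rho>(3) by (auto simp: eventually_at_top_linorder)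
  have "\<exists>x0. \<forall>x\<ge>x0. \<exists>t\<in>{x..2*x}. generic f t \<and> nev_T t f \<le> exp (t powr ?\<rho>)"
  proof (intro exI[of _ "max 1 x0"] allI impI)
    fix x assume x: "max 1 x0 \<le> x"
    obtain t where "x < t" "t < 2 * x" "generic f t" using generic_exists[OF nz, of x "2 * x"] x by auto
    thus "\<exists>t\<in>{x..2*x}. generic f t \<and> nev_T t f \<le> exp (t powr ?\<rho>)" using x0[of t] x by (intro bexI[of _ t]) auto
  qed
  from nev_T_growth[OF nz \<rho>(1,2) _ this, of 1]
  have gr: "eventually (\<lambda>r. \<forall>R. generic f R \<longrightarrow> r \<le> R \<longrightarrow> R \<le> r + r powr \<delta> \<longrightarrow> nev_T R f \<le> 2 * max 1 (nev_T r f)) nev_filter"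
    by (simp add: \<delta>_def)
  obtain K r0 where K: "0 \<le> K" and diff: "\<And>r R2. r0 \<le> r \<Longrightarrow> r + r powr \<delta> / 2 \<le> R2 \<Longrightarrow> R2 \<le> r + r powr \<delta> \<Longrightarrow>
      generic f r \<Longrightarrow> generic (\<lambda>z. f (z + c)) r \<Longrightarrow> generic f R2 \<Longrightarrow>
      circle_mean r (\<lambda>z. \<bar>ln (cmod (f (z + c))) - ln (cmod (f z))\<bar>) \<le> K * (nev_T R2 f + 1) * r powr - (\<delta> / 2)"
    using difference_estimate[OF nz \<delta>, of c] by blast
  have "((\<lambda>r. K * 3 * r powr - (\<delta> / 2)) \<longlongrightarrow> K * 3 * 0) at_top"
  proof (intro tendsto_intros)
    show "((\<lambda>r. r powr - (\<delta> / 2)) \<longlongrightarrow> 0) at_top" using \<delta> by real_asymp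
  qed
  hence "eventually (\<lambda>r. K * 3 * r powr - (\<delta> / 2) < e) at_top" using e by (auto simp: order_tendsto_iff)
  hence "eventually (\<lambda>r. K * 3 * r powr - (\<delta> / 2) < e) nev_filter" by (rule eventually_at_top_imp_nev)
  thus "eventually (\<lambda>r. circle_mean r (\<lambda>z. \<bar>ln (cmod (f (z + c))) - ln (cmod (f z))\<bar>) \<le> 0 + e * nev_T r f) nev_filter"
    using gr eventually_r_ge[of "max 1 r0"] eventually_generic[OF nz] eventually_shift_generic[of c] eventually_T_ge[of 1]
  proof eventually_elim
    case (elim r)
    have "0 < r powr \<delta>" using elim by simp
    then obtain R2 where R2: "r + r powr \<delta> / 2 < R2" "R2 < r + r powr \<delta>" "generic f R2"
      using generic_exists[OF nz, of "r + r powr \<delta> / 2" "r + r powr \<delta>"] elim by auto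
    have "nev_T R2 f \<le> 2 * nev_T r f"
      using elim(2)[rule_format, OF R2(3)] R2 elim \<open>0 < r powr \<delta>\<close> by simp
    hence "K * (nev_T R2 f + 1) * r powr - (\<delta> / 2) \<le> K * (3 * nev_T r f) * r powr - (\<delta> / 2)"
      using K elim by (intro mult_right_mono mult_left_mono) auto
    also have "\<dots> = K * 3 * r powr - (\<delta> / 2) * nev_T r f" by simp
    also have "\<dots> \<le> e * nev_T r f" using elim by (intro mult_right_mono) auto
    finally show ?case using diff[of r R2] R2 elim by simp
  qed
qed

lemma asym_le_m_quotient: "(\<lambda>r. nev_m r (\<lambda>z. f (z + c) / f z)) \<preceq> (\<lambda>_. 0)"
proof (rule asym_le_trans[OF asym_leI asym_le_difference[of c]])
  show "eventually (\<lambda>r. nev_m r (\<lambda>z. f (z + c) / f z) \<le> circle_mean r (\<lambda>z. \<bar>ln (cmod (f (z + c))) - ln (cmod (f z))\<bar>)) nev_filter"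
    using eventually_generic[OF nz] eventually_shift_generic[of c]
  proof eventually_elim
    case (elim r)
    note c = generic_continuous[OF elim(1)] generic_continuous[OF elim(2)]
    note n = generic_nonzero[OF elim(1)] generic_nonzero[OF elim(2)]
    show ?case unfolding nev_m_eq
    proof (rule circle_mean_mono)
      show "continuous_on (sphere 0 r) (\<lambda>z. log_plus (cmod (f (z + c) / f z)))"
        using c n by (intro continuous_intros) auto
      show "continuous_on (sphere 0 r) (\<lambda>z. \<bar>ln (cmod (f (z + c))) - ln (cmod (f z))\<bar>)"
        using c n by (intro continuous_intros) auto
      show "log_plus (cmod (f (z + c) / f z)) \<le> \<bar>ln (cmod (f (z + c))) - ln (cmod (f z))\<bar>" if "cmod z = r" for z
        using n[OF that] by (simp add: log_plus_eq norm_divide ln_div)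
    qed (use generic_pos[OF elim(1)] in simp)
  qed
qed

text \<open>The proximity function passes through the quotient f(z + c) / f(z), the counting
  function through the shift of weights.\<close>

lemma asym_le_T_shift: "(\<lambda>r. nev_T r (\<lambda>z. f (z + c))) \<preceq> (\<lambda>r. nev_T r f)"
proof -
  have pm: "pole_mult (\<lambda>z. f (z + c)) = (\<lambda>z. pole_mult f (z + c))"
    by (rule ext) (rule pole_mult_shift[OF nz])
  have "(\<lambda>r. nev_T r (\<lambda>z. f (z + c))) \<preceq> (\<lambda>r. (nev_m r f + nev_m r (\<lambda>z. f (z + c) / f z)) + weighted_N (\<lambda>z. pole_mult f (z + c)) r)"
  proof (rule asym_leI)
    show "eventually (\<lambda>r. nev_T r (\<lambda>z. f (z + c)) \<le> (nev_m r f + nev_m r (\<lambda>z. f (z + c) / f z)) + weighted_N (\<lambda>z. pole_mult f (z + c)) r) nev_filter"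
      using eventually_generic[OF nz] eventually_shift_generic[of c]
    proof eventually_elim
      case (elim r)
      have r: "0 < r" using generic_pos[OF elim(1)] .
      note c = generic_continuous[OF elim(1)] generic_continuous[OF elim(2)] and n = generic_nonzero[OF elim(1)]
      have "nev_m r (\<lambda>z. f (z + c)) = nev_m r (\<lambda>z. f z * (f (z + c) / f z))"
        using r n by (intro nev_m_cong) auto
      also have "\<dots> \<le> nev_m r f + nev_m r (\<lambda>z. f (z + c) / f z)"
        using r c n by (intro nev_m_mult_le continuous_on_divide) auto
      finally show ?case
        using r pm by (simp add: nev_T_def nev_N_eq nz_meromorphicD[OF nz_meromorphic_shift[OF nz]])
    qed
  qed
  also have "\<dots> \<preceq> (\<lambda>r. (nev_m r f + 0) + weighted_N (pole_mult f) r)"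
    by (intro asym_le_add asym_le_m_quotient asym_le_weighted_N_shift asym_leI) auto
  also have "\<dots> \<preceq> (\<lambda>r. nev_T r f)"
    using eventually_r_ge[of 1]
    by (intro asym_leI) (auto elim!: eventually_mono simp: nev_T_def nev_N_eq nz_meromorphicD[OF nz])
  finally show ?thesis .
qed

text \<open>The hypothesis bounds T(r,g) only off an exceptional set, which still leaves a good
  radius in every [x, 2x], and that is all \<open>nev_T_growth\<close> asks for. The estimate then
  involves only ln r and ln T(r,f), both o(T(r,f)).\<close>

lemma asym_le_log_derivative:
  assumes g: "nz_meromorphic g" and Tg: "eventually (\<lambda>r. nev_T r g \<le> K * nev_T r f) nev_filter"
  shows "(\<lambda>r. nev_m r (\<lambda>z. deriv g z / g z)) \<preceq> (\<lambda>_. 0)"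
proof -
  let ?\<rho> = "growth_exponent"
  note \<rho> = growth_exponent
  define \<rho>' where "\<rho>' = (1 + ?\<rho>) / 2"
  have \<rho>': "0 < \<rho>'" "\<rho>' < 1" "0 < \<rho>' - ?\<rho>" using \<rho> by (auto simp: \<rho>'_def)
  \<comment> \<open>Replacing K by something at least 1 gives a nonnegative ln K' and keeps the
    argument of the final logarithm at least 2.\<close>
  define K' where "K' = max 1 K"
  have K': "1 \<le> K'" by (simp add: K'_def)
  have TgK: "eventually (\<lambda>r. nev_T r g \<le> K' * nev_T r f) nev_filter"
    using Tg eventually_T_ge[of 0]
    by eventually_elim (erule order_trans, rule mult_right_mono, auto simp: K'_def)
  have "eventually (\<lambda>r. K' * exp (r powr ?\<rho>) \<le> exp (r powr \<rho>')) at_top"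
  proof -
    have "eventually (\<lambda>r::real. ln K' + r powr ?\<rho> \<le> r powr \<rho>') at_top"
      using \<rho> \<rho>' by (intro const_add_powr_le) auto
    thus ?thesis
    proof eventually_elim
      case (elim r)
      have "exp (ln K' + r powr ?\<rho>) \<le> exp (r powr \<rho>')" using elim by simp
      thus ?case using K' by (simp add: exp_add)
    qed
  qed
  from eventually_at_top_imp_nev[OF this] eventually_at_top_imp_nev[OF \<rho>(3)] TgK eventually_generic[OF g]
  have "eventually (\<lambda>t. generic g t \<and> nev_T t g \<le> exp (t powr \<rho>')) nev_filter"
  proof eventually_elim
    case (elim r)
    have "K' * nev_T r f \<le> K' * exp (r powr ?\<rho>)" using K' elim by (intro mult_left_mono) auto
    thus ?case using elim by linarith
  qed
  from eventually_nev_dyadic[OF this]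
  have "\<exists>x0. \<forall>x\<ge>x0. \<exists>t\<in>{x..2*x}. generic g t \<and> nev_T t g \<le> exp (t powr \<rho>')" by blast
  from nev_T_growth[OF g \<rho>'(1,2) _ this, of 1]
  have gr: "eventually (\<lambda>r. \<forall>R. generic g R \<longrightarrow> r \<le> R \<longrightarrow> R \<le> r + r powr ((1 - \<rho>') / 4) \<longrightarrow> nev_T R g \<le> 2 * max 1 (nev_T r g)) nev_filter"
    by simp
  obtain C where C: "0 \<le> C" and ld: "\<And>r R2. 1 \<le> r \<Longrightarrow> r + 1 \<le> R2 \<Longrightarrow> generic g r \<Longrightarrow> generic g R2 \<Longrightarrow>
      nev_m r (\<lambda>z. deriv g z / g z) \<le> C * (1 + ln R2 + log_plus (nev_T R2 g))"
    using log_derivative_estimate[OF g] by blast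
  have "(\<lambda>r. nev_m r (\<lambda>z. deriv g z / g z)) \<preceq> (\<lambda>r. C * (3 + 1 * ln r + ln (2 + 2 * K' * nev_T r f)))"
  proof (rule asym_leI)
    have pw: "eventually (\<lambda>r::real. 1 < r powr ((1 - \<rho>') / 4)) nev_filter"
    proof (rule eventually_at_top_imp_nev)
      have "0 < (1 - \<rho>') / 4" using \<rho>' by simp
      thus "eventually (\<lambda>r::real. 1 < r powr ((1 - \<rho>') / 4)) at_top" by real_asymp
    qed
    show "eventually (\<lambda>r. nev_m r (\<lambda>z. deriv g z / g z) \<le> C * (3 + 1 * ln r + ln (2 + 2 * K' * nev_T r f))) nev_filter"
      using gr TgK pw eventually_r_ge[of 1] eventually_generic[OF g] eventually_T_ge[of 0]
    proof eventually_elim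
      case (elim r)
      have "r powr ((1 - \<rho>') / 4) \<le> r powr 1" using elim \<rho>' by (intro powr_mono) auto
      hence pr: "r powr ((1 - \<rho>') / 4) \<le> r" using elim by simp
      obtain R2 where R2: "r + 1 < R2" "R2 < r + r powr ((1 - \<rho>') / 4)" "generic g R2"
        using generic_exists[OF g, of "r + 1" "r + r powr ((1 - \<rho>') / 4)"] elim by auto
      have KT: "0 \<le> K' * nev_T r f" using K' elim by simp
      have "nev_T R2 g \<le> 2 * max 1 (nev_T r g)" using elim(1)[rule_format, OF R2(3)] R2 by simp
      also have "\<dots> \<le> 2 * (1 + K' * nev_T r f)" using elim(2) KT by (intro mult_left_mono) auto
      finally have "nev_T R2 g \<le> 2 + 2 * K' * nev_T r f" by simp
      hence "log_plus (nev_T R2 g) \<le> log_plus (2 + 2 * K' * nev_T r f)" by (rule log_plus_mono)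
      also have "\<dots> = ln (2 + 2 * K' * nev_T r f)" using KT by (simp add: log_plus_def max_def mult.assoc)
      finally have 1: "log_plus (nev_T R2 g) \<le> ln (2 + 2 * K' * nev_T r f)" .
      have "ln R2 \<le> ln (2 * r)" using R2 pr elim by (intro ln_mono) auto
      also have "\<dots> = ln 2 + ln r" using elim by (simp add: ln_mult)
      also have "ln 2 \<le> (2::real)" using ln_le_minus_one[of 2] by simp
      finally have 2: "ln R2 \<le> 2 + ln r" by simp
      have "C * (1 + ln R2 + log_plus (nev_T R2 g)) \<le> C * (3 + 1 * ln r + ln (2 + 2 * K' * nev_T r f))"
        using C 1 2 by (intro mult_left_mono) auto
      thus ?case using ld[of r R2] R2 elim by simp
    qed
  qed
  also have "\<dots> \<preceq> (\<lambda>r. C * (0 + 0 + 0))"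
  proof (intro asym_le_cmult asym_le_add asym_le_const asym_le_ln C)
    have "(\<lambda>x. ln (2 + 2 * K' * x)) \<in> o(\<lambda>x. x)" using K' by real_asymp
    thus "(\<lambda>r. ln (2 + 2 * K' * nev_T r f)) \<preceq> (\<lambda>_. 0)" by (rule asym_le_compose_T)
  qed simp
  finally show ?thesis by simp
qed

end

section \<open>The value distribution of the difference product\<close>

locale shift_monomial_value = small_hyper_order f for f +
  fixes s :: "complex \<Rightarrow> complex" and m n :: nat and c :: "nat \<Rightarrow> complex" and i :: "nat \<Rightarrow> nat"
  assumes small_s: "small_function f s" and s_not_zero: "\<not> eventually (\<lambda>z. s z = 0) (cosparse UNIV)"
    and m: "1 \<le> m" and i_pos: "\<And>k. k \<in> {1..m} \<Longrightarrow> 0 < i k" and n_gt: "shift_monomial_degree m i < n"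
begin

abbreviation "d \<equiv> shift_monomial_degree m i"
abbreviation "g \<equiv> \<lambda>k z. f (z + c k)"
abbreviation "F \<equiv> shift_monomial m c i f"

definition \<phi> :: "complex \<Rightarrow> complex" where "\<phi> z = f z ^ n * F z - s z"
definition P :: "complex \<Rightarrow> complex" where "P z = s z * (deriv \<phi> z / \<phi> z - deriv s z / s z)"
definition Q :: "complex \<Rightarrow> complex" where "Q z = P z / f z ^ (n - 1)"

lemma F_eq: "F = (\<lambda>z. \<Prod>k\<in>{1..m}. g k z ^ i k)"
  by (rule ext) (simp add: shift_monomial_def)

lemma d_pos: "1 \<le> d"
proof -
  have "1 \<le> i 1" using i_pos[of 1] m by simp
  also have "\<dots> \<le> d" unfolding shift_monomial_degree_def using m by (intro member_le_sum) auto
  finally show ?thesis .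
qed

lemma n_ge: "2 \<le> n" using d_pos n_gt by simp

lemma s_nz: "nz_meromorphic s"
  using small_s s_not_zero by (simp add: small_function_def nz_meromorphic_def)

lemma g_nz: "nz_meromorphic (g k)" by (rule nz_meromorphic_shift[OF nz])

lemma F_nz: "nz_meromorphic F"
  unfolding F_eq by (intro nz_meromorphic_prod nz_meromorphic_power g_nz) auto

lemma asym_le_T_s: "(\<lambda>r. nev_T r s) \<preceq> (\<lambda>_. 0)"
  using small_s by (intro nev_S_imp_asym_le) (simp add: small_function_def)

lemma T_F_le: "eventually (\<lambda>r. nev_T r F \<le> (\<Sum>k\<in>{1..m}. real (i k) * nev_T r (g k))) nev_filter"
proof -
  have "eventually (\<lambda>r. \<forall>k\<in>{1..m}. generic (g k) r) nev_filter"
    by (intro eventually_ball_finite ballI eventually_generic g_nz) simp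
  thus ?thesis using eventually_r_ge[of 1]
    unfolding F_eq by eventually_elim (intro nev_T_prod_le g_nz, auto)
qed

lemma asym_le_T_F: "(\<lambda>r. nev_T r F) \<preceq> (\<lambda>r. real d * nev_T r f)"
proof -
  have "(\<lambda>r. nev_T r F) \<preceq> (\<lambda>r. \<Sum>k\<in>{1..m}. real (i k) * nev_T r (g k))" by (rule asym_leI[OF T_F_le])
  also have "\<dots> \<preceq> (\<lambda>r. \<Sum>k\<in>{1..m}. real (i k) * nev_T r f)"
    by (intro asym_le_sum asym_le_cmult asym_le_T_shift) auto
  also have "\<dots> = (\<lambda>r. real d * nev_T r f)"
    by (simp add: shift_monomial_degree_def sum_distrib_right)
  finally show ?thesis .
qed

lemma asym_le_T_inverse_F: "(\<lambda>r. nev_T r (\<lambda>z. 1 / F z)) \<preceq> (\<lambda>r. real d * nev_T r f)"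
proof -
  obtain C where C: "\<And>r. generic F r \<Longrightarrow> nev_T r F = nev_T r (\<lambda>z. 1 / F z) + C"
    using first_main_theorem[OF F_nz] by blast
  have "(\<lambda>r. nev_T r (\<lambda>z. 1 / F z)) \<preceq> (\<lambda>r. nev_T r F + - C)"
    using eventually_generic[OF F_nz] by (intro asym_leI) (auto elim!: eventually_mono simp: C)
  also have "\<dots> \<preceq> (\<lambda>r. real d * nev_T r f + 0)" by (intro asym_le_add asym_le_T_F asym_le_const)
  finally show ?thesis by simp
qed

text \<open>Otherwise f^n = C s / F off a sparse set. Comparing characteristics gives n T(r,f) <=
  d_F T(r,f) + o(T(r,f)), against n >= d_F + 1.\<close>

lemma not_proportional_small: "\<not> eventually (\<lambda>z. f z ^ n * F z = C * s z) (cosparse UNIV)"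
proof
  assume eq: "eventually (\<lambda>z. f z ^ n * F z = C * s z) (cosparse UNIV)"
  have C0: "C \<noteq> 0"
  proof
    assume "C = 0"
    hence "eventually (\<lambda>z. f z ^ n * F z = 0) (cosparse UNIV)" using eq by simp
    thus False using nz_meromorphic_mult[OF nz_meromorphic_power[OF nz] F_nz, of n] by (simp add: nz_meromorphic_def)
  qed
  have fn: "nz_meromorphic (\<lambda>z. f z ^ n)" and Fi: "nz_meromorphic (\<lambda>z. 1 / F z)" and Cz: "nz_meromorphic (\<lambda>_. C)"
    using C0 by (auto intro: nz_meromorphic_power nz nz_meromorphic_inverse F_nz)
  have Cs: "nz_meromorphic (\<lambda>z. C * s z)" by (rule nz_meromorphic_mult[OF Cz s_nz])
  have "eventually (\<lambda>z. f z ^ n = C * s z * (1 / F z)) (cosparse UNIV)"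
    using eq nz_meromorphicD(3)[OF F_nz] by eventually_elim (simp add: field_simps)
  hence T_eq: "eventually (\<lambda>r. nev_T r (\<lambda>z. f z ^ n) = nev_T r (\<lambda>z. C * s z * (1 / F z))) nev_filter"
    by (rule eventually_nev_T_cong[OF fn nz_meromorphic_mult[OF Cs Fi]])
  have "(\<lambda>r. real n * nev_T r f) \<preceq> (\<lambda>r. (log_plus (cmod C) + nev_T r s) + nev_T r (\<lambda>z. 1 / F z))"
  proof (rule asym_leI)
    show "eventually (\<lambda>r. real n * nev_T r f \<le> (log_plus (cmod C) + nev_T r s) + nev_T r (\<lambda>z. 1 / F z)) nev_filter"
      using T_eq eventually_generic[OF s_nz] eventually_generic[OF F_nz] eventually_r_ge[of 1]
    proof eventually_elim
      case (elim r)
      have gC: "generic (\<lambda>_. C) r" using C0 elim by (simp add: generic_def good_point_def)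
      have "pole_mult (\<lambda>_. C) = (\<lambda>_. 0)" by (rule ext) (simp add: pole_mult_nz Cz C0)
      hence TC: "nev_T r (\<lambda>_. C) = log_plus (cmod C)"
        using elim by (simp add: nev_T_def nev_N_eq[OF meromorphic_on_const] weighted_N_def)
      have "real n * nev_T r f = nev_T r (\<lambda>z. C * s z * (1 / F z))" using elim by (simp add: nev_T_power nz)
      also have "\<dots> \<le> nev_T r (\<lambda>z. C * s z) + nev_T r (\<lambda>z. 1 / F z)"
        using elim by (intro nev_T_mult_le Cs Fi generic_mult gC generic_inverse)
      also have "nev_T r (\<lambda>z. C * s z) \<le> nev_T r (\<lambda>_. C) + nev_T r s"
        using elim by (intro nev_T_mult_le Cz s_nz gC)
      finally show ?case by (simp add: TC)
    qed
  qed
  also have "\<dots> \<preceq> (\<lambda>r. (0 + 0) + real d * nev_T r f)"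
    by (intro asym_le_add asym_le_const asym_le_T_s asym_le_T_inverse_F)
  \<comment> \<open>Any error coefficient below 1 would do, because n exceeds d_F by at least
    1.\<close>
  finally have "eventually (\<lambda>r. real n * nev_T r f \<le> (0 + 0) + real d * nev_T r f + 1/2 * nev_T r f) nev_filter"
    unfolding asym_le_def by (auto dest: spec[of _ "1/2"])
  hence "eventually (\<lambda>r. False) nev_filter" using eventually_T_ge[of 1]
  proof eventually_elim
    case (elim r)
    have "(real d + 1) * nev_T r f \<le> real n * nev_T r f" using n_gt elim by (intro mult_right_mono) auto
    thus False using elim by (simp add: algebra_simps)
  qed
  thus False using nev_filter_neq_bot by (simp add: trivial_limit_def)
qed

lemma \<phi>_nz: "nz_meromorphic \<phi>"
proof -
  have "\<phi> meromorphic_on UNIV"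
    unfolding \<phi>_def[abs_def] by (intro meromorphic_intros nz_meromorphicD nz F_nz s_nz)
  moreover have "\<not> eventually (\<lambda>z. \<phi> z = 0) (cosparse UNIV)"
    using not_proportional_small[of 1] by (simp add: \<phi>_def)
  ultimately show ?thesis by (simp add: nz_meromorphic_def)
qed

lemma P_nz: "nz_meromorphic P"
proof -
  have mero: "P meromorphic_on UNIV"
    unfolding P_def[abs_def] by (intro meromorphic_intros nz_meromorphicD \<phi>_nz s_nz)
  have "\<not> eventually (\<lambda>z. P z = 0) (cosparse UNIV)"
  proof
    assume "eventually (\<lambda>z. P z = 0) (cosparse UNIV)"
    hence "eventually (\<lambda>z. deriv \<phi> z / \<phi> z = deriv s z / s z) (cosparse UNIV)"
      using nz_meromorphicD(3)[OF s_nz] by eventually_elim (simp add: P_def)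
    then obtain C where "eventually (\<lambda>z. \<phi> z = C * s z) (cosparse UNIV)"
      using logderiv_eq_imp_proportional[OF \<phi>_nz s_nz] by blast
    hence "eventually (\<lambda>z. f z ^ n * F z = (C + 1) * s z) (cosparse UNIV)"
      by eventually_elim (simp add: \<phi>_def algebra_simps)
    thus False using not_proportional_small by blast
  qed
  thus ?thesis using mero by (simp add: nz_meromorphic_def)
qed

lemma Q_nz: "nz_meromorphic Q"
  unfolding Q_def[abs_def] by (intro nz_meromorphic_divide P_nz nz_meromorphic_power nz)

text \<open>Multiplied out, the expression for Q divides by neither f nor F, so its regularity can
  be read off even at their zeros. In the definition of Q such zeros look like poles of high
  order.\<close>

lemma Q_identity:
  assumes "good_point f w" "good_point F w" "good_point \<phi> w" "good_point s w"
  shows "Q w = f w * F w * (deriv \<phi> w / \<phi> w) - (of_nat n * deriv f w * F w + f w * deriv F w)"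
proof -
  have D: "(h has_field_derivative deriv h w) (at w)" if "good_point h w" for h
    using that analytic_on_imp_differentiable_at[of h "{w}" w] by (simp add: good_point_def field_differentiable_derivI)
  have fn: "((\<lambda>z. f z ^ n) has_field_derivative of_nat n * f w ^ (n - 1) * deriv f w) (at w)"
    using DERIV_power[OF D[OF assms(1)], of n] by (simp add: mult_ac)
  have "(\<phi> has_field_derivative (of_nat n * f w ^ (n - 1) * deriv f w * F w + deriv F w * f w ^ n) - deriv s w) (at w)"
    unfolding \<phi>_def[abs_def] by (intro DERIV_diff DERIV_mult fn D assms)
  hence d\<phi>: "deriv \<phi> w = (of_nat n * f w ^ (n - 1) * deriv f w * F w + deriv F w * f w ^ n) - deriv s w"
    by (rule DERIV_imp_deriv)
  have nz_w: "f w \<noteq> 0" "s w \<noteq> 0" "\<phi> w \<noteq> 0" using assms by (auto simp: good_point_def)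
  have "P w = s w * (deriv \<phi> w / \<phi> w) - deriv s w" using nz_w by (simp add: P_def right_diff_distrib)
  also have "s w = f w ^ n * F w - \<phi> w" by (simp add: \<phi>_def)
  also have "(f w ^ n * F w - \<phi> w) * (deriv \<phi> w / \<phi> w) = f w ^ n * F w * (deriv \<phi> w / \<phi> w) - deriv \<phi> w"
    using nz_w by (simp add: left_diff_distrib diff_divide_distrib)
  finally have "P w = f w ^ n * F w * (deriv \<phi> w / \<phi> w) - (of_nat n * f w ^ (n - 1) * deriv f w * F w + deriv F w * f w ^ n)"
    by (simp add: d\<phi>)
  moreover have "f w ^ n = f w ^ (n - 1) * f w" using n_ge by (metis One_nat_def Suc_pred' mult.commute not_numeral_le_zero power_Suc zero_less_iff_neq_zero)
  ultimately have "P w = f w ^ (n - 1) * (f w * F w * (deriv \<phi> w / \<phi> w) - (of_nat n * deriv f w * F w + f w * deriv F w))"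
    by (simp add: algebra_simps)
  thus ?thesis using nz_w by (simp add: Q_def)
qed

section \<open>Local orders of \<open>\<phi>\<close>, \<open>P\<close> and \<open>Q\<close>\<close>

lemma zorder_F: "zorder F z = (\<Sum>k\<in>{1..m}. int (i k) * zorder (g k) z)"
  unfolding F_eq by (subst nz_zorder_prod) (auto intro!: nz_meromorphic_power g_nz sum.cong nz_zorder_power)

lemma zorder_\<phi>_ge: "min (int n * zorder f z + zorder F z) (zorder s z) \<le> zorder \<phi> z"
proof -
  have "order_ge (\<lambda>z. f z ^ n * F z) z (int n * zorder f z + zorder F z)"
    by (subst order_ge_iff_zorder) (auto intro!: nz_meromorphic_mult nz_meromorphic_power nz F_nz
        simp: nz_zorder_mult nz_meromorphic_power nz F_nz nz_zorder_power)
  moreover have "order_ge s z (zorder s z)" by (simp add: order_ge_iff_zorder s_nz)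
  ultimately have "order_ge \<phi> z (min (int n * zorder f z + zorder F z) (zorder s z))"
    unfolding \<phi>_def[abs_def] by (intro order_ge_diff) (auto elim: order_ge_mono)
  thus ?thesis by (simp add: order_ge_iff_zorder \<phi>_nz)
qed

lemma zorder_P_ge: "zorder s z + (if zorder \<phi> z = 0 \<and> zorder s z = 0 then 0 else - 1) \<le> zorder P z"
proof -
  have "order_ge (\<lambda>w. deriv \<phi> w / \<phi> w - deriv s w / s w) z (if zorder \<phi> z = 0 \<and> zorder s z = 0 then 0 else - 1)"
    by (intro order_ge_diff order_ge_mono[OF order_ge_logderiv[OF \<phi>_nz]] order_ge_mono[OF order_ge_logderiv[OF s_nz]]) auto
  hence "order_ge P z (zorder s z + (if zorder \<phi> z = 0 \<and> zorder s z = 0 then 0 else - 1))"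
    unfolding P_def[abs_def] by (intro order_ge_mult) (auto simp: order_ge_iff_zorder s_nz)
  thus ?thesis by (simp add: order_ge_iff_zorder P_nz)
qed

lemma zorder_Q: "zorder Q z = zorder P z - int (n - 1) * zorder f z"
  unfolding Q_def[abs_def]
  by (simp add: nz_zorder_divide P_nz nz_meromorphic_power nz nz_zorder_power)

text \<open>Every factor in \<open>Q_identity\<close> is regular here. This excludes poles of Q at
  zeros of f, although Q is defined by dividing by a power of f.\<close>

lemma order_ge_Q:
  assumes f0: "0 \<le> zorder f z" and F0: "0 \<le> zorder F z" and \<phi>0: "zorder \<phi> z = 0"
  shows "0 \<le> zorder Q z"
proof -
  have f: "order_ge f z 0" and F: "order_ge F z 0" using f0 F0 by (auto simp: order_ge_iff_zorder nz F_nz)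
  have \<phi>: "order_ge (\<lambda>w. deriv \<phi> w / \<phi> w) z 0" using order_ge_logderiv[OF \<phi>_nz, of z] \<phi>0 by simp
  note m = order_ge_mult[where n = 0 and m = 0, simplified]
  have "order_ge (\<lambda>w. f w * F w * (deriv \<phi> w / \<phi> w) - (of_nat n * deriv f w * F w + f w * deriv F w)) z 0"
    by (intro order_ge_diff order_ge_add m f F \<phi> order_ge_deriv order_ge_const)
  moreover have "eventually (\<lambda>w. f w * F w * (deriv \<phi> w / \<phi> w) - (of_nat n * deriv f w * F w + f w * deriv F w) = Q w) (at z)"
  proof -
    have "eventually (\<lambda>w. good_point f w \<and> good_point F w \<and> good_point \<phi> w \<and> good_point s w) (cosparse UNIV)"
      by (intro eventually_conj eventually_good_point nz F_nz \<phi>_nz s_nz)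
    hence "eventually (\<lambda>w. good_point f w \<and> good_point F w \<and> good_point \<phi> w \<and> good_point s w) (at z)"
      by (rule eventually_cosparse_imp_eventually_at) auto
    thus ?thesis by eventually_elim (simp add: Q_identity)
  qed
  ultimately have "order_ge Q z 0" by (rule order_ge_cong)
  thus ?thesis by (simp add: order_ge_iff_zorder Q_nz)
qed

text \<open>With f F factored out of the identity, the rest is a combination of logarithmic
  derivatives and has at most a simple pole, so only one unit of the order of F is lost.\<close>

lemma zorder_Q_ge:
  assumes f0: "0 \<le> zorder f z"
  shows "zorder F z - 1 \<le> zorder Q z"
proof -
  have L: "order_ge (\<lambda>w. deriv h w / h w) z (- 1)" if "nz_meromorphic h" for h
    by (rule order_ge_mono[OF order_ge_logderiv[OF that]]) auto
  have "order_ge (\<lambda>w. deriv \<phi> w / \<phi> w - (of_nat n * (deriv f w / f w) + deriv F w / F w)) z (- 1)"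
    using order_ge_mult[OF order_ge_const L[OF nz], of "of_nat n"]
    by (intro order_ge_diff order_ge_add L \<phi>_nz F_nz) auto
  hence "order_ge (\<lambda>w. f w * F w * (deriv \<phi> w / \<phi> w - (of_nat n * (deriv f w / f w) + deriv F w / F w))) z (0 + zorder F z + - 1)"
    using f0 by (intro order_ge_mult) (auto simp: order_ge_iff_zorder nz F_nz)
  moreover have "eventually (\<lambda>w. f w * F w * (deriv \<phi> w / \<phi> w - (of_nat n * (deriv f w / f w) + deriv F w / F w)) = Q w) (at z)"
  proof -
    have "eventually (\<lambda>w. good_point f w \<and> good_point F w \<and> good_point \<phi> w \<and> good_point s w) (cosparse UNIV)"
      by (intro eventually_conj eventually_good_point nz F_nz \<phi>_nz s_nz)
    hence "eventually (\<lambda>w. good_point f w \<and> good_point F w \<and> good_point \<phi> w \<and> good_point s w) (at z)"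
      by (rule eventually_cosparse_imp_eventually_at) auto
    thus ?thesis by eventually_elim (simp add: Q_identity good_point_def field_simps)
  qed
  ultimately have "order_ge Q z (0 + zorder F z + - 1)" by (rule order_ge_cong)
  thus ?thesis by (simp add: order_ge_iff_zorder Q_nz)
qed

text \<open>The bounds \<open>A1\<close> for P and \<open>A2\<close> for Q are added. Each allows
  one pole at a zero of \<phi> and one per shift with a pole; in addition P is charged for a pole of
  f and Q for the full multiplicity of the poles of F. Zeros and poles of s are charged generously,
  since T(r,s) is negligible.\<close>

lemma pole_weight_P_Q:
  "pole_mult P z + pole_mult Q z \<le> 2 * pole_ind (\<lambda>z. 1 / \<phi> z) z + (\<Sum>k\<in>{1..m}. i k * pole_mult (g k) z)
     + pole_ind f z + 2 * (\<Sum>k\<in>{1..m}. pole_ind (g k) z) + 4 * pole_mult s z + 4 * pole_mult (\<lambda>z. 1 / s z) z"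
proof -
  define S1 where "S1 = (\<Sum>k\<in>{1..m}. i k * pole_mult (g k) z)"
  define S2 where "S2 = (\<Sum>k\<in>{1..m}. pole_ind (g k) z)"
  define zf where "zf = zorder f z"
  define zF where "zF = zorder F z"
  define zs where "zs = zorder s z"
  define z\<phi> where "z\<phi> = zorder \<phi> z"
  have F_ge: "- int S1 \<le> zF"
  proof -
    have "- int S1 = (\<Sum>k\<in>{1..m}. int (i k) * - int (pole_mult (g k) z))"
      by (simp add: S1_def sum_negf)
    also have "\<dots> \<le> (\<Sum>k\<in>{1..m}. int (i k) * zorder (g k) z)"
      by (intro sum_mono mult_left_mono) (auto simp: pole_mult_nz g_nz)
    finally show ?thesis by (simp add: zF_def zorder_F)
  qed
  have S2: "S1 = 0" if "S2 = 0"
  proof -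
    have "pole_ind (g k) z = 0" if "k \<in> {1..m}" for k using \<open>S2 = 0\<close> that by (auto simp: S2_def)
    hence "pole_mult (g k) z = 0" if "k \<in> {1..m}" for k using that by (fastforce simp: pole_mult_def pole_ind_def split: if_splits)
    thus ?thesis by (simp add: S1_def)
  qed
  have \<phi>_ge: "min (int n * zf + zF) zs \<le> z\<phi>" using zorder_\<phi>_ge[of z] by (simp add: zf_def zF_def zs_def z\<phi>_def)
  have P_ge: "zs + (if z\<phi> = 0 \<and> zs = 0 then 0 else - 1) \<le> zorder P z"
    using zorder_P_ge[of z] by (simp add: z\<phi>_def zs_def)
  have eqs: "pole_mult P z = nat (- zorder P z)" "pole_mult Q z = nat (- zorder Q z)"
    "pole_ind (\<lambda>z. 1 / \<phi> z) z = (if 0 < z\<phi> then 1 else 0)" "pole_ind f z = (if zf < 0 then 1 else 0)"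
    "pole_mult s z = nat (- zs)" "pole_mult (\<lambda>z. 1 / s z) z = nat zs"
    by (simp_all add: pole_mult_nz pole_ind_nz P_nz Q_nz nz s_nz \<phi>_nz nz_meromorphic_inverse nz_zorder_inverse zf_def zs_def z\<phi>_def)
  have A1: "nat (- zorder P z) \<le> (if 0 < z\<phi> then 1 else 0) + (if zf < 0 then 1 else 0) + S2 + 2 * nat (- zs) + 2 * nat zs"
  proof (cases "zs = 0")
    case True
    consider "z\<phi> = 0" | "0 < z\<phi>" | "z\<phi> < 0" by linarith
    thus ?thesis
    proof cases
      \<comment> \<open>As s has order 0, a pole of \<phi> has to come from f or from one of its
        shifts, and either one pays for the simple pole of P.\<close>
      case 3
      have "zf < 0 \<or> S2 \<noteq> 0"
      proof (rule ccontr)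
        assume "\<not> ?thesis"
        hence zf: "0 \<le> zf" and "S2 = 0" by auto
        hence "0 \<le> zF" using S2 F_ge by simp
        moreover have "0 \<le> int n * zf" using zf by simp
        ultimately show False using \<phi>_ge 3 True by linarith
      qed
      thus ?thesis using P_ge True 3 by (auto split: if_splits)
    qed (use P_ge True in \<open>auto split: if_splits\<close>)
  next
    case False
    thus ?thesis using P_ge by (auto split: if_splits)
  qed
  have A2: "nat (- zorder Q z) \<le> (if 0 < z\<phi> then 1 else 0) + S1 + S2 + 2 * nat (- zs) + 2 * nat zs"
  proof (cases "zf < 0")
    case True
    \<comment> \<open>At a pole of f the division by f^(n-1), with n >= 2, gains at least one order
      and cancels the simple pole of the logarithmic derivatives in P.\<close>
    have "1 * 1 \<le> int (n - 1) * - zf" using True n_ge by (intro mult_mono) auto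
    hence "int (n - 1) * zf \<le> - 1" unfolding mult_minus_right by linarith
    moreover have "zorder Q z = zorder P z - int (n - 1) * zf" unfolding zf_def by (rule zorder_Q)
    moreover have "zs - 1 \<le> zorder P z" using P_ge by (simp split: if_splits)
    ultimately have "zs \<le> zorder Q z" by linarith
    thus ?thesis by auto
  next
    case False
    hence zf: "0 \<le> zorder f z" by (simp add: zf_def)
    have Q1: "zF - 1 \<le> zorder Q z" using zorder_Q_ge[OF zf] by (simp add: zF_def)
    show ?thesis
    \<comment> \<open>If no shift has a pole and s has order 0, then \<phi> is regular: either Q is
      regular, too, or \<phi> vanishes and pays for a simple pole. In the other case some weight is
      available for the loss of one order.\<close>
    proof (cases "S2 = 0 \<and> zs = 0")
      case True
      hence F0: "0 \<le> zF" using S2 F_ge by simp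
      have "0 \<le> int n * zf" using zf by (simp add: zf_def)
      hence "0 \<le> z\<phi>" using \<phi>_ge F0 True by linarith
      moreover have "0 \<le> zorder Q z" if "z\<phi> = 0"
        using order_ge_Q[OF zf] F0 that by (simp add: zF_def z\<phi>_def)
      ultimately show ?thesis using Q1 F0 by (cases "z\<phi> = 0") auto
    next
      case False
      hence "1 \<le> S2 + nat (- zs) + nat zs" by auto
      thus ?thesis using Q1 F_ge by (auto split: if_splits)
    qed
  qed
  show ?thesis unfolding eqs S1_def[symmetric] S2_def[symmetric] using A1 A2 by (simp split: if_splits)
qed

section \<open>Proximity functions of \<open>P\<close> and \<open>Q\<close>\<close>

lemma eventually_all_generic:
  "eventually (\<lambda>r. 1 \<le> r \<and> generic f r \<and> generic F r \<and> generic s r \<and> generic \<phi> r \<and> generic P r \<and> generic Q r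
     \<and> (\<forall>k\<in>{1..m}. generic (g k) r)) nev_filter"
  by (intro eventually_conj eventually_r_ge eventually_generic nz F_nz s_nz \<phi>_nz P_nz Q_nz
      eventually_ball_finite ballI g_nz) simp

text \<open>Any multiple of T(r,f) is good enough as a bound: it only makes the logarithmic
  derivative lemma applicable to \<phi>.\<close>

lemma asym_le_T_\<phi>: "(\<lambda>r. nev_T r \<phi>) \<preceq> (\<lambda>r. real (n + d) * nev_T r f)"
proof -
  have "(\<lambda>r. nev_T r \<phi>) \<preceq> (\<lambda>r. real n * nev_T r f + nev_T r F + nev_T r s + ln 2)"
  proof (rule asym_leI)
    show "eventually (\<lambda>r. nev_T r \<phi> \<le> real n * nev_T r f + nev_T r F + nev_T r s + ln 2) nev_filter"
      using eventually_all_generic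
    proof eventually_elim
      case (elim r)
      have fn: "nz_meromorphic (\<lambda>z. f z ^ n)" by (rule nz_meromorphic_power[OF nz])
      have "nev_T r \<phi> \<le> nev_T r (\<lambda>z. f z ^ n * F z) + nev_T r s + ln 2"
        using elim \<phi>_nz unfolding \<phi>_def[abs_def]
        by (intro nev_T_diff_le nz_meromorphic_mult fn F_nz s_nz generic_mult generic_power) auto
      also have "nev_T r (\<lambda>z. f z ^ n * F z) \<le> nev_T r (\<lambda>z. f z ^ n) + nev_T r F"
        using elim by (intro nev_T_mult_le fn F_nz generic_power) auto
      finally show ?case using elim by (simp add: nev_T_power nz)
    qed
  qed
  also have "\<dots> \<preceq> (\<lambda>r. real n * nev_T r f + real d * nev_T r f + 0 + 0)"
    by (intro asym_le_add asym_le_T_F asym_le_T_s asym_le_const asym_leI) simp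
  finally show ?thesis by (simp add: algebra_simps)
qed

lemma asym_le_logderiv:
  assumes "nz_meromorphic h" "(\<lambda>r. nev_T r h) \<preceq> (\<lambda>r. K * nev_T r f)"
  shows "(\<lambda>r. nev_m r (\<lambda>z. deriv h z / h z)) \<preceq> (\<lambda>_. 0)"
proof (rule asym_le_log_derivative[OF assms(1), of "K + 1"])
  have "eventually (\<lambda>r. nev_T r h \<le> K * nev_T r f + 1 * nev_T r f) nev_filter"
    using assms(2) zero_less_one unfolding asym_le_def by blast
  thus "eventually (\<lambda>r. nev_T r h \<le> (K + 1) * nev_T r f) nev_filter" by (simp add: algebra_simps)
qed

lemma asym_le_logderivs:
  "(\<lambda>r. nev_m r (\<lambda>z. deriv \<phi> z / \<phi> z)) \<preceq> (\<lambda>_. 0)"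
  "(\<lambda>r. nev_m r (\<lambda>z. deriv s z / s z)) \<preceq> (\<lambda>_. 0)"
  "(\<lambda>r. nev_m r (\<lambda>z. deriv f z / f z)) \<preceq> (\<lambda>_. 0)"
  "(\<lambda>r. nev_m r (\<lambda>z. deriv F z / F z)) \<preceq> (\<lambda>_. 0)"
proof -
  show "(\<lambda>r. nev_m r (\<lambda>z. deriv \<phi> z / \<phi> z)) \<preceq> (\<lambda>_. 0)" by (rule asym_le_logderiv[OF \<phi>_nz asym_le_T_\<phi>])
  show "(\<lambda>r. nev_m r (\<lambda>z. deriv F z / F z)) \<preceq> (\<lambda>_. 0)" by (rule asym_le_logderiv[OF F_nz asym_le_T_F])
  show "(\<lambda>r. nev_m r (\<lambda>z. deriv f z / f z)) \<preceq> (\<lambda>_. 0)"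
    by (rule asym_le_logderiv[OF nz, of 1]) (simp add: asym_leI)
  show "(\<lambda>r. nev_m r (\<lambda>z. deriv s z / s z)) \<preceq> (\<lambda>_. 0)"
    by (rule asym_le_logderiv[OF s_nz, of 0]) (simp add: asym_le_T_s)
qed

lemma asym_le_m_P: "(\<lambda>r. nev_m r P) \<preceq> (\<lambda>_. 0)"
proof -
  have "(\<lambda>r. nev_m r P) \<preceq> (\<lambda>r. nev_T r s + ((nev_m r (\<lambda>z. deriv \<phi> z / \<phi> z) + nev_m r (\<lambda>z. deriv s z / s z)) + ln 2))"
  proof (rule asym_leI)
    show "eventually (\<lambda>r. nev_m r P \<le> nev_T r s + ((nev_m r (\<lambda>z. deriv \<phi> z / \<phi> z) + nev_m r (\<lambda>z. deriv s z / s z)) + ln 2)) nev_filter"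
      using eventually_all_generic
    proof eventually_elim
      case (elim r)
      have c: "continuous_on (sphere 0 r) s" "continuous_on (sphere 0 r) (\<lambda>z. deriv \<phi> z / \<phi> z)"
        "continuous_on (sphere 0 r) (\<lambda>z. deriv s z / s z)"
        using elim by (intro generic_continuous generic_logderiv_continuous; simp)+
      have "nev_m r P \<le> nev_m r s + nev_m r (\<lambda>z. deriv \<phi> z / \<phi> z - deriv s z / s z)"
        unfolding P_def[abs_def] using elim by (intro nev_m_mult_le continuous_on_diff c) simp
      also have "nev_m r s \<le> nev_T r s" using elim by (simp add: nev_T_def nev_N_nonneg nz_meromorphicD[OF s_nz])
      also have "nev_m r (\<lambda>z. deriv \<phi> z / \<phi> z - deriv s z / s z)
          \<le> nev_m r (\<lambda>z. deriv \<phi> z / \<phi> z) + nev_m r (\<lambda>z. deriv s z / s z) + ln 2"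
        using elim by (intro nev_m_diff_le c) simp
      finally show ?case by simp
    qed
  qed
  also have "\<dots> \<preceq> (\<lambda>r. 0 + ((0 + 0) + 0))"
    by (intro asym_le_add asym_le_T_s asym_le_logderivs asym_le_const)
  finally show ?thesis by simp
qed

text \<open>Clunie's argument: where \<open>|f| \<ge> 1\<close> one has \<open>|Q| \<le> |P|\<close>; where \<open>|f| < 1\<close> the factor
  \<open>f F\<close> is dominated by the product of the quotients \<open>f(z + c\<^sub>k) / f(z)\<close>.\<close>

lemma asym_le_m_Q: "(\<lambda>r. nev_m r Q) \<preceq> (\<lambda>_. 0)"
proof -
  define X where "X r = nev_m r P + ((\<Sum>k\<in>{1..m}. real (i k) * nev_m r (\<lambda>z. f (z + c k) / f z))
      + (nev_m r (\<lambda>z. deriv \<phi> z / \<phi> z) + (nev_m r (\<lambda>z. deriv f z / f z) + (nev_m r (\<lambda>z. deriv F z / F z) + (log_plus (real n) + 2 * ln 2)))))" for r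
  have "(\<lambda>r. nev_m r Q) \<preceq> X"
  proof (rule asym_leI)
    show "eventually (\<lambda>r. nev_m r Q \<le> X r) nev_filter"
      using eventually_all_generic
    proof eventually_elim
      case (elim r)
      define D where "D h z = deriv h z / h z" for h :: "complex \<Rightarrow> complex" and z
      define q where "q k z = f (z + c k) / f z" for k z
      define A where "A z = (\<Prod>k\<in>{1..m}. q k z ^ i k)" for z
      define E where "E z = D \<phi> z - (of_nat n * D f z + D F z)" for z
      have r0: "0 \<le> r" using elim by simp
      have cD: "continuous_on (sphere 0 r) (D h)" if "generic h r" for h
        unfolding D_def[abs_def] by (rule generic_logderiv_continuous[OF that])
      have cq: "continuous_on (sphere 0 r) (q k)" if "k \<in> {1..m}" for k
        unfolding q_def[abs_def] using elim that generic_nonzero[of f r]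
        by (intro continuous_on_divide generic_continuous) auto
      have cA: "continuous_on (sphere 0 r) A" unfolding A_def[abs_def] by (intro continuous_on_prod continuous_on_power cq)
      have gen: "generic \<phi> r" "generic f r" "generic F r" "generic s r" "generic P r" "generic Q r" using elim by auto
      note cs = continuous_on_mult[OF continuous_on_const[of _ "of_nat n"] cD[OF gen(2)]]
      note cf = continuous_on_add[OF cs cD[OF gen(3)]]
      have cE: "continuous_on (sphere 0 r) E" unfolding E_def[abs_def] by (rule continuous_on_diff[OF cD[OF gen(1)] cf])
      have "nev_m r Q \<le> nev_m r P + nev_m r (\<lambda>z. A z * E z) + 0"
      proof (rule nev_m_le_add[OF generic_continuous[OF gen(6)] generic_continuous[OF gen(5)] continuous_on_mult[OF cA cE] r0])
        fix z assume z: "cmod z = r"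
        have gp: "good_point f z" "good_point F z" "good_point \<phi> z" "good_point s z"
          using gen z by (auto simp: generic_def)
        have fz: "f z \<noteq> 0" "F z \<noteq> 0" using gp by (auto simp: good_point_def)
        show "log_plus (cmod (Q z)) \<le> log_plus (cmod (P z)) + log_plus (cmod (A z * E z)) + 0"
        proof (cases "1 \<le> cmod (f z)")
          case True
          have "1 \<le> cmod (f z) ^ (n - 1)" using True by (rule one_le_power)
          hence "cmod (P z) / cmod (f z) ^ (n - 1) \<le> cmod (P z) / 1" by (intro divide_left_mono) auto
          hence "log_plus (cmod (Q z)) \<le> log_plus (cmod (P z))"
            by (intro log_plus_mono) (simp add: Q_def norm_divide norm_power)
          thus ?thesis using log_plus_nonneg[of "cmod (A z * E z)"] by linarith
        next
          case False
          hence f1: "cmod (f z) \<le> 1" by simp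
          \<comment> \<open>The factor |f| is discarded, then each |f(z + c_k)| is divided by |f(z)|
            <= 1, which only enlarges it.\<close>
          have "cmod (f z) * cmod (F z) \<le> 1 * cmod (F z)" using f1 by (intro mult_right_mono) auto
          also have "1 * cmod (F z) = (\<Prod>k\<in>{1..m}. cmod (f (z + c k)) ^ i k)"
            unfolding F_eq by (simp add: prod_norm[symmetric] norm_power)
          also have "\<dots> \<le> (\<Prod>k\<in>{1..m}. cmod (q k z) ^ i k)"
          proof (intro prod_mono conjI power_mono)
            fix k
            have "cmod (f (z + c k)) / 1 \<le> cmod (f (z + c k)) / cmod (f z)"
              using f1 fz by (intro divide_left_mono) auto
            thus "cmod (f (z + c k)) \<le> cmod (q k z)" by (simp add: q_def norm_divide)
          qed auto
          also have "\<dots> = cmod (A z)" by (simp add: A_def prod_norm[symmetric] norm_power)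
          finally have "cmod (f z) * cmod (F z) * cmod (E z) \<le> cmod (A z) * cmod (E z)" by (intro mult_right_mono) auto
          moreover have "Q z = f z * F z * E z"
            unfolding Q_identity[OF gp] E_def D_def using fz by (simp add: field_simps)
          ultimately have "log_plus (cmod (Q z)) \<le> log_plus (cmod (A z * E z))"
            by (intro log_plus_mono) (simp add: norm_mult)
          thus ?thesis using log_plus_nonneg[of "cmod (P z)"] by linarith
        qed
      qed
      also have "nev_m r (\<lambda>z. A z * E z) \<le> nev_m r A + nev_m r E" by (rule nev_m_mult_le[OF cA cE r0])
      also have "nev_m r A \<le> (\<Sum>k\<in>{1..m}. real (i k) * nev_m r (q k))"
        unfolding A_def[abs_def] using r0 cq by (intro nev_m_prod_le) auto
      also have "nev_m r E \<le> nev_m r (D \<phi>) + nev_m r (\<lambda>z. of_nat n * D f z + D F z) + ln 2"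
        unfolding E_def[abs_def] by (rule nev_m_diff_le[OF cD[OF gen(1)] cf r0])
      also have "nev_m r (\<lambda>z. of_nat n * D f z + D F z) \<le> nev_m r (\<lambda>z. of_nat n * D f z) + nev_m r (D F) + ln 2"
        by (rule nev_m_add_le[OF cs cD[OF gen(3)] r0])
      also have "nev_m r (\<lambda>z. of_nat n * D f z) \<le> log_plus (real n) + nev_m r (D f)"
        using nev_m_mult_le[OF continuous_on_const[of _ "of_nat n"] cD[OF gen(2)] r0] by simp
      finally show ?case by (simp add: X_def D_def[abs_def] q_def[abs_def])
    qed
  qed
  also have "X \<preceq> (\<lambda>r. 0 + ((\<Sum>k\<in>{1..m}. real (i k) * 0) + (0 + (0 + (0 + 0)))))"
    unfolding X_def[abs_def]
    by (intro asym_le_add asym_le_sum asym_le_cmult asym_le_m_P asym_le_m_quotient asym_le_logderivs asym_le_const) auto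
  finally show ?thesis by simp
qed

text \<open>Integrating \<open>pole_weight_P_Q\<close> bounds N(r,P) + N(r,Q) by counting functions
  of shifted weights. Removing the shifts turns them into d_F N(r,f) and 2m times the reduced
  counting function, up to o(T(r,f)).\<close>

lemma main_inequality:
  "(\<lambda>r. (real n - 1) * nev_T r f - real d * nev_N r f - (2 * real m + 1) * nev_Nbar r f)
     \<preceq> (\<lambda>r. 2 * nev_Nbar r (\<lambda>z. 1 / \<phi> z))"
proof -
  have Qi: "nz_meromorphic (\<lambda>z. 1 / Q z)" and si: "nz_meromorphic (\<lambda>z. 1 / s z)" and \<phi>i: "nz_meromorphic (\<lambda>z. 1 / \<phi> z)"
    by (intro nz_meromorphic_inverse Q_nz s_nz \<phi>_nz)+
  obtain C where C: "\<And>r. generic Q r \<Longrightarrow> nev_T r Q = nev_T r (\<lambda>z. 1 / Q z) + C"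
    using first_main_theorem[OF Q_nz] by blast
  obtain Cs where Cs: "\<And>r. generic s r \<Longrightarrow> nev_T r s = nev_T r (\<lambda>z. 1 / s z) + Cs"
    using first_main_theorem[OF s_nz] by blast
  define W1 where "W1 k z = pole_mult f (z + c k)" for k z
  define W2 where "W2 k z = pole_ind f (z + c k)" for k z
  define B where "B r = 2 * nev_Nbar r (\<lambda>z. 1 / \<phi> z) + (\<Sum>k\<in>{1..m}. real (i k) * weighted_N (W1 k) r)
      + weighted_N (pole_ind f) r + 2 * (\<Sum>k\<in>{1..m}. weighted_N (W2 k) r)" for r
  have fm: "f meromorphic_on UNIV" by (rule nz_meromorphicD(1)[OF nz])
  have lfW: "locally_finite_weight (W1 k)" "locally_finite_weight (W2 k)" for k
    unfolding W1_def[abs_def] W2_def[abs_def]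
    by (intro locally_finite_weight_shift locally_finite_pole_mult locally_finite_pole_ind fm)+
  \<comment> \<open>Solving the definition of Q for the power of f; its characteristic is exactly n
    - 1 times that of f.\<close>
  have "eventually (\<lambda>z. f z ^ (n - 1) = P z * (1 / Q z)) (cosparse UNIV)"
    using nz_meromorphicD(3)[OF nz] nz_meromorphicD(3)[OF P_nz] by eventually_elim (simp add: Q_def)
  hence T_eq: "eventually (\<lambda>r. nev_T r (\<lambda>z. f z ^ (n - 1)) = nev_T r (\<lambda>z. P z * (1 / Q z))) nev_filter"
    by (intro eventually_nev_T_cong nz_meromorphic_mult nz_meromorphic_power nz P_nz Qi)
  have "(\<lambda>r. (real n - 1) * nev_T r f) \<preceq> (\<lambda>r. B r + (nev_m r P + nev_m r Q + - C + 4 * nev_T r s + 4 * (nev_T r s + - Cs)))"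
  proof (rule asym_leI)
    show "eventually (\<lambda>r. (real n - 1) * nev_T r f \<le> B r + (nev_m r P + nev_m r Q + - C + 4 * nev_T r s + 4 * (nev_T r s + - Cs))) nev_filter"
      using T_eq eventually_all_generic
    proof eventually_elim
      case (elim r)
      have r1: "1 \<le> r" and G: "generic f r" "generic s r" "generic P r" "generic Q r" using elim by auto
      have nn: "real n - 1 = real (n - 1)" using n_ge by simp
      have "real (n - 1) * nev_T r f = nev_T r (\<lambda>z. P z * (1 / Q z))"
        using elim(1) r1 by (simp add: nev_T_power nz)
      also have "\<dots> \<le> nev_T r P + nev_T r (\<lambda>z. 1 / Q z)"
        by (rule nev_T_mult_le[OF P_nz Qi G(3) generic_inverse[OF G(4)] r1])
      finally have 1: "real (n - 1) * nev_T r f \<le> nev_m r P + nev_m r Q - C + (nev_N r P + nev_N r Q)"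
        using C[OF G(4)] by (simp add: nev_T_def)
      have lf: "locally_finite_weight (pole_mult h)" "locally_finite_weight (pole_ind h)" if "nz_meromorphic h" for h
        by (intro locally_finite_pole_mult locally_finite_pole_ind nz_meromorphicD that)+
      have NN: "nev_N r h = weighted_N (pole_mult h) r" "nev_Nbar r h = weighted_N (pole_ind h) r" if "nz_meromorphic h" for h
        using r1 nz_meromorphicD(1)[OF that] by (auto intro: nev_N_eq nev_Nbar_eq)
      \<comment> \<open>Nested to the left, so that the facts \<open>l2\<close> to \<open>l6\<close>
        split off one summand at a time.\<close>
      define w where "w z = ((((2 * pole_ind (\<lambda>z. 1 / \<phi> z) z + (\<Sum>k\<in>{1..m}. i k * W1 k z))
         + pole_ind f z) + 2 * (\<Sum>k\<in>{1..m}. W2 k z)) + 4 * pole_mult s z) + 4 * pole_mult (\<lambda>z. 1 / s z) z" for z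
      have lW: "locally_finite_weight (\<lambda>z. 2 * pole_ind (\<lambda>z. 1 / \<phi> z) z)" "locally_finite_weight (\<lambda>z. \<Sum>k\<in>{1..m}. i k * W1 k z)"
        "locally_finite_weight (pole_ind f)" "locally_finite_weight (\<lambda>z. 2 * (\<Sum>k\<in>{1..m}. W2 k z))"
        "locally_finite_weight (\<lambda>z. 4 * pole_mult s z)" "locally_finite_weight (\<lambda>z. 4 * pole_mult (\<lambda>z. 1 / s z) z)"
        by (intro locally_finite_weight_cmult locally_finite_weight_sum lfW lf nz s_nz si \<phi>i finite_atLeastAtMost)+
      note l2 = locally_finite_weight_add[OF lW(1,2)]
      note l3 = locally_finite_weight_add[OF l2 lW(3)]
      note l4 = locally_finite_weight_add[OF l3 lW(4)]
      note l5 = locally_finite_weight_add[OF l4 lW(5)]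
      note l6 = locally_finite_weight_add[OF l5 lW(6)]
      have "nev_N r P + nev_N r Q = weighted_N (\<lambda>z. pole_mult P z + pole_mult Q z) r"
        by (simp only: weighted_N_add[OF lf(1)[OF P_nz] lf(1)[OF Q_nz]] NN[OF P_nz] NN[OF Q_nz])
      also have "\<dots> \<le> weighted_N w r"
      proof (rule weighted_N_mono_weight[OF _ _ r1])
        show "locally_finite_weight w" unfolding w_def[abs_def] by (rule l6)
        show "pole_mult P z + pole_mult Q z \<le> w z" for z
          using pole_weight_P_Q[of z] unfolding w_def W1_def W2_def by (simp only: pole_mult_shift[OF nz] pole_ind_shift[OF nz])
      qed
      also have "weighted_N w r = B r + 4 * nev_N r s + 4 * nev_N r (\<lambda>z. 1 / s z)"
      proof -
        have a1: "weighted_N (\<lambda>z. 2 * pole_ind (\<lambda>z. 1 / \<phi> z) z) r = 2 * weighted_N (pole_ind (\<lambda>z. 1 / \<phi> z)) r"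
          "weighted_N (\<lambda>z. 4 * pole_mult s z) r = 4 * weighted_N (pole_mult s) r"
          "weighted_N (\<lambda>z. 4 * pole_mult (\<lambda>z. 1 / s z) z) r = 4 * weighted_N (pole_mult (\<lambda>z. 1 / s z)) r"
          by (simp_all add: weighted_N_cmult lf \<phi>i s_nz si)
        have a2: "weighted_N (\<lambda>z. \<Sum>k\<in>{1..m}. i k * W1 k z) r = (\<Sum>k\<in>{1..m}. real (i k) * weighted_N (W1 k) r)"
          by (subst weighted_N_sum[OF finite_atLeastAtMost locally_finite_weight_cmult[OF lfW(1)]])
             (simp only: weighted_N_cmult[OF lfW(1)])
        have a3: "weighted_N (\<lambda>z. 2 * (\<Sum>k\<in>{1..m}. W2 k z)) r = 2 * (\<Sum>k\<in>{1..m}. weighted_N (W2 k) r)"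
          by (subst weighted_N_cmult[OF locally_finite_weight_sum[OF finite_atLeastAtMost lfW(2)]],
              subst weighted_N_sum[OF finite_atLeastAtMost lfW(2)]) simp
        show ?thesis
          unfolding w_def[abs_def] B_def NN[OF \<phi>i] NN[OF s_nz] NN[OF si]
          by (simp only: weighted_N_add[OF l5 lW(6)] weighted_N_add[OF l4 lW(5)] weighted_N_add[OF l3 lW(4)]
              weighted_N_add[OF l2 lW(3)] weighted_N_add[OF lW(1,2)] a1 a2 a3)
      qed
      finally have 2: "nev_N r P + nev_N r Q \<le> B r + 4 * nev_N r s + 4 * nev_N r (\<lambda>z. 1 / s z)" .
      have "nev_N r s \<le> nev_T r s" "nev_N r (\<lambda>z. 1 / s z) \<le> nev_T r (\<lambda>z. 1 / s z)"
        using r1 G(2) generic_inverse[OF G(2)] by (simp_all add: nev_T_def nev_m_nonneg generic_continuous)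
      hence "nev_N r P + nev_N r Q \<le> B r + 4 * nev_T r s + 4 * nev_T r (\<lambda>z. 1 / s z)" using 2 by linarith
      also have "nev_T r (\<lambda>z. 1 / s z) = nev_T r s + - Cs" using Cs[OF G(2)] by linarith
      finally show ?case unfolding nn by (intro order_trans[OF 1]) linarith
    qed
  qed
  also have "\<dots> \<preceq> (\<lambda>r. B r + (0 + 0 + 0 + 4 * 0 + 4 * (0 + 0)))"
    by (intro asym_le_add asym_le_cmult asym_le_m_P asym_le_m_Q asym_le_const asym_le_T_s asym_leI) auto
  also have "\<dots> = B" by simp
  also have "B \<preceq> (\<lambda>r. 2 * nev_Nbar r (\<lambda>z. 1 / \<phi> z) + (\<Sum>k\<in>{1..m}. real (i k) * weighted_N (pole_mult f) r)
      + weighted_N (pole_ind f) r + 2 * (\<Sum>k\<in>{1..m}. weighted_N (pole_ind f) r))"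
    unfolding B_def[abs_def] W1_def[abs_def] W2_def[abs_def]
    by (intro asym_le_add asym_le_sum asym_le_cmult asym_le_weighted_N_shift pole_ind_le_mult nz asym_leI) auto
  finally have fin: "(\<lambda>r. (real n - 1) * nev_T r f) \<preceq> (\<lambda>r. 2 * nev_Nbar r (\<lambda>z. 1 / \<phi> z) + (\<Sum>k\<in>{1..m}. real (i k) * weighted_N (pole_mult f) r)
      + weighted_N (pole_ind f) r + 2 * (\<Sum>k\<in>{1..m}. weighted_N (pole_ind f) r))" .
  show ?thesis unfolding asym_le_def
  proof (intro allI impI)
    fix e :: real assume "0 < e"
    hence "eventually (\<lambda>r. (real n - 1) * nev_T r f \<le> 2 * nev_Nbar r (\<lambda>z. 1 / \<phi> z) + (\<Sum>k\<in>{1..m}. real (i k) * weighted_N (pole_mult f) r)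
      + weighted_N (pole_ind f) r + 2 * (\<Sum>k\<in>{1..m}. weighted_N (pole_ind f) r) + e * nev_T r f) nev_filter"
      using fin unfolding asym_le_def by blast
    thus "eventually (\<lambda>r. (real n - 1) * nev_T r f - real d * nev_N r f - (2 * real m + 1) * nev_Nbar r f
        \<le> 2 * nev_Nbar r (\<lambda>z. 1 / \<phi> z) + e * nev_T r f) nev_filter"
      using eventually_r_ge[of 1]
    proof eventually_elim
      case (elim r)
      have "(\<Sum>k\<in>{1..m}. real (i k) * weighted_N (pole_mult f) r) = real d * nev_N r f"
        using elim fm by (simp add: shift_monomial_degree_def sum_distrib_right nev_N_eq)
      moreover have "weighted_N (pole_ind f) r = nev_Nbar r f" using elim fm by (simp add: nev_Nbar_eq)
      ultimately show ?case using elim(1) by (simp add: algebra_simps)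
    qed
  qed
qed

end

theorem corollary1p1:
  fixes f s :: "complex \<Rightarrow> complex"
  assumes "transcendental_meromorphic f"
    and "hyper_order f < 1"
    and "small_function f s"
    and "\<not> eventually (\<lambda>z. s z = 0) (cosparse UNIV)"
  shows "(\<forall>(m::nat) (c::nat \<Rightarrow> complex) (i::nat \<Rightarrow> nat) (n::nat).
            m \<ge> 1 \<and> (\<forall>k\<in>{1..m}. i k > 0) \<and> (\<forall>k\<in>{1..m}. c k \<noteq> 0) \<and> inj_on c {1..m} \<and>
            n > shift_monomial_degree m i \<longrightarrow>
            (\<exists>S\<in>nev_S f. \<forall>r>0.
               2 * nev_Nbar r (\<lambda>z. 1 / (f z ^ n * shift_monomial m c i f z - s z)) \<ge>
                 (real n - 1) * nev_T r f - real (shift_monomial_degree m i) * nev_N r f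
                 - (2 * real m + 1) * nev_Nbar r f + S r))
       \<and> (\<forall>(\<eta>::complex) (n::nat).
            \<eta> \<noteq> 0 \<and> n > 1 \<longrightarrow>
            (\<exists>S\<in>nev_S f. \<forall>r>0.
               2 * nev_Nbar r (\<lambda>z. 1 / (f z ^ n * f (z + \<eta>) - s z)) \<ge>
                 (real n - 1) * nev_T r f - nev_N r f - 3 * nev_Nbar r f + S r))"
    (is "?general \<and> ?special")
proof -
  interpret small_hyper_order f by unfold_locales (fact assms)+
  have general: "\<exists>S\<in>nev_S f. \<forall>r>0.
               2 * nev_Nbar r (\<lambda>z. 1 / (f z ^ n * shift_monomial m c i f z - s z)) \<ge>
                 (real n - 1) * nev_T r f - real (shift_monomial_degree m i) * nev_N r f
                 - (2 * real m + 1) * nev_Nbar r f + S r"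
    if "m \<ge> 1" "\<forall>k\<in>{1..m}. i k > 0" "n > shift_monomial_degree m i"
    for m n :: nat and c :: "nat \<Rightarrow> complex" and i :: "nat \<Rightarrow> nat"
  proof -
    interpret shift_monomial_value f s m n c i by unfold_locales (use assms that in auto)
    \<comment> \<open>The witness for S is the truncated defect of the inequality, which is why the
      claim holds for every radius and not just off an exceptional set.\<close>
    from asym_le_imp_nev_S[OF main_inequality] show ?thesis
      by (rule bexI[rotated]) (auto simp: \<phi>_def min_def)
  qed
  have ?special
  proof (intro allI impI)
    fix \<eta> :: complex and n :: nat assume "\<eta> \<noteq> 0 \<and> n > 1"
    thus "\<exists>S\<in>nev_S f. \<forall>r>0. 2 * nev_Nbar r (\<lambda>z. 1 / (f z ^ n * f (z + \<eta>) - s z)) \<ge>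
                 (real n - 1) * nev_T r f - nev_N r f - 3 * nev_Nbar r f + S r"
      using general[of 1 "\<lambda>_. 1" n "\<lambda>_. \<eta>"] by (simp add: shift_monomial_def shift_monomial_degree_def)
  qed
  thus ?thesis using general by blast
qed

end
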